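(* Let $N\geq 2$, let $t$ be a central indeterminate element (e.g. a parameter) in $\mathcal{O}$, and let $\mathcal{C}_N=\sum_{k=0}^N\sigma_{q,Q}(k)t^{N-k}$, which is a central element and which is formally inverted. Then $tI_N+XY$ is invertible and, for all $i,j\in[N]$, $$\big((tI_N+XY)^{-1}\big)_{ij}=\frac{1}{\mathcal{C}_N}\sum_{\substack{K\subset[N]\\ i,j\in K}}t^{N-|K|}(-q)_{i<K}(-q)_{K>j}\sum_{L\in\binom{[N]}{|K|-1}}[D'Y]_{q,Q,L,K\setminus\{i\}}\,[XD']_{q,Q,K\setminus\{j\},L}.$$ In particular, with the factors arranged in this order (all minors in the numerator expanded into words in the $Y_{ab}$ and $X_{ab}$), every coefficient is, up to sign, a power of $t$ times a product of integral powers of $q$ and of the $q_{ab}$ (hence, up to sign, a power of $t$ times an integral power of $q$ when $q_{ab}=q$ for all $a\ne b$), so that no term vanishes when $q\to1$.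
   Context: Let $N\ge 1$ be an integer and $[N]=\{1,\dots,N\}$. Let $q$ and $q_{ij}$ ($i,j\in[N]$) be commuting invertible indeterminates subject only to $q_{ii}=1$ and $q_{ij}q_{ji}=q^2$ for $i\neq j$ (so $q$ and the $q_{ij}$ with $i<j$ are independent), and let $F$ be the field of rational functions over $\mathbb{C}$ in them; $Q=(q_{ij})$. With $e_{ij}$ the matrix units of size $N$, put $R=\sum_{i,j=1}^N q_{ij}e_{ii}\otimes e_{jj}+(1-q^2)\sum_{1\le i<j\le N}e_{ij}\otimes e_{ji}$, $\Sigma=\sum_{i,j}e_{ij}\otimes e_{ji}$ and $\hat R=\Sigma R$. For an $N\times N$ matrix $M$ over an $F$-algebra, $M_{0k}=\sum_{i,j}M_{ij}\otimes e_{ij}$ with $e_{ij}$ placed in the $k$-th leg of a tensor power of $M_N(F)$; $R_{12}$ is $R$ in legs 1,2 and $\hat R_{k,k+1}$ is $\hat R$ in legs $k,k+1$. $\mathcal{O}=\mathcal{O}_{q,Q}^{\mathbb R}(M_N(\mathbb C))$ is the unital associative $F$-algebra generated by the entries of $X=(X_{ij})$ and $Y=(Y_{ij})$ ($i,j\in[N]$) with relations $R_{12}X_{01}X_{02}=X_{02}X_{01}R_{12}$, $R_{12}Y_{02}Y_{01}=Y_{01}Y_{02}R_{12}$, $X_{01}R_{12}Y_{02}=Y_{02}R_{12}X_{01}$. It carries the involutive anti-automorphism $^*$ (complex conjugation on $\mathbb C$) with $q^*=q$, $q_{ij}^*=q_{ji}$, $X_{ij}^*=Y_{ji}$. The indeterminate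 $t$ is adjoined to $\mathcal O$ so as to be central. For a function $\sigma:I\to\mathbb N$ with $I\subset\mathbb N$ finite, put $(-q)_{\sigma,r}=\prod_{i<j,\ \sigma(i)>\sigma(j)}(-q_{\sigma(i)\sigma(j)})$ and $(-q)_{\sigma,c}=\prod_{i<j,\ \sigma(i)>\sigma(j)}(-q_{\sigma(j)\sigma(i)})$ (products over $i,j\in I$). Coefficients: let $[n]=1+q^2+\dots+q^{2(n-1)}$, $[n]!=[1]\cdots[n]$, $[0]!=1$. Let $u=\sum_{\sigma\in S_N}(-q)_{\sigma,c}\,e_{\sigma(1)}\otimes\dots\otimes e_{\sigma(N)}\in (F^N)^{\otimes N}$ (column vector), $v=u^*$ the row vector $\sum_{\sigma\in S_N}(-q)_{\sigma,r}\,e_{\sigma(1)}^T\otimes\dots\otimes e_{\sigma(N)}^T$, and $\alpha_i=\frac{1}{[N]!}\frac{[N]!}{[i]!\,[N-i]!}$. Then $\sigma_{q,Q}(0)=1$ and for $1\le i\le N$ $$\sigma_{q,Q}(i)=q^{-(i-1)i}\alpha_i\,v\,\big((XY)_{01}\hat R_{12}\hat R_{23}\cdots\hat R_{i-1,i}\big)^i u\in\mathcal{O}.$$ For $K\subset[N]$ and $i,j\in[N]$: $(-q)_{i<K}=\prod_{k\in K,\ i<k}(-q_{ik})$ and $(-q)_{K>j}=\prod_{k\in K,\ k>j}(-q_{kj})$. Minors: $\binom{[N]}{i}$ is the set of $i$-element subsets $J=\{j_1<\dots<j_i\}$ of $[N]$. With $D'=\mathrm{diag}(q^{N-1},\dots,q,1)$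 and $M=XD'$, for $J,K\in\binom{[N]}{i}$, $[XD']_{q,Q,J,K}=\sum_{\tau:[i]\to K\text{ bijective}}(-q)_{\tau,c}M_{j_1\tau(1)}\cdots M_{j_i\tau(i)}$, with value $1$ for $J=K=\emptyset$, and $[D'Y]_{q,Q,J,K}=[XD']_{q,Q,K,J}^*$. *)

theory Defs
  imports
    "HOL-Analysis.Analysis"
    "HOL-Library.Poly_Mapping"
    "HOL-Computational_Algebra.Fraction_Field"
begin

(* The index set [N] is rendered by a finite linearly ordered type 'n with CARD('n) = N;
   such a type is order isomorphic to [N] in exactly one way. *)

section \<open>Auxiliary facts on \<open>\<Rightarrow>\<^sub>0\<close>\<close>

lemma poly_mapping_sum_single:
  "f = (\<Sum>k\<in>Poly_Mapping.keys f. Poly_Mapping.single k (Poly_Mapping.lookup f k))"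
  by (rule poly_mapping_eqI)
    (auto simp: lookup_sum lookup_single when_def in_keys_iff sum.delta)

lemma additive_sum:
  fixes F :: "'a::comm_monoid_add \<Rightarrow> 'b::comm_monoid_add"
  assumes "F 0 = 0" and "\<And>x y. F (x + y) = F x + F y"
  shows "F (sum g A) = (\<Sum>a\<in>A. F (g a))"
  using assms by (induction A rule: infinite_finite_induct) auto

lemma multiplicative_from_singles:
  fixes F :: "('a::monoid_add \<Rightarrow>\<^sub>0 'b::semiring_0) \<Rightarrow> 'c::semiring_0"
  assumes z: "F 0 = 0" and add: "\<And>x y. F (x + y) = F x + F y"
    and s: "\<And>a b x y. F (Poly_Mapping.single (a + b) (x * y))
              = F (Poly_Mapping.single a x) * F (Poly_Mapping.single b y)"
  shows "F (f * g) = F f * F g"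
proof -
  let ?S = "\<lambda>h k. Poly_Mapping.single k (Poly_Mapping.lookup h k)"
  have "f * g = (\<Sum>k\<in>Poly_Mapping.keys f. ?S f k) * (\<Sum>k\<in>Poly_Mapping.keys g. ?S g k)"
    using poly_mapping_sum_single[of f] poly_mapping_sum_single[of g] by simp
  also have "\<dots> = (\<Sum>k\<in>Poly_Mapping.keys f. \<Sum>l\<in>Poly_Mapping.keys g. ?S f k * ?S g l)"
    by (simp add: sum_product)
  finally have "F (f * g) = (\<Sum>k\<in>Poly_Mapping.keys f. \<Sum>l\<in>Poly_Mapping.keys g. F (?S f k * ?S g l))"
    by (simp add: additive_sum[of F, OF z add])
  also have "\<dots> = (\<Sum>k\<in>Poly_Mapping.keys f. F (?S f k)) * (\<Sum>l\<in>Poly_Mapping.keys g. F (?S g l))"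
    by (simp add: mult_single s sum_product)
  also have "(\<Sum>k\<in>Poly_Mapping.keys f. F (?S f k)) = F f"
    using additive_sum[of F, OF z add] poly_mapping_sum_single[of f] by metis
  also have "(\<Sum>k\<in>Poly_Mapping.keys g. F (?S g k)) = F g"
    using additive_sum[of F, OF z add] poly_mapping_sum_single[of g] by metis
  finally show ?thesis .
qed


section \<open>The field of rational functions in \<open>q\<close> and the \<open>q\<^sub>i\<^sub>j\<close>\<close>

(* The independent indeterminates: None stands for q and Some (i, j), i < j, for q_ij. *)

typedef (overloaded) ('n::linorder) indet =
  "{v :: ('n \<times> 'n) option. \<forall>i j. v = Some (i, j) \<longrightarrow> i < j}"
  by (rule exI[of _ None]) simp

definition ind_q :: "'n::linorder indet" where
  "ind_q = Abs_indet None"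

definition ind :: "'n::linorder \<Rightarrow> 'n \<Rightarrow> 'n indet" where
  "ind i j = Abs_indet (Some (i, j))"

(* An auxiliary order, needed only for the library's proof that monoid rings over ordered monoids
   are integral domains. *)

instantiation indet :: (linorder) linorder
begin

definition less_eq_indet :: "'a indet \<Rightarrow> 'a indet \<Rightarrow> bool" where
  "less_eq_indet x y \<longleftrightarrow>
     (case Rep_indet x of None \<Rightarrow> True
      | Some (a, b) \<Rightarrow> (case Rep_indet y of None \<Rightarrow> False
                        | Some (c, d) \<Rightarrow> a < c \<or> a = c \<and> b \<le> d))"

definition less_indet :: "'a indet \<Rightarrow> 'a indet \<Rightarrow> bool" where
  "less_indet x y \<longleftrightarrow> x \<le> y \<and> \<not> y \<le> x"

instance
proof
  fix x y z :: "'a indet"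
  show "(x < y) = (x \<le> y \<and> \<not> y \<le> x)" by (simp add: less_indet_def)
  show "x \<le> x" by (auto simp: less_eq_indet_def split: option.splits)
  show "x \<le> y \<Longrightarrow> y \<le> z \<Longrightarrow> x \<le> z"
    by (auto simp: less_eq_indet_def split: option.splits)
  show "x \<le> y \<Longrightarrow> y \<le> x \<Longrightarrow> x = y"
    by (subst Rep_indet_inject[symmetric]) (auto simp: less_eq_indet_def split: option.splits)
  show "x \<le> y \<or> y \<le> x"
    by (auto simp: less_eq_indet_def split: option.splits)
qed

end

(* Complex Laurent polynomials in the indeterminates, and their field of fractions. *)

type_synonym 'n laurent = "('n indet \<Rightarrow>\<^sub>0 int) \<Rightarrow>\<^sub>0 complex"

type_synonym 'n rat_fun = "'n laurent fract"

definition const_F :: "complex \<Rightarrow> 'n::linorder rat_fun" where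
  "const_F c = Fract (Poly_Mapping.single 0 c) 1"

definition indet_F :: "'n::linorder indet \<Rightarrow> 'n rat_fun" where
  "indet_F v = Fract (Poly_Mapping.single (Poly_Mapping.single v 1) 1) 1"

definition q :: "'n::linorder rat_fun" where
  "q = indet_F ind_q"

definition qij :: "'n::linorder \<Rightarrow> 'n \<Rightarrow> 'n rat_fun" where
  "qij i j = (if i = j then 1 else if i < j then indet_F (ind i j) else q ^ 2 / indet_F (ind j i))"

(* The involution of the field: complex conjugation on constants, q* = q and q_ij* = q_ji = q^2 / q_ij.
   On exponents, q^c (prod q_ij^m_ij) goes to q^(c + 2 sum m_ij) (prod q_ij^(-m_ij)). *)

definition total_exp :: "('n::linorder indet \<Rightarrow>\<^sub>0 int) \<Rightarrow> int" where
  "total_exp m = (\<Sum>v\<in>Poly_Mapping.keys m. Poly_Mapping.lookup m v)"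

definition star_exp :: "('n::linorder indet \<Rightarrow>\<^sub>0 int) \<Rightarrow> ('n indet \<Rightarrow>\<^sub>0 int)" where
  "star_exp m = Poly_Mapping.single ind_q (2 * total_exp m) - m"

definition star_laurent :: "'n::linorder laurent \<Rightarrow> 'n laurent" where
  "star_laurent p =
     (\<Sum>m\<in>Poly_Mapping.keys p. Poly_Mapping.single (star_exp m) (cnj (Poly_Mapping.lookup p m)))"

lemma total_exp_superset:
  "finite A \<Longrightarrow> Poly_Mapping.keys m \<subseteq> A \<Longrightarrow> total_exp m = (\<Sum>v\<in>A. Poly_Mapping.lookup m v)"
  unfolding total_exp_def by (rule sum.mono_neutral_left) (auto simp: in_keys_iff)

lemma total_exp_add: "total_exp (m + n) = total_exp m + total_exp n"
proof -
  let ?A = "Poly_Mapping.keys m \<union> Poly_Mapping.keys n"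
  have "Poly_Mapping.keys (m + n) \<subseteq> ?A" by (rule keys_add)
  then show ?thesis
    by (simp add: total_exp_superset[of ?A] lookup_add sum.distrib)
qed

lemma total_exp_uminus: "total_exp (- m) = - total_exp m"
  using total_exp_add[of m "- m"] by (simp add: total_exp_def)

lemma total_exp_diff: "total_exp (m - n) = total_exp m - total_exp n"
  using total_exp_add[of m "- n"] by (simp add: total_exp_uminus)

lemma total_exp_single: "total_exp (Poly_Mapping.single v c) = c"
  by (simp add: total_exp_def)

lemma star_exp_add: "star_exp (m + n) = star_exp m + star_exp n"
  by (simp add: star_exp_def total_exp_add distrib_left single_add)

lemma star_exp_star_exp [simp]: "star_exp (star_exp m) = m"
  by (simp add: star_exp_def total_exp_diff total_exp_single)

lemma star_exp_eq_iff: "star_exp m = k \<longleftrightarrow> m = star_exp k"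
  by auto

lemma lookup_star_laurent:
  "Poly_Mapping.lookup (star_laurent p) k = cnj (Poly_Mapping.lookup p (star_exp k))"
proof -
  have "Poly_Mapping.lookup (star_laurent p) k
      = (\<Sum>m\<in>Poly_Mapping.keys p. if m = star_exp k then cnj (Poly_Mapping.lookup p m) else 0)"
    unfolding star_laurent_def lookup_sum
    by (rule sum.cong[OF refl]) (auto simp: lookup_single when_def star_exp_eq_iff)
  also have "\<dots> = cnj (Poly_Mapping.lookup p (star_exp k))"
    by (auto simp: in_keys_iff sum.delta)
  finally show ?thesis .
qed

lemma star_laurent_0 [simp]: "star_laurent 0 = 0"
  by (simp add: star_laurent_def)

lemma star_laurent_add: "star_laurent (x + y) = star_laurent x + star_laurent y"
  by (rule poly_mapping_eqI) (simp add: lookup_star_laurent lookup_add)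

lemma star_laurent_star_laurent [simp]: "star_laurent (star_laurent p) = p"
  by (rule poly_mapping_eqI) (simp add: lookup_star_laurent)

lemma star_laurent_single:
  "star_laurent (Poly_Mapping.single m c) = Poly_Mapping.single (star_exp m) (cnj c)"
  by (cases "c = 0") (simp_all add: star_laurent_def)

lemma star_laurent_mult: "star_laurent (x * y) = star_laurent x * star_laurent y"
  by (rule multiplicative_from_singles)
    (simp_all add: star_laurent_add star_laurent_single star_exp_add mult_single)

lemma star_laurent_eq_0_iff [simp]: "star_laurent p = 0 \<longleftrightarrow> p = 0"
  by (metis star_laurent_0 star_laurent_star_laurent)

lift_definition star_F :: "'n::linorder rat_fun \<Rightarrow> 'n rat_fun" is
  "\<lambda>(a, b). (star_laurent a, star_laurent b)"
  by (auto simp: star_laurent_mult[symmetric])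

lemma star_F_Fract: "star_F (Fract a b) = Fract (star_laurent a) (star_laurent b)"
  by transfer auto

lemma star_exp_0 [simp]: "star_exp 0 = 0"
  by (simp add: star_exp_def total_exp_def)

lemma star_laurent_1 [simp]: "star_laurent 1 = 1"
  using star_laurent_single[of 0 1] by simp

lemma star_F_mult: "star_F (x * y) = star_F x * star_F y"
  by (cases x; cases y) (simp add: star_F_Fract star_laurent_mult)

lemma star_F_add: "star_F (x + y) = star_F x + star_F y"
  by (cases x; cases y) (simp add: star_F_Fract star_laurent_mult star_laurent_add)

lemma star_F_star_F [simp]: "star_F (star_F x) = x"
  by (cases x) (simp add: star_F_Fract)

lemma star_F_1 [simp]: "star_F 1 = 1"
  by (simp add: One_fract_def star_F_Fract)

lemma star_F_const: "star_F (const_F c) = const_F (cnj c)"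
  by (simp add: const_F_def star_F_Fract star_laurent_single)

lemma indet_F_neq_0 [simp]: "indet_F v \<noteq> 0"
proof -
  have "Poly_Mapping.single (Poly_Mapping.single v (1::int)) (1::complex) \<noteq> 0"
    by (metis lookup_single_eq lookup_zero zero_neq_one)
  then show ?thesis unfolding indet_F_def Zero_fract_def by (subst eq_fract) auto
qed

lemma star_F_q: "star_F q = q"
proof -
  have "star_exp (Poly_Mapping.single ind_q 1) = Poly_Mapping.single (ind_q :: 'a indet) 1"
    by (simp add: star_exp_def total_exp_single flip: single_diff)
  then show ?thesis
    by (simp add: q_def indet_F_def star_F_Fract star_laurent_single)
qed

lemma star_F_indet_F: "star_F (indet_F v) = q ^ 2 / indet_F v"
proof -
  have "star_F (indet_F v) * indet_F v = q ^ 2"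
    by (simp add: q_def indet_F_def star_F_Fract star_laurent_single star_exp_def
        total_exp_single mult_single power2_eq_square flip: single_add)
  then show ?thesis by (simp add: field_simps)
qed

lemma star_F_qij: "star_F (qij i j) = qij j i"
proof -
  have "star_F (qij i j) = qij j i" if "i < j" for i j :: 'a
    using that by (auto simp: qij_def star_F_indet_F)
  then show ?thesis
    by (metis linorder_neqE star_F_star_F qij_def star_F_1)
qed


(* Otherwise lift_definition and transfer below would unfold the scalars and the monoid ring too. *)

lifting_forget poly_mapping.lifting
lifting_forget fract.lifting


section \<open>Specialization of the parameters\<close>

definition eval_laurent :: "('n::linorder indet \<Rightarrow> complex) \<Rightarrow> 'n laurent \<Rightarrow> complex" where
  "eval_laurent \<rho> p =
     (\<Sum>m\<in>Poly_Mapping.keys p. Poly_Mapping.lookup p m *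
        (\<Prod>v\<in>Poly_Mapping.keys m. \<rho> v powi Poly_Mapping.lookup m v))"

(* The rational function x is regular at the point \<rho> (with nonzero coordinates) and has the
   value y there. The constant point z is the specialization q_ab = q = z for all a, b with a \<noteq> b. *)

definition has_value_at :: "'n::linorder rat_fun \<Rightarrow> complex \<Rightarrow> ('n indet \<Rightarrow> complex) \<Rightarrow> bool" where
  "has_value_at x y \<rho> \<longleftrightarrow>
     (\<exists>a b. x = Fract a b \<and> eval_laurent \<rho> b \<noteq> 0 \<and> y = eval_laurent \<rho> a / eval_laurent \<rho> b)"


section \<open>The free algebra on the entries of \<open>X\<close> and \<open>Y\<close>\<close>

datatype 'a freemon = Word (letters: "'a list")

instantiation freemon :: (type) monoid_add
begin

definition zero_freemon :: "'a freemon" where "0 = Word []"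

definition plus_freemon :: "'a freemon \<Rightarrow> 'a freemon \<Rightarrow> 'a freemon" where
  "v + w = Word (letters v @ letters w)"

instance by standard (simp_all add: zero_freemon_def plus_freemon_def)

end

(* Square matrices 'a ^'n ^'n; this spelling allows a sort constraint on 'n. *)

type_synonym ('a, 'n) sqmat = "(('a, 'n) vec, 'n) vec"

datatype 'n gen = GX 'n 'n | GY 'n 'n

type_synonym 'n free_alg = "'n gen freemon \<Rightarrow>\<^sub>0 'n rat_fun"

definition scal :: "'n::linorder rat_fun \<Rightarrow> 'n free_alg" where
  "scal c = Poly_Mapping.single 0 c"

definition Xfree :: "('n::{finite,linorder} free_alg, 'n) sqmat" where
  "Xfree = (\<chi> i j. Poly_Mapping.single (Word [GX i j]) 1)"

definition Yfree :: "('n::{finite,linorder} free_alg, 'n) sqmat" where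
  "Yfree = (\<chi> i j. Poly_Mapping.single (Word [GY i j]) 1)"

(* The conjugate-linear involutive anti-automorphism with X_ij* = Y_ji; it induces the one of the
   quotient algebra. *)

fun star_gen :: "'n gen \<Rightarrow> 'n gen" where
  "star_gen (GX i j) = GY j i"
| "star_gen (GY i j) = GX j i"

definition star :: "'n::linorder free_alg \<Rightarrow> 'n free_alg" where
  "star f = (\<Sum>w\<in>Poly_Mapping.keys f.
     Poly_Mapping.single (Word (rev (map star_gen (letters w)))) (star_F (Poly_Mapping.lookup f w)))"


section \<open>The R-matrix and the algebra\<close>

definition kron :: "'a::semiring_1 ^'n ^'n \<Rightarrow> 'a ^'n ^'n \<Rightarrow> 'a ^('n \<times> 'n) ^('n \<times> 'n)" where
  "kron A B = (\<chi> r s. A $ fst r $ fst s * B $ snd r $ snd s)"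

definition munit :: "'n \<Rightarrow> 'n \<Rightarrow> 'a::semiring_1 ^'n ^'n" where
  "munit i j = (\<chi> a b. if a = i \<and> b = j then 1 else 0)"

(* mat c ** A is the scalar multiple c A *)

definition Rmat :: "('n::{finite,linorder} rat_fun, 'n \<times> 'n) sqmat" where
  "Rmat = (\<Sum>i\<in>UNIV. \<Sum>j\<in>UNIV. mat (qij i j) ** kron (munit i i) (munit j j))
        + mat (1 - q ^ 2) ** (\<Sum>(i, j)\<in>{(i, j). i < j}. kron (munit i j) (munit j i))"

definition Flip :: "('n::{finite,linorder} rat_fun, 'n \<times> 'n) sqmat" where
  "Flip = (\<Sum>i\<in>UNIV. \<Sum>j\<in>UNIV. kron (munit i j) (munit j i))"

definition Rhat :: "('n::{finite,linorder} rat_fun, 'n \<times> 'n) sqmat" where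
  "Rhat = Flip ** Rmat"

definition entries :: "'a ^'m ^'n \<Rightarrow> 'a set" where
  "entries A = {A $ i $ j | i j. True}"

definition relators :: "'n::{finite,linorder} free_alg set" where
  "relators =
     (let R12 = map_matrix scal Rmat;
          X01 = kron Xfree (mat 1); X02 = kron (mat 1) Xfree;
          Y01 = kron Yfree (mat 1); Y02 = kron (mat 1) Yfree
      in entries (R12 ** X01 ** X02 - X02 ** X01 ** R12)
       \<union> entries (R12 ** Y02 ** Y01 - Y01 ** Y02 ** R12)
       \<union> entries (X01 ** R12 ** Y02 - Y02 ** R12 ** X01))"

inductive_set ideal_of :: "'a::ring_1 set \<Rightarrow> 'a set" for S :: "'a set" where
  ideal_of_0: "0 \<in> ideal_of S"
| ideal_of_gen: "s \<in> S \<Longrightarrow> a * s * b \<in> ideal_of S"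
| ideal_of_add: "x \<in> ideal_of S \<Longrightarrow> y \<in> ideal_of S \<Longrightarrow> x + y \<in> ideal_of S"

lemma ideal_of_mult_left: "x \<in> ideal_of S \<Longrightarrow> c * x \<in> ideal_of S"
proof (induction rule: ideal_of.induct)
  case (ideal_of_gen s a b)
  then show ?case using ideal_of.ideal_of_gen[of s S "c * a" b] by (simp add: mult.assoc)
qed (auto simp: distrib_left intro: ideal_of.intros)

lemma ideal_of_mult_right: "x \<in> ideal_of S \<Longrightarrow> x * c \<in> ideal_of S"
proof (induction rule: ideal_of.induct)
  case (ideal_of_gen s a b)
  then show ?case using ideal_of.ideal_of_gen[of s S a "b * c"] by (simp add: mult.assoc)
qed (auto simp: distrib_right intro: ideal_of.intros)

lemma ideal_of_uminus: "x \<in> ideal_of S \<Longrightarrow> - x \<in> ideal_of S"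
  using ideal_of_mult_left[of x S "-1"] by simp

lemma ideal_of_base: "x \<in> S \<Longrightarrow> x \<in> ideal_of S"
  using ideal_of_gen[of x S 1 1] by simp

lemma ideal_of_hom_zero:
  fixes h :: "'a::ring_1 \<Rightarrow> 'b::ring_1"
  assumes "x \<in> ideal_of S" "h 0 = 0" "\<And>x y. h (x + y) = h x + h y" "\<And>x y. h (x * y) = h x * h y"
    "\<And>s. s \<in> S \<Longrightarrow> h s = 0"
  shows "h x = 0"
  using assms by (induction rule: ideal_of.induct) auto

definition ideal_cong :: "'a::ring_1 set \<Rightarrow> 'a \<Rightarrow> 'a \<Rightarrow> bool" where
  "ideal_cong S x y \<longleftrightarrow> x - y \<in> ideal_of S"

lemma ideal_cong_refl: "ideal_cong S x x"
  by (simp add: ideal_cong_def ideal_of_0)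

lemma ideal_cong_equivp: "equivp (ideal_cong S)"
proof (rule equivpI)
  show "reflp (ideal_cong S)" by (simp add: reflp_def ideal_cong_refl)
  show "symp (ideal_cong S)"
    by (rule sympI) (use ideal_of_uminus in \<open>fastforce simp: ideal_cong_def\<close>)
  show "transp (ideal_cong S)"
    by (rule transpI) (use ideal_of_add in \<open>fastforce simp: ideal_cong_def\<close>)
qed

lemma ideal_cong_add: "ideal_cong S x y \<Longrightarrow> ideal_cong S x' y' \<Longrightarrow> ideal_cong S (x + x') (y + y')"
  using ideal_of_add[of "x - y" S "x' - y'"] by (simp add: ideal_cong_def algebra_simps)

lemma ideal_cong_uminus: "ideal_cong S x y \<Longrightarrow> ideal_cong S (- x) (- y)"
  using ideal_of_uminus[of "x - y" S] by (simp add: ideal_cong_def)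

lemma ideal_cong_diff: "ideal_cong S x y \<Longrightarrow> ideal_cong S x' y' \<Longrightarrow> ideal_cong S (x - x') (y - y')"
  using ideal_cong_add[of S x y "- x'" "- y'"] ideal_cong_uminus[of S x' y'] by simp

lemma ideal_cong_mult: "ideal_cong S x y \<Longrightarrow> ideal_cong S x' y' \<Longrightarrow> ideal_cong S (x * x') (y * y')"
  using ideal_of_add[OF ideal_of_mult_right[of "x - y" S x'] ideal_of_mult_left[of "x' - y'" S y]]
  by (simp add: ideal_cong_def algebra_simps)

(* The constant term is a character of the free algebra which kills the relators; hence the
   algebra below is nontrivial. *)

lemma const_term_mult:
  "Poly_Mapping.lookup (f * g) 0 = Poly_Mapping.lookup f 0 * Poly_Mapping.lookup g 0"
  for f g :: "'a freemon \<Rightarrow>\<^sub>0 'b::ring_1"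
proof (rule multiplicative_from_singles[where F = "\<lambda>f. Poly_Mapping.lookup f 0"])
  fix a b :: "'a freemon" and x y :: 'b
  have "a + b = 0 \<longleftrightarrow> a = 0 \<and> b = 0"
    by (cases a; cases b) (simp add: zero_freemon_def plus_freemon_def)
  then show "Poly_Mapping.lookup (Poly_Mapping.single (a + b) (x * y)) 0 =
      Poly_Mapping.lookup (Poly_Mapping.single a x) 0 * Poly_Mapping.lookup (Poly_Mapping.single b y) 0"
    by (auto simp: lookup_single when_def)
qed (simp_all add: lookup_add)

lemma const_term_gen [simp]:
  "Poly_Mapping.lookup (Xfree $ i $ j) 0 = 0" "Poly_Mapping.lookup (Yfree $ i $ j) 0 = 0"
  by (simp_all add: Xfree_def Yfree_def lookup_single zero_freemon_def)

lemma const_term_relators: "x \<in> relators \<Longrightarrow> Poly_Mapping.lookup x 0 = 0"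
  by (auto simp: relators_def Let_def entries_def matrix_matrix_mult_def kron_def lookup_minus
      lookup_sum const_term_mult)

lemma one_notin_ideal_relators: "\<not> ideal_cong relators 0 (1 :: 'n::{finite,linorder} free_alg)"
proof
  assume "ideal_cong relators 0 (1 :: 'n free_alg)"
  then have "- 1 \<in> ideal_of (relators :: 'n free_alg set)" by (simp add: ideal_cong_def)
  then have "Poly_Mapping.lookup (- 1 :: 'n free_alg) 0 = 0"
    by (rule ideal_of_hom_zero[where h = "\<lambda>f. Poly_Mapping.lookup f 0"])
      (simp_all add: lookup_add const_term_mult const_term_relators)
  then show False by simp
qed

quotient_type (overloaded) 'n OqQ = "'n::{finite,linorder} free_alg" / "ideal_cong relators"
  by (rule ideal_cong_equivp)

instantiation OqQ :: ("{finite,linorder}") ring_1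
begin

lift_definition zero_OqQ :: "'a OqQ" is 0 .
lift_definition one_OqQ :: "'a OqQ" is 1 .
lift_definition plus_OqQ :: "'a OqQ \<Rightarrow> 'a OqQ \<Rightarrow> 'a OqQ" is "(+)" by (rule ideal_cong_add)
lift_definition minus_OqQ :: "'a OqQ \<Rightarrow> 'a OqQ \<Rightarrow> 'a OqQ" is "(-)" by (rule ideal_cong_diff)
lift_definition uminus_OqQ :: "'a OqQ \<Rightarrow> 'a OqQ" is uminus by (rule ideal_cong_uminus)
lift_definition times_OqQ :: "'a OqQ \<Rightarrow> 'a OqQ \<Rightarrow> 'a OqQ" is "(*)" by (rule ideal_cong_mult)

instance
proof
  show "(0 :: 'a OqQ) \<noteq> 1" by transfer (rule one_notin_ideal_relators)
qed (transfer, simp add: algebra_simps ideal_cong_refl)+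

end

lift_definition to_O :: "'n::{finite,linorder} free_alg \<Rightarrow> 'n OqQ" is "\<lambda>f. f" .

definition scal_O :: "'n::{finite,linorder} rat_fun \<Rightarrow> 'n OqQ" where
  "scal_O c = to_O (scal c)"

definition Xmat :: "('n::{finite,linorder} OqQ, 'n) sqmat" where
  "Xmat = map_matrix to_O Xfree"

definition Ymat :: "('n::{finite,linorder} OqQ, 'n) sqmat" where
  "Ymat = map_matrix to_O Yfree"


section \<open>The elements \<open>\<sigma>\<^sub>q\<^sub>,\<^sub>Q(i)\<close>\<close>

(* (-q)_{\<sigma>,r} and (-q)_{\<sigma>,c} for \<sigma> : I -> [N] *)

definition mq_r :: "'b::linorder set \<Rightarrow> ('b \<Rightarrow> 'n::linorder) \<Rightarrow> 'n rat_fun" where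
  "mq_r I \<sigma> = (\<Prod>(i, j) \<in> {(i, j). i \<in> I \<and> j \<in> I \<and> i < j \<and> \<sigma> i > \<sigma> j}. - qij (\<sigma> i) (\<sigma> j))"

definition mq_c :: "'b::linorder set \<Rightarrow> ('b \<Rightarrow> 'n::linorder) \<Rightarrow> 'n rat_fun" where
  "mq_c I \<sigma> = (\<Prod>(i, j) \<in> {(i, j). i \<in> I \<and> j \<in> I \<and> i < j \<and> \<sigma> i > \<sigma> j}. - qij (\<sigma> j) (\<sigma> i))"

definition qint :: "nat \<Rightarrow> 'n::linorder rat_fun" where
  "qint n = (\<Sum>k<n. q ^ (2 * k))"

definition qfact :: "nat \<Rightarrow> 'n::linorder rat_fun" where
  "qfact n = (\<Prod>k=1..n. qint k)"

definition alpha :: "nat \<Rightarrow> 'n::{finite,linorder} rat_fun" where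
  "alpha i = 1 / qfact CARD('n) * (qfact CARD('n) / (qfact i * qfact (CARD('n) - i)))"

(* The N-th tensor power of F^N: its legs are indexed by 'n and its standard basis by the maps
   a : legs -> [N], with e_{a(1)} \<otimes> ... \<otimes> e_{a(N)} = axis a 1. The k-th leg (k = 1, ..., N) is
   leg k. *)

definition leg :: "nat \<Rightarrow> 'n::{finite,linorder}" where
  "leg k = sorted_list_of_set UNIV ! (k - 1)"

definition on_leg :: "'n \<Rightarrow> ('a::zero, 'n::finite) sqmat \<Rightarrow> ('a, 'n \<Rightarrow> 'n) sqmat" where
  "on_leg k A = (\<chi> a b. if \<forall>l. l \<noteq> k \<longrightarrow> a l = b l then A $ a k $ b k else 0)"

definition on_legs :: "'n::finite \<Rightarrow> 'n \<Rightarrow> ('a::zero, 'n \<times> 'n) sqmat \<Rightarrow> ('a, 'n \<Rightarrow> 'n) sqmat" where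
  "on_legs k m T =
     (\<chi> a b. if \<forall>l. l \<noteq> k \<and> l \<noteq> m \<longrightarrow> a l = b l then T $ (a k, a m) $ (b k, b m) else 0)"

definition u_vec :: "('n::{finite,linorder} rat_fun, 'n \<Rightarrow> 'n) vec" where
  "u_vec = (\<Sum>\<sigma> | bij \<sigma>. mq_c UNIV \<sigma> *s axis \<sigma> 1)"

definition v_vec :: "('n::{finite,linorder} rat_fun, 'n \<Rightarrow> 'n) vec" where
  "v_vec = (\<Sum>\<sigma> | bij \<sigma>. mq_r UNIV \<sigma> *s axis \<sigma> 1)"

(* The library's ^ is componentwise on matrices. *)

definition mpow :: "'a::semiring_1 ^'m ^'m \<Rightarrow> nat \<Rightarrow> 'a ^'m ^'m" where
  "mpow A k = (((**) A) ^^ k) (mat 1)"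

(* (XY)_{01} Rhat_{12} Rhat_{23} ... Rhat_{i-1,i} *)

definition sigma_op :: "nat \<Rightarrow> ('n::{finite,linorder} OqQ, 'n \<Rightarrow> 'n) sqmat" where
  "sigma_op i = foldl (**) (on_leg (leg 1) (Xmat ** Ymat))
     (map (\<lambda>k. map_matrix scal_O (on_legs (leg k) (leg (k + 1)) Rhat)) [1..<i])"

definition sigma :: "nat \<Rightarrow> 'n::{finite,linorder} OqQ" where
  "sigma i = (if i = 0 then 1 else
     scal_O (q powi (- int ((i - 1) * i)) * alpha i) *
     (\<Sum>a\<in>UNIV. \<Sum>b\<in>UNIV. scal_O (v_vec $ a) * mpow (sigma_op i) i $ a $ b * scal_O (u_vec $ b)))"


section \<open>Adjoining \<open>t\<close> and inverting \<open>\<C>\<^sub>N\<close>\<close>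

(* For a ring A, the type nat \<Rightarrow>\<^sub>0 A is the polynomial ring A[t] in a central indeterminate:
   single m x stands for x t^m. *)

definition tvar :: "nat \<Rightarrow>\<^sub>0 'a::semiring_1" where
  "tvar = Poly_Mapping.single 1 1"

definition const :: "'a::semiring_1 \<Rightarrow> (nat \<Rightarrow>\<^sub>0 'a)" where
  "const x = Poly_Mapping.single 0 x"

definition C_N :: "nat \<Rightarrow>\<^sub>0 'n::{finite,linorder} OqQ" where
  "C_N = (\<Sum>k=0..CARD('n). const (sigma k) * tvar ^ (CARD('n) - k))"

(* The ring \<O>[t] with C_N inverted: \<O>[t][s] / (C_N s - 1) with a central indeterminate s, which is
   the localization of \<O>[t] at the powers of C_N. *)

definition loc_relator :: "(nat \<Rightarrow>\<^sub>0 nat \<Rightarrow>\<^sub>0 'n::{finite,linorder} OqQ) set" where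
  "loc_relator = {const C_N * tvar - 1}"

(* Nontriviality of the localization: the character X, Y |-> 0, t, s |-> 1 maps C_N s to 1. *)

definition eval_one :: "('a::zero \<Rightarrow> 'b::semiring_1) \<Rightarrow> (nat \<Rightarrow>\<^sub>0 'a) \<Rightarrow> 'b" where
  "eval_one h f = (\<Sum>k\<in>Poly_Mapping.keys f. h (Poly_Mapping.lookup f k))"

locale ring1_hom =
  fixes h :: "'a::ring_1 \<Rightarrow> 'b::ring_1"
  assumes hom_zero [simp]: "h 0 = 0" and hom_one [simp]: "h 1 = 1"
    and hom_add: "h (x + y) = h x + h y" and hom_mult: "h (x * y) = h x * h y"
begin

lemma hom_uminus: "h (- x) = - h x"
  using hom_add[of x "- x"] by (simp add: eq_neg_iff_add_eq_0 add.commute)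

lemma hom_diff: "h (x - y) = h x - h y"
  using hom_add[of x "- y"] by (simp add: hom_uminus)

lemma hom_sum: "h (sum f A) = (\<Sum>a\<in>A. h (f a))"
  by (rule additive_sum) (simp_all add: hom_add)

lemma eval_one_single [simp]: "eval_one h (Poly_Mapping.single k x) = h x"
  by (cases "x = 0") (simp_all add: eval_one_def)

lemma eval_one_superset:
  "finite A \<Longrightarrow> Poly_Mapping.keys f \<subseteq> A \<Longrightarrow> eval_one h f = (\<Sum>k\<in>A. h (Poly_Mapping.lookup f k))"
  unfolding eval_one_def by (rule sum.mono_neutral_left) (auto simp: in_keys_iff)

lemma eval_one_hom: "ring1_hom (eval_one h)"
proof
  show z: "eval_one h 0 = 0" by (simp add: eval_one_def)
  show "eval_one h 1 = 1" using eval_one_single[of 0 1] by simp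
  show add: "eval_one h (f + g) = eval_one h f + eval_one h g" for f g
  proof -
    let ?A = "Poly_Mapping.keys f \<union> Poly_Mapping.keys g"
    have "Poly_Mapping.keys (f + g) \<subseteq> ?A" by (rule keys_add)
    then show ?thesis
      by (simp add: eval_one_superset[of ?A] lookup_add hom_add sum.distrib)
  qed
  show "eval_one h (f * g) = eval_one h f * eval_one h g" for f g
    by (rule multiplicative_from_singles) (simp_all add: z add hom_mult)
qed

end

lift_definition counit :: "'n::{finite,linorder} OqQ \<Rightarrow> 'n rat_fun" is
  "\<lambda>f. Poly_Mapping.lookup f 0"
proof -
  fix x y :: "'n free_alg"
  assume "ideal_cong relators x y"
  then have "Poly_Mapping.lookup (x - y) 0 = 0"
    unfolding ideal_cong_def
    by (rule ideal_of_hom_zero[where h = "\<lambda>f. Poly_Mapping.lookup f 0"])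
      (simp_all add: lookup_add const_term_mult const_term_relators)
  then show "Poly_Mapping.lookup x 0 = Poly_Mapping.lookup y 0" by (simp add: lookup_minus)
qed

interpretation counit: ring1_hom counit
  by standard (transfer, simp add: lookup_add const_term_mult)+

lemma counit_to_O: "counit (to_O f) = Poly_Mapping.lookup f 0"
  by transfer simp

lemma counit_XY: "counit ((Xmat ** Ymat) $ i $ j) = 0"
  by (simp add: matrix_matrix_mult_def Xmat_def counit.hom_sum counit.hom_mult counit_to_O)

lemma counit_mult_matrix:
  "(\<And>i j. counit (A $ i $ j) = 0) \<Longrightarrow> counit ((A ** B) $ i $ j) = 0"
  by (simp add: matrix_matrix_mult_def counit.hom_sum counit.hom_mult)

lemma counit_sigma_op:
  fixes a b :: "'n::{finite,linorder} \<Rightarrow> 'n"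
  shows "counit (sigma_op i $ a $ b) = 0"
proof -
  have *: "\<forall>a b. counit (foldl (**) A Bs $ a $ b) = 0" if "\<forall>a b. counit (A $ a $ b) = 0"
    for A :: "('n OqQ, 'n \<Rightarrow> 'n) sqmat" and Bs
    using that
  proof (induction Bs arbitrary: A)
    case (Cons B Bs)
    have "\<forall>a b. counit ((A ** B) $ a $ b) = 0"
      using Cons.prems counit_mult_matrix[of A B] by blast
    then show ?case using Cons.IH by simp
  qed simp
  have "\<forall>a b. counit (on_leg (leg 1) (Xmat ** Ymat) $ a $ b) = 0"
    by (simp add: on_leg_def counit_XY)
  then show ?thesis
    unfolding sigma_op_def using * by blast
qed

lemma counit_sigma:
  "counit (sigma i :: 'n::{finite,linorder} OqQ) = (if i = 0 then 1 else 0)"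
proof -
  have "counit (mpow (sigma_op i) i $ a $ b) = 0" if "i \<noteq> 0" for a b :: "'n \<Rightarrow> 'n"
    using that counit_mult_matrix[OF counit_sigma_op] by (cases i) (simp_all add: mpow_def)
  then show ?thesis
    by (simp add: sigma_def counit.hom_sum counit.hom_mult)
qed

lifting_forget OqQ.lifting

lemma one_notin_loc_ideal:
  "\<not> ideal_cong loc_relator 0 (1 :: nat \<Rightarrow>\<^sub>0 nat \<Rightarrow>\<^sub>0 'n::{finite,linorder} OqQ)"
proof
  interpret e1: ring1_hom "eval_one counit :: (nat \<Rightarrow>\<^sub>0 'n OqQ) \<Rightarrow> _"
    by (rule counit.eval_one_hom)
  interpret e2: ring1_hom "eval_one (eval_one counit) :: (nat \<Rightarrow>\<^sub>0 nat \<Rightarrow>\<^sub>0 'n OqQ) \<Rightarrow> _"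
    by (rule e1.eval_one_hom)
  have t: "eval_one counit (tvar ^ k :: nat \<Rightarrow>\<^sub>0 'n OqQ) = 1" for k
    by (induction k) (simp_all add: e1.hom_mult, simp add: tvar_def)
  have C: "eval_one counit (C_N :: nat \<Rightarrow>\<^sub>0 'n OqQ) = 1"
    by (simp add: C_N_def e1.hom_sum e1.hom_mult t const_def counit_sigma)
  have rel: "eval_one (eval_one counit) s = 0" if "s \<in> loc_relator"
    for s :: "nat \<Rightarrow>\<^sub>0 nat \<Rightarrow>\<^sub>0 'n OqQ"
    using that by (simp add: loc_relator_def e2.hom_diff e2.hom_mult const_def tvar_def C)
  assume "ideal_cong loc_relator 0 (1 :: nat \<Rightarrow>\<^sub>0 nat \<Rightarrow>\<^sub>0 'n OqQ)"
  then have "- 1 \<in> ideal_of (loc_relator :: (nat \<Rightarrow>\<^sub>0 nat \<Rightarrow>\<^sub>0 'n OqQ) set)"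
    by (simp add: ideal_cong_def)
  then have "eval_one (eval_one counit) (- 1 :: nat \<Rightarrow>\<^sub>0 nat \<Rightarrow>\<^sub>0 'n OqQ) = 0"
    by (rule ideal_of_hom_zero) (simp_all add: e2.hom_add e2.hom_mult rel)
  then show False by (simp add: e2.hom_uminus)
qed

quotient_type (overloaded) 'n Oloc = "nat \<Rightarrow>\<^sub>0 nat \<Rightarrow>\<^sub>0 'n::{finite,linorder} OqQ" / "ideal_cong loc_relator"
  by (rule ideal_cong_equivp)

instantiation Oloc :: ("{finite,linorder}") ring_1
begin

lift_definition zero_Oloc :: "'a Oloc" is 0 .
lift_definition one_Oloc :: "'a Oloc" is 1 .
lift_definition plus_Oloc :: "'a Oloc \<Rightarrow> 'a Oloc \<Rightarrow> 'a Oloc" is "(+)" by (rule ideal_cong_add)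
lift_definition minus_Oloc :: "'a Oloc \<Rightarrow> 'a Oloc \<Rightarrow> 'a Oloc" is "(-)" by (rule ideal_cong_diff)
lift_definition uminus_Oloc :: "'a Oloc \<Rightarrow> 'a Oloc" is uminus by (rule ideal_cong_uminus)
lift_definition times_Oloc :: "'a Oloc \<Rightarrow> 'a Oloc \<Rightarrow> 'a Oloc" is "(*)" by (rule ideal_cong_mult)

instance
proof
  show "(0 :: 'a Oloc) \<noteq> 1" by transfer (rule one_notin_loc_ideal)
qed (transfer, simp add: algebra_simps ideal_cong_refl)+

end

lift_definition to_loc :: "(nat \<Rightarrow>\<^sub>0 'n::{finite,linorder} OqQ) \<Rightarrow> 'n Oloc" is const .

(* The class of s. *)

lift_definition C_N_inverse :: "'n::{finite,linorder} Oloc" is tvar .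

lemma C_N_mult_inverse: "to_loc C_N * C_N_inverse = 1"
  by transfer (simp add: ideal_cong_def ideal_of_base loc_relator_def)

lemma C_N_inverse_central: "C_N_inverse * x = x * (C_N_inverse :: 'n::{finite,linorder} Oloc)"
proof transfer
  fix x :: "nat \<Rightarrow>\<^sub>0 nat \<Rightarrow>\<^sub>0 'n OqQ"
  have "tvar * x = x * tvar"
  proof -
    let ?S = "\<lambda>k. Poly_Mapping.single k (Poly_Mapping.lookup x k)"
    have "tvar * (\<Sum>k\<in>Poly_Mapping.keys x. ?S k) = (\<Sum>k\<in>Poly_Mapping.keys x. ?S k) * tvar"
      by (simp add: tvar_def sum_distrib_left sum_distrib_right mult_single add.commute)
    then show ?thesis using poly_mapping_sum_single[of x] by simp
  qed
  then show "ideal_cong loc_relator (tvar * x) (x * tvar)" by (simp add: ideal_cong_refl)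
qed


section \<open>Minors and the numerator\<close>

(* D' = diag (q^(N-1), ..., q, 1): the k-th element of 'n has N - k elements above it. *)

definition Dprime :: "('n::{finite,linorder} rat_fun, 'n) sqmat" where
  "Dprime = (\<chi> i j. if i = j then q ^ card {k. i < k} else 0)"

(* The minors are formed in the free algebra, so that their expansion into words makes sense;
   their images under to_O are the minors in \<O>. The sets J and K are meant to have equally many
   elements. *)

definition minor_XD :: "'n::{finite,linorder} set \<Rightarrow> 'n set \<Rightarrow> 'n free_alg" where
  "minor_XD J K =
     (let i = card J; M = Xfree ** map_matrix scal Dprime; j = (\<lambda>k. sorted_list_of_set J ! (k - 1))
      in \<Sum>\<tau> | \<tau> \<in> {1..i} \<rightarrow>\<^sub>E K \<and> bij_betw \<tau> {1..i} K.
           scal (mq_c {1..i} \<tau>) * (\<Prod>k\<leftarrow>[1..<i+1]. M $ j k $ \<tau> k))"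

definition minor_DY :: "'n::{finite,linorder} set \<Rightarrow> 'n set \<Rightarrow> 'n free_alg" where
  "minor_DY J K = star (minor_XD K J)"

(* (-q)_{i<K} and (-q)_{K>j} *)

definition mq_less :: "'n::linorder \<Rightarrow> 'n set \<Rightarrow> 'n rat_fun" where
  "mq_less i K = (\<Prod>k | k \<in> K \<and> i < k. - qij i k)"

definition mq_greater :: "'n::linorder set \<Rightarrow> 'n \<Rightarrow> 'n rat_fun" where
  "mq_greater K j = (\<Prod>k | k \<in> K \<and> k > j. - qij k j)"

(* An element of F<X, Y>[t]. Different terms (K, L and the two permutations) have different words,
   so collecting like words merges nothing. *)

definition numerator :: "'n::{finite,linorder} \<Rightarrow> 'n \<Rightarrow> (nat \<Rightarrow>\<^sub>0 'n free_alg)" where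
  "numerator i j =
     (\<Sum>K | i \<in> K \<and> j \<in> K. tvar ^ (CARD('n) - card K) *
        const (scal (mq_less i K) * scal (mq_greater K j) *
          (\<Sum>L | card L = card K - 1. minor_DY L (K - {i}) * minor_XD (K - {j}) L)))"

definition to_Ot :: "(nat \<Rightarrow>\<^sub>0 'n::{finite,linorder} free_alg) \<Rightarrow> (nat \<Rightarrow>\<^sub>0 'n OqQ)" where
  "to_Ot = Poly_Mapping.map to_O"

(* The coefficient, in F[t], of the word w. *)

definition word_coeff :: "(nat \<Rightarrow>\<^sub>0 'n::linorder free_alg) \<Rightarrow> 'n gen freemon \<Rightarrow> (nat \<Rightarrow>\<^sub>0 'n rat_fun)" where
  "word_coeff P w = Poly_Mapping.map (\<lambda>f. Poly_Mapping.lookup f w) P"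

definition tI_plus_XY :: "('n::{finite,linorder} Oloc, 'n) sqmat" where
  "tI_plus_XY = mat (to_loc tvar) + map_matrix (\<lambda>x. to_loc (const x)) (Xmat ** Ymat)"

end

theory Submission
  imports Defs "HOL-Combinatorics.Multiset_Permutations"
begin

text \<open>
  Put \<open>Z = XY\<close> and let \<open>A\<^sub>k\<close> be the matrix of coefficients of \<open>t^(N - k)\<close> in the numerator. Comparing powers
  of \<open>t\<close>, the claim \<open>(tI + Z) A = C\<^sub>N I\<close> says that \<open>Z A\<^sub>k + A\<^sub>k\<^sub>+\<^sub>1 = \<sigma>(k) I\<close> for all \<open>k\<close>, with \<open>A\<^sub>1 = I\<close> and
  \<open>A\<^sub>N\<^sub>+\<^sub>1 = 0\<close>: a quantum Cayley-Hamilton identity in the form of the Faddeev-LeVerrier recursion.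

  The recursion is \<open>main_identity_all\<close>. Up to scalars, \<open>A\<^sub>k\<close> is obtained from the quantum
  alternating tensors of rank \<open>k\<close> by applying \<open>Y\<close> to the legs and closing all legs but one with \<open>X\<close> and
  a weight (a partial quantum trace). To multiply by \<open>X\<close> on the left, one moves the new \<open>X\<close> through the
  row of \<open>Y\<close>s with the relation \<open>X R Y = Y R X\<close>; this replaces the alternating tensor by one that
  has been transported along a row of R-matrices (\<open>move_X\<close>). A transported alternating tensor is again
  alternating (the braid relation), so it is a combination of the standard ones, with coefficients that
  are Laurent monomials in the \<open>q\<^sub>i\<^sub>j\<close> up to sign and a factor \<open>1 - q^2\<close> (\<open>tr_uv\<close>). What remains is an identity between such coefficients, whose sums are
  geometric series in \<open>q^2\<close> that telescope (\<open>main_coeff\<close>).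

  By induction along the recursion, \<open>A\<^sub>k\<close> satisfies the same exchange relations with \<open>X\<close> and \<open>Y\<close> as
  \<open>Z\<close> does. These relations make the quantum trace of a matrix central, and for \<open>k \<ge> 1\<close> the element \<open>\<sigma>(k)\<close> is a
  nonzero multiple of the quantum trace of \<open>Z A\<^sub>k\<close>; hence \<open>\<sigma>(k)\<close> is central (\<open>sm_com\<close>). Then \<open>A\<^sub>k\<close>, a polynomial in \<open>Z\<close> with
  central coefficients, commutes with \<open>Z\<close>, and the one-sided inverse is two-sided.

  The recursion produces \<open>\<sigma>(k)\<close> as a sum over subsets of quantum traces. To see that this is the matrix
  coefficient in the definition (\<open>sigma_sm\<close>), note that \<open>u\<close> is alternating, so every \<open>\<Sigma>R\<close> that meets it acts
  by \<open>-q^2\<close>, and the \<open>k\<close>-th power becomes a product of \<open>k\<close> factors \<open>X\<close> followed by \<open>k\<close> factors \<open>Y\<close>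
  (\<open>Dop_power\<close>); the factors \<open>X\<close> are then turned into closing factors one at a time (\<open>\<Phi>_step\<close>).

  For the last claim, the word of a term determines the sets and permutations that index it, so terms
  do not collect. Its coefficient is a product of factors \<open>-1\<close>, \<open>q\<close> and \<open>q\<^sub>a\<^sub>b\<close>, that is, up to
  sign, a Laurent monomial, and a Laurent monomial has a nonzero value at every point with nonzero coordinates.
\<close>

section \<open>Quantum alternating functions on words\<close>

text \<open>The parameters enter only through \<open>r = q^2\<close> and \<open>Q i j = q\<^sub>i\<^sub>j\<close>. The
  \<open>r\<close>-integers must not vanish because \<open>\<sigma>(k)\<close> is recovered from quantum traces by dividing by them.\<close>

locale qparam =
  fixes r :: "'f::field" and Q :: "'n::{finite,linorder} \<Rightarrow> 'n \<Rightarrow> 'f"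
  assumes Q_diag [simp]: "Q i i = 1"
    and Q_mult: "i \<noteq> j \<Longrightarrow> Q i j * Q j i = r"
    and r_nz [simp]: "r \<noteq> 0"
    and qnum_nz: "n > 0 \<Longrightarrow> (\<Sum>k<n. r ^ k) \<noteq> 0"
begin

lemma Q_nz [simp]: "Q i j \<noteq> 0"
  using Q_mult[of i j] r_nz by (cases "i = j") auto

lemma one_plus_r_nz: "1 + r \<noteq> 0"
  using qnum_nz[of 2] by (simp add: numeral_2_eq_2)

text \<open>The factor that the pair \<open>(x, y)\<close>, in this order, contributes to \<open>(-q)\<^sub>\<sigma>\<^sub>,\<^sub>c\<close>. The value \<open>0\<close> for equal letters
  makes \<open>eps_c\<close> vanish on words with a repetition, so that sums over permutations become sums over all words.\<close>

definition inv_c :: "'n \<Rightarrow> 'n \<Rightarrow> 'f" where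
  "inv_c x y = (if y < x then - Q y x else if y = x then 0 else 1)"

definition inv_r :: "'n \<Rightarrow> 'n \<Rightarrow> 'f" where
  "inv_r x y = (if y < x then - Q x y else if y = x then 0 else 1)"

primrec eps_c :: "'n list \<Rightarrow> 'f" where
  "eps_c [] = 1"
| "eps_c (x # w) = (\<Prod>y\<leftarrow>w. inv_c x y) * eps_c w"

primrec eps_r :: "'n list \<Rightarrow> 'f" where
  "eps_r [] = 1"
| "eps_r (x # w) = (\<Prod>y\<leftarrow>w. inv_r x y) * eps_r w"

text \<open>The functions on words that span the quantum exterior algebra. The scalar action \<open>s\<close> is
  a parameter because both numeric functions and functions with values in the algebra occur.\<close>

definition alternating :: "('f \<Rightarrow> 'm \<Rightarrow> 'm::ab_group_add) \<Rightarrow> ('n list \<Rightarrow> 'm) \<Rightarrow> bool" where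
  "alternating s f \<longleftrightarrow> (\<forall>v w a b. (a < b \<longrightarrow> f (v @ b # a # w) = s (- Q a b) (f (v @ a # b # w)))
      \<and> f (v @ a # a # w) = 0)"

lemma alternating_Cons: "alternating s f \<Longrightarrow> alternating s (\<lambda>w. f (x # w))"
  unfolding alternating_def by (metis append_Cons)

lemma alternating_append: "alternating s f \<Longrightarrow> alternating s (\<lambda>w. f (v @ w))"
  unfolding alternating_def by (metis append_assoc)

lemma alternating_snoc: "alternating s f \<Longrightarrow> alternating s (\<lambda>w. f (w @ v))"
  unfolding alternating_def by simp

lemma alternatingI:
  assumes "\<And>v w a b. a < b \<Longrightarrow> f (v @ b # a # w) = s (- Q a b) (f (v @ a # b # w))"
    and "\<And>v w a. f (v @ a # a # w) = 0"
  shows "alternating s f"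
  using assms unfolding alternating_def by blast

lemma alternatingD:
  assumes "alternating s f"
  shows "a < b \<Longrightarrow> f (v @ b # a # w) = s (- Q a b) (f (v @ a # b # w))"
    and "f (v @ a # a # w) = 0"
  using assms unfolding alternating_def by blast+

lemma alternating_add:
  assumes "vector_space s" "alternating s f" "alternating s g"
  shows "alternating s (\<lambda>w. f w + g w)"
proof -
  interpret vector_space s by fact
  show ?thesis
    by (rule alternatingI)
       (simp_all only: alternatingD[OF assms(2)] alternatingD[OF assms(3)] scale_right_distrib add_0)
qed

lemma alternating_scale:
  assumes "vector_space s" "alternating s f"
  shows "alternating s (\<lambda>w. s c (f w))"
proof -
  interpret vector_space s by fact
  show ?thesis
    by (rule alternatingI)
       (simp_all only: alternatingD[OF assms(2)] scale_scale mult.commute scale_zero_right)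
qed

lemma alternating_sum:
  assumes "vector_space s" "\<And>x. alternating s (f x)"
  shows "alternating s (\<lambda>w. \<Sum>x\<in>A. f x w)"
proof -
  interpret vector_space s by fact
  have z: "alternating s (\<lambda>w. 0)" by (simp add: alternating_def)
  show ?thesis
  proof (induction A rule: infinite_finite_induct)
    case (insert x A)
    then show ?case using alternating_add[OF assms(1) assms(2)[of x] insert.IH] by simp
  qed (simp_all add: z)
qed

text \<open>Both defining conditions together say that each \<open>\<Sigma>R\<close> acts as the scalar \<open>-r\<close>. In this form, which treats all
  pairs of letters alike, the property can be compared with the relations between generators.\<close>

lemma alternating_iff_Hecke:
  assumes "vector_space s"
  shows "alternating s f \<longleftrightarrow> (\<forall>v w a b.
     s (Q b a) (f (v @ b # a # w)) + (if b < a then s (1 - r) (f (v @ a # b # w)) else 0)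
       = s (- r) (f (v @ a # b # w)))" (is "_ \<longleftrightarrow> ?H")
proof
  interpret vector_space s by fact
  assume alt: "alternating s f"
  show ?H
  proof (intro allI)
    fix v w and a b :: 'n
    consider "a < b" | "a = b" | "b < a" by (rule linorder_cases[of a b])
    then show "s (Q b a) (f (v @ b # a # w)) + (if b < a then s (1 - r) (f (v @ a # b # w)) else 0)
       = s (- r) (f (v @ a # b # w))"
    proof cases
      case 1
      then have "Q b a * - Q a b = - r" using Q_mult[of b a] by simp
      moreover have "\<not> b < a" using 1 by (rule less_not_sym)
      ultimately show ?thesis by (simp only: alternatingD(1)[OF alt 1] if_False add_0_right scale_scale)
    next
      case 2
      then show ?thesis by (simp add: alternatingD[OF alt])
    next
      case 3
      have "Q b a + (1 - r) * (- Q b a) = - r * (- Q b a)" by (simp add: algebra_simps)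
      then have "s (Q b a) x + s (1 - r) (s (- Q b a) x) = s (- r) (s (- Q b a) x)" for x
        by (simp only: scale_scale scale_left_distrib[symmetric])
      then show ?thesis using 3 by (simp only: alternatingD(1)[OF alt 3] if_True)
    qed
  qed
next
  interpret vector_space s by fact
  assume H: ?H
  show "alternating s f"
  proof (rule alternatingI)
    fix v w a
    have "s 1 (f (v @ a # a # w)) = s (- r) (f (v @ a # a # w))"
      using H[rule_format, of a a v w] by simp
    then have "s (1 + r) (f (v @ a # a # w)) = 0"
      by (simp add: scale_left_distrib eq_neg_iff_add_eq_0)
    then show "f (v @ a # a # w) = 0" using one_plus_r_nz by simp
  next
    fix v w and a b :: 'n
    assume ab: "a < b"
    then have "\<not> b < a" by (rule less_not_sym)
    with H[rule_format, where a = a and b = b and v = v and w = w]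
    have "s (Q b a) (f (v @ b # a # w)) = s (- r) (f (v @ a # b # w))"
      by (simp only: if_False add_0_right)
    also have "- r = Q b a * - Q a b" using Q_mult[of b a] ab by simp
    finally show "f (v @ b # a # w) = s (- Q a b) (f (v @ a # b # w))"
      by (metis Q_nz scale_cancel_left scale_scale)
  qed
qed

lemma alternating_insort:
  assumes "vector_space s" and "alternating s f" and "sorted v"
  shows "f (x # v) = s (\<Prod>y\<leftarrow>v. inv_c x y) (f (insort x v))"
  using assms(2,3)
proof (induction v arbitrary: f)
  case Nil
  interpret vector_space s by fact
  show ?case by simp
next
  case (Cons y v)
  interpret vector_space s by fact
  consider "x < y" | "x = y" | "y < x" by (rule linorder_cases[of x y])
  then show ?case
  proof cases
    case 1
    then have "map (inv_c x) (y # v) = map (\<lambda>_. 1) (y # v)"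
      using Cons.prems(2) by (intro map_cong) (auto simp: inv_c_def)
    then have "(\<Prod>z\<leftarrow>y # v. inv_c x z) = (\<Prod>z\<leftarrow>y # v. 1)" by (simp only:)
    also have "\<dots> = 1" by (simp add: map_replicate_const)
    finally show ?thesis using less_imp_le[OF 1] by (simp del: prod_list.Cons list.map)
  next
    case 2
    then show ?thesis using alternatingD(2)[OF Cons.prems(1), of "[]"] by (simp add: inv_c_def)
  next
    case 3
    then have "\<not> x \<le> y" by (simp only: linorder_not_le)
    have "f (x # y # v) = s (- Q y x) (f (y # x # v))"
      using alternatingD(1)[OF Cons.prems(1) 3, of "[]"] by simp
    also have "f (y # x # v) = s (\<Prod>z\<leftarrow>v. inv_c x z) (f (y # insort x v))"
      using Cons.IH[OF alternating_Cons[OF Cons.prems(1)]] Cons.prems(2) by simp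
    finally show ?thesis using 3 \<open>\<not> x \<le> y\<close> by (simp add: inv_c_def[of x y])
  qed
qed

text \<open>Sorting a word by adjacent exchanges collects one factor for each inversion. Hence an alternating
  function is determined by its values on increasing words.\<close>

lemma alternating_sort:
  assumes "vector_space s" and "alternating s f"
  shows "f w = s (eps_c w) (f (sort w))"
  using assms(2)
proof (induction w arbitrary: f)
  case Nil
  interpret vector_space s by fact
  show ?case by simp
next
  case (Cons x w)
  interpret vector_space s by fact
  show ?case
    using Cons.IH[OF alternating_Cons[OF Cons.prems]] 
      alternating_insort[OF assms(1) Cons.prems, of "sort w" x]
    by (simp add: prod_mset_prod_list[symmetric] mult.commute)
qed

lemma inv_c_antisym: "a < b \<Longrightarrow> inv_c b a = - Q a b * inv_c a b"
  by (auto simp: inv_c_def)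

lemma alternating_eps_c: "alternating (*) eps_c"
proof (rule alternatingI)
  show "eps_c (v @ b # a # w) = - Q a b * eps_c (v @ a # b # w)" if "a < b" for v w a b
    using that by (induction v) (auto simp: inv_c_antisym mult_ac inv_c_def)
  show "eps_c (v @ a # a # w) = 0" for v w a
    by (induction v) (auto simp: inv_c_def)
qed

lemma eps_c_append:
  "eps_c (v @ w) = eps_c v * eps_c w * (\<Prod>x\<leftarrow>v. \<Prod>y\<leftarrow>w. inv_c x y)"
  by (induction v) (simp_all add: mult_ac)

lemma eps_r_append:
  "eps_r (v @ w) = eps_r v * eps_r w * (\<Prod>x\<leftarrow>v. \<Prod>y\<leftarrow>w. inv_r x y)"
  by (induction v) (simp_all add: mult_ac)

lemma eps_c_sorted: "sorted w \<Longrightarrow> distinct w \<Longrightarrow> eps_c w = 1"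
proof (induction w)
  case (Cons x w)
  then have "map (inv_c x) w = map (\<lambda>_. 1) w"
    by (intro map_cong) (auto simp: inv_c_def order_le_less)
  then have "(\<Prod>z\<leftarrow>w. inv_c x z) = (\<Prod>z\<leftarrow>w. 1)" by (simp only:)
  then show ?case using Cons by (simp add: map_replicate_const)
qed simp

lemma eps_r_sorted: "sorted w \<Longrightarrow> distinct w \<Longrightarrow> eps_r w = 1"
proof (induction w)
  case (Cons x w)
  then have "map (inv_r x) w = map (\<lambda>_. 1) w"
    by (intro map_cong) (auto simp: inv_r_def order_le_less)
  then have "(\<Prod>z\<leftarrow>w. inv_r x z) = (\<Prod>z\<leftarrow>w. 1)" by (simp only:)
  then show ?case using Cons by (simp add: map_replicate_const)
qed simp

lemma eps_c_not_distinct: "\<not> distinct w \<Longrightarrow> eps_c w = 0"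
proof (induction w)
  case (Cons x w)
  then show ?case by (auto simp: prod_list_zero_iff inv_c_def image_iff)
qed simp

lemma eps_r_not_distinct: "\<not> distinct w \<Longrightarrow> eps_r w = 0"
proof (induction w)
  case (Cons x w)
  then show ?case by (auto simp: prod_list_zero_iff inv_r_def image_iff)
qed simp

lemma alternating_vanish:
  assumes "vector_space s" "alternating s f" "\<not> distinct w"
  shows "f w = 0"
proof -
  interpret vector_space s by fact
  show ?thesis using alternating_sort[OF assms(1,2), of w] eps_c_not_distinct[OF assms(3)] by simp
qed

text \<open>The operator of a row of R-matrices: an auxiliary leg that enters with letter \<open>i\<close> crosses the
  legs of the word \<open>b\<close> one after another and leaves with letter \<open>p\<close>, the word having turned into \<open>a\<close>. The function
  \<open>F p a\<close> is evaluated on the result.\<close>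

fun transport :: "('f \<Rightarrow> 'm \<Rightarrow> 'm::ab_group_add) \<Rightarrow> ('n \<Rightarrow> 'n list \<Rightarrow> 'm) \<Rightarrow> 'n list \<Rightarrow> 'n \<Rightarrow> 'm" where
  "transport s F [] i = F i []"
| "transport s F (x # b) i = transport s
     (\<lambda>p a. s (Q p x) (F p (x # a)) + (if p < x then s (1 - r) (F x (p # a)) else 0)) b i"

lemma transport_hom:
  assumes "\<And>x y. h (x + y) = h x + h y" "\<And>c x. h (s c x) = s' c (h x)" "h 0 = 0"
  shows "h (transport s F b i) = transport s' (\<lambda>p a. h (F p a)) b i"
  by (induction b arbitrary: F) (simp_all add: assms if_distrib[of h] cong: if_cong)

lemma transport_add:
  assumes "vector_space s"
  shows "transport s (\<lambda>p a. F p a + G p a) b i = transport s F b i + transport s G b i"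
proof (induction b arbitrary: F G)
  case (Cons x b)
  interpret vector_space s by fact
  show ?case
    unfolding transport.simps Cons.IH[symmetric]
    by (rule arg_cong[of _ _ "\<lambda>F. transport s F b i"]) (auto simp: fun_eq_iff scale_right_distrib)
qed simp

lemma transport_zero:
  assumes "vector_space s"
  shows "transport s (\<lambda>p a. 0) b i = 0"
proof (induction b)
  case (Cons x b)
  interpret vector_space s by fact
  show ?case using Cons by (simp cong: if_cong)
qed simp

lemma transport_sum:
  assumes "vector_space s"
  shows "transport s (\<lambda>p a. \<Sum>x\<in>A. F x p a) b i = (\<Sum>x\<in>A. transport s (F x) b i)"
  by (induction A rule: infinite_finite_induct) (simp_all add: transport_zero transport_add assms)

lemma transport_scale:
  assumes "vector_space s"
  shows "transport s (\<lambda>p a. s c (F p a)) b i = s c (transport s F b i)"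
proof -
  interpret vector_space s by fact
  show ?thesis
    by (subst transport_hom[where h = "s c" and s = s and s' = s])
       (simp_all add: scale_right_distrib mult.commute)
qed

text \<open>This is the braid relation: crossing two legs and then exchanging them is the same as exchanging them
  first, so transport commutes with the action of each \<open>\<Sigma>R\<close> on adjacent legs.\<close>

lemma transport_alternating:
  fixes F :: "'n \<Rightarrow> 'n list \<Rightarrow> 'f"
  assumes "\<And>p. alternating (*) (F p)"
  shows "alternating (*) (\<lambda>b. transport (*) F b i)"
proof -
  have vs: "vector_space ((*) :: 'f \<Rightarrow> 'f \<Rightarrow> 'f)" 
    by unfold_locales (simp_all add: algebra_simps)
  have step: "alternating (*) (\<lambda>a. Q p x * (F p (x # a)) + (if p < x then (1 - r) * (F x (p # a)) else 0))"
    if "\<And>p. alternating (*) (F p)" for F :: "'n \<Rightarrow> 'n list \<Rightarrow> 'f" and p x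
  proof (cases "p < x")
    case True
    with alternating_add[OF vs alternating_scale[OF vs alternating_Cons[OF that[of p]]]
        alternating_scale[OF vs alternating_Cons[OF that[of x]]]]
    show ?thesis by simp
  next
    case False
    with alternating_scale[OF vs alternating_Cons[OF that[of p]]] show ?thesis by simp
  qed
  have *: "(a < b \<longrightarrow> transport (*) F (v @ b # a # w) i = - Q a b * transport (*) F (v @ a # b # w) i)
     \<and> transport (*) F (v @ a # a # w) i = 0" if "\<And>p. alternating (*) (F p)" for v w a b
    using that
  proof (induction v arbitrary: F)
    case Nil
    have F0: "F p (c # c # w) = 0" for p c w using alternatingD(2)[OF Nil, of p "[]"] by simp
    have F1: "F p (b # a # w) = - Q a b * F p (a # b # w)" if "a < b" for p a b w
      using alternatingD(1)[OF Nil, of a b p "[]"] that by simp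
    show ?case
    proof (intro conjI impI)
      assume ab: "a < b"
      show "transport (*) F ([] @ b # a # w) i = - Q a b * transport (*) F ([] @ a # b # w) i"
        unfolding append_Nil transport.simps transport_scale[OF vs, symmetric]
      proof (intro arg_cong[of _ _ "\<lambda>F. transport (*) F w i"] ext)
        fix p u
        have r: "r = Q a b * Q b a" using Q_mult[of a b] ab by simp
        consider "p < a" | "p = a" | "a < p" "p < b" | "p = b" | "b < p"
          using less_linear[of p a] less_linear[of p b] by blast
        then show "Q p a * (Q p b * F p (b # a # u) + (if p < b then (1 - r) * F b (p # a # u) else 0)) +
            (if p < a then (1 - r) * (Q a b * F a (b # p # u) + (if a < b then (1 - r) * F b (a # p # u) else 0)) else 0)
          = - Q a b * (Q p b * (Q p a * F p (a # b # u) + (if p < a then (1 - r) * F a (p # b # u) else 0)) +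
            (if p < b then (1 - r) * (Q b a * F b (a # p # u) + (if b < a then (1 - r) * F a (b # p # u) else 0)) else 0))"
        proof cases
          case 1
          have "p < b" using 1 ab by (rule less_trans)
          have n: "\<not> b < a" using ab by (rule less_not_sym)
          show ?thesis
            unfolding F1[OF ab] F1[OF 1] F1[OF \<open>p < b\<close>] if_P[OF ab] if_P[OF 1] if_P[OF \<open>p < b\<close>] if_not_P[OF n] r
            by (simp add: algebra_simps)
        next
          case 2
          show ?thesis
            unfolding 2 F1[OF ab] F0 if_P[OF ab] if_not_P[OF less_irrefl] if_not_P[OF less_not_sym[OF ab]] Q_diag
            by simp
        next
          case 3
          have aux: "x * (z * (- c * X) + m * (- y * B)) + 0 = - c * (z * (x * X + 0) + m * (d * B + 0))"
            if "x * y = c * d" for x y c d z m X B :: 'f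
          proof -
            have "x * (z * (- c * X) + m * (- y * B)) + 0 = - (c * z * x * X) - m * B * (x * y)"
              by (simp add: algebra_simps)
            also have "\<dots> = - (c * z * x * X) - m * B * (c * d)" by (simp only: that)
            also have "\<dots> = - c * (z * (x * X + 0) + m * (d * B + 0))" by (simp add: algebra_simps)
            finally show ?thesis .
          qed
          show ?thesis
            unfolding F1[OF ab] F1[OF 3(1)] if_P[OF ab] if_P[OF 3(2)] if_not_P[OF less_not_sym[OF 3(1)]]
              if_not_P[OF less_not_sym[OF ab]]
            by (rule aux) (use 3 ab in \<open>simp add: Q_mult\<close>)
        next
          case 4
          show ?thesis
            unfolding 4 F1[OF ab] F0 if_P[OF ab] if_not_P[OF less_irrefl] if_not_P[OF less_not_sym[OF ab]] Q_diag
            by simp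
        next
          case 5
          have "\<not> p < a" using less_trans[OF ab 5] by (rule less_not_sym)
          then show ?thesis
            unfolding F1[OF ab] if_not_P[OF less_not_sym[OF 5]] if_not_P[OF \<open>\<not> p < a\<close>]
            by simp
        qed
      qed
    next
      show "transport (*) F ([] @ a # a # w) i = 0"
      proof -
        have F0': "Q p a * F a (p # a # u) + F a (a # p # u) = 0" if "p < a" for p u
          by (simp add: F1[OF that])
        have "(\<lambda>p u. Q p a * (Q p a * F p (a # a # u) + (if p < a then (1 - r) * F a (p # a # u) else 0)) +
            (if p < a then (1 - r) * (Q a a * F a (a # p # u) + (if a < a then (1 - r) * F a (a # p # u) else 0)) else 0))
          = (\<lambda>p u. 0)" (is "?L = ?R")
        proof (intro ext)
          fix p u
          have "?L p u = (if p < a then (1 - r) * (Q p a * F a (p # a # u) + F a (a # p # u)) else 0)"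
            by (simp add: F0 algebra_simps)
          then show "?L p u = 0" using F0'[of p u] by simp
        qed
        then show ?thesis
          unfolding append_Nil transport.simps by (simp only: transport_zero[OF vs])
      qed
    qed
  next
    case (Cons x v)
    show ?case unfolding append_Cons transport.simps by (rule Cons.IH, rule step, rule Cons.prems)
  qed
  show ?thesis
    by (rule alternatingI) (simp_all only: *[OF assms])
qed

end

section \<open>The algebra generated by two quantum matrices\<close>

context qparam begin

lemma sum_rank_above:
  "finite A \<Longrightarrow> (\<Sum>c\<in>A. r ^ card {k\<in>A. c < k}) = (\<Sum>k<card A. r ^ k)" for A :: "'n set"
proof (induction A rule: finite_linorder_min_induct)
  case (insert b A)
  have "{k \<in> insert b A. c < k} = {k \<in> A. c < k}" if "c \<in> A" for c
    using insert.hyps(2) that by (auto dest: less_asym)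
  moreover have "{k \<in> insert b A. b < k} = A" using insert.hyps(2) by auto
  moreover have "b \<notin> A" using insert.hyps(2) by blast
  ultimately show ?case using insert by (simp add: add.commute)
qed simp

lemma sum_rank_below:
  "finite A \<Longrightarrow> (\<Sum>c\<in>A. r ^ card {k\<in>A. k < c}) = (\<Sum>k<card A. r ^ k)" for A :: "'n set"
proof (induction A rule: finite_linorder_max_induct)
  case (insert b A)
  have "{k \<in> insert b A. k < c} = {k \<in> A. k < c}" if "c \<in> A" for c
    using insert.hyps(2) that by (auto dest: less_asym)
  moreover have "{k \<in> insert b A. k < b} = A" using insert.hyps(2) by auto
  moreover have "b \<notin> A" using insert.hyps(2) by blast
  ultimately show ?case using insert by (simp add: add.commute)
qed simp

text \<open>The diagonal entries of \<open>D'\<close> squared; they are the weights of the trace that closes a leg.\<close>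

definition wt :: "'n \<Rightarrow> 'f" where "wt c = r ^ card {k. c < k}"

lemma telescope: "(1 - r) * (\<Sum>k<n. r ^ k) = 1 - r ^ n"
  by (simp add: one_diff_power_eq)

text \<open>Partial trace of R with the weights \<open>wt\<close>: this is why \<open>D'\<close> appears in the minors.\<close>

lemma wt_trace: "wt p + (1 - r) * (\<Sum>c\<in>{c. p < c}. wt c) = 1"
proof -
  have "(\<Sum>c\<in>{c. p < c}. wt c) = (\<Sum>c\<in>{c. p < c}. r ^ card {k\<in>{c. p < c}. c < k})"
    unfolding wt_def by (intro sum.cong refl arg_cong[of _ _ "\<lambda>A. r ^ card A"]) auto
  then show ?thesis by (simp only: sum_rank_above[OF finite] telescope) (simp add: wt_def)
qed

end

text \<open>The three relations of \<open>\<O>\<close> in coordinates, over any ring with a central copy \<open>sc\<close> of the field.\<close>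

locale quantum_pair = qparam r Q for r :: "'f::field" and Q :: "'n::{finite,linorder} \<Rightarrow> 'n \<Rightarrow> 'f" +
  fixes sc :: "'f \<Rightarrow> 'o::ring_1" and X Y :: "'n \<Rightarrow> 'n \<Rightarrow> 'o"
  assumes sc_add: "sc (x + y) = sc x + sc y" and sc_mult: "sc (x * y) = sc x * sc y"
    and sc_1 [simp]: "sc 1 = 1" and sc_comm: "z * sc x = sc x * z"
    and XX: "sc (Q a b) * (X a c * X b d) + (if a < b then sc (1 - r) * (X b c * X a d) else 0)
           = sc (Q c d) * (X b d * X a c) + (if d < c then sc (1 - r) * (X b c * X a d) else 0)"
    and YY: "sc (Q a b) * (Y b d * Y a c) + (if a < b then sc (1 - r) * (Y a d * Y b c) else 0)
           = sc (Q c d) * (Y a c * Y b d) + (if d < c then sc (1 - r) * (Y a d * Y b c) else 0)"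
    and XY: "sc (Q b d) * (Y a d * X b c) + (if b = d then sc (1 - r) * (\<Sum>k\<in>{k. b < k}. Y a k * X k c) else 0)
           = sc (Q c a) * (X b c * Y a d) + (if a = c then sc (1 - r) * (\<Sum>l\<in>{l. l < a}. X b l * Y l d) else 0)"
begin

abbreviation scl :: "'f \<Rightarrow> 'o \<Rightarrow> 'o" where "scl c x \<equiv> sc c * x"

lemma sc_0 [simp]: "sc 0 = 0"
  using sc_add[of 0 0] by simp

lemma sc_minus: "sc (- a) = - sc a"
  using sc_add[of a "- a"] by (simp add: eq_neg_iff_add_eq_0 add.commute)

lemma sc_diff: "sc (a - b) = sc a - sc b"
  using sc_add[of a "- b"] by (simp add: sc_minus)

lemma sc_sum: "sc (\<Sum>x\<in>A. f x) = (\<Sum>x\<in>A. sc (f x))"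
  by (induction A rule: infinite_finite_induct) (simp_all add: sc_add)

lemma vs: "vector_space scl"
  by unfold_locales (simp_all add: sc_add sc_mult algebra_simps)

lemma sc_left: "x * (sc c * y) = sc c * (x * y)"
  by (metis mult.assoc sc_comm)

lemma scl_comm: "sc a * (sc b * y) = sc b * (sc a * y)"
  by (rule sc_left)

lemma alternating_sc: "alternating (*) g \<Longrightarrow> alternating scl (\<lambda>w. sc (g w))"
  unfolding alternating_def by (simp only: sc_mult[symmetric] sc_0) simp

lemma alternating_left: "alternating scl f \<Longrightarrow> alternating scl (\<lambda>w. z * f w)"
  by (rule alternatingI) (simp_all add: alternatingD sc_left[of z])

lemma alternating_right: "alternating scl f \<Longrightarrow> alternating scl (\<lambda>w. f w * z)"
  by (rule alternatingI) (simp_all add: alternatingD mult.assoc)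

text \<open>\<open>Y\<close> applied to every leg. The factor belonging to the first leg is written rightmost, as in the product
  of the adjoint minors.\<close>

primrec Yop :: "('n list \<Rightarrow> 'o) \<Rightarrow> 'n list \<Rightarrow> 'o" where
  Yop_Nil: "Yop f [] = f []"
| Yop_Cons: "Yop f (c # w) = Yop (\<lambda>b. \<Sum>x\<in>UNIV. Y c x * f (x # b)) w"

lemma Yop_hom: 
  assumes "\<And>x y. h (x + y) = h x + h y" "\<And>c x y. h (Y c y * x) = Y c y * h x" "h 0 = 0"
  shows "h (Yop f w) = Yop (\<lambda>b. h (f b)) w"
proof (induction w arbitrary: f)
  case (Cons c w)
  have "h (sum g A) = (\<Sum>a\<in>A. h (g a))" for g :: "'n \<Rightarrow> 'o" and A
    by (rule additive_sum) (simp_all add: assms)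
  then show ?case by (simp add: Cons assms)
qed simp

lemma Yop_add: "Yop (\<lambda>b. f b + g b) w = Yop f w + Yop g w"
  by (induction w arbitrary: f g) (simp_all add: distrib_left sum.distrib)

lemma Yop_zero [simp]: "Yop (\<lambda>b. 0) w = 0"
  by (induction w) simp_all

lemma Yop_sum: "Yop (\<lambda>b. \<Sum>x\<in>A. f x b) w = (\<Sum>x\<in>A. Yop (f x) w)"
  by (induction A rule: infinite_finite_induct) (simp_all add: Yop_add)

lemma Yop_scale: "Yop (\<lambda>b. sc c * f b) w = sc c * Yop f w"
  by (rule Yop_hom[where h = "\<lambda>x. sc c * x", symmetric]) (simp_all add: distrib_left sc_left)

lemma Yop_right: "Yop (\<lambda>b. f b * z) w = Yop f w * z"
  by (rule Yop_hom[where h = "\<lambda>x. x * z", symmetric]) (simp_all add: distrib_right mult.assoc)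

lemma Yop_cong_len:
  "(\<And>b. length b = length w \<Longrightarrow> f b = g b) \<Longrightarrow> Yop f w = Yop g w"
proof (induction w arbitrary: f g)
  case (Cons c w)
  show ?case unfolding Yop_Cons
    by (rule Cons.IH) (simp only: Cons.prems list.size)
qed simp

lemma Yop_snoc: "Yop f (w @ [c]) = (\<Sum>x\<in>UNIV. Y c x * Yop (\<lambda>b. f (b @ [x])) w)"
proof (induction w arbitrary: f)
  case (Cons d w)
  have "Yop f ((d # w) @ [c]) = (\<Sum>x\<in>UNIV. Y c x * Yop (\<lambda>b. \<Sum>y\<in>UNIV. Y d y * f (y # b @ [x])) w)"
    by (simp add: Cons)
  then show ?case by simp
qed simp

text \<open>All legs are closed: each is contracted with a factor \<open>X\<close>, placed to the right of the value
  of the function, with the weight of the closed letter.\<close>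

primrec Xcon :: "('n list \<Rightarrow> 'o) \<Rightarrow> 'n list \<Rightarrow> 'o" where
  Xcon_Nil: "Xcon f [] = f []"
| Xcon_Cons: "Xcon f (a # w) = Xcon (\<lambda>b. \<Sum>c\<in>UNIV. sc (wt c) * (f (c # b) * X a c)) w"

lemma Xcon_add: "Xcon (\<lambda>b. f b + g b) w = Xcon f w + Xcon g w"
  by (induction w arbitrary: f g) (simp_all add: distrib_left distrib_right sum.distrib)

lemma Xcon_zero [simp]: "Xcon (\<lambda>b. 0) w = 0"
  by (induction w) simp_all

lemma Xcon_sum: "Xcon (\<lambda>b. \<Sum>x\<in>A. f x b) w = (\<Sum>x\<in>A. Xcon (f x) w)"
  by (induction A rule: infinite_finite_induct) (simp_all add: Xcon_add)

lemma Xcon_left: "Xcon (\<lambda>b. z * f b) w = z * Xcon f w"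
proof (induction w arbitrary: f)
  case (Cons a w)
  show ?case
    by (simp add: Cons[symmetric] sum_distrib_left mult.assoc sc_left)
qed simp

lemma Xcon_cong_len:
  "(\<And>b. length b = length w \<Longrightarrow> f b = g b) \<Longrightarrow> Xcon f w = Xcon g w"
proof (induction w arbitrary: f g)
  case (Cons c w)
  show ?case unfolding Xcon_Cons
    by (rule Cons.IH) (simp only: Cons.prems list.size)
qed simp

text \<open>The relation between the entries of \<open>Y\<close> intertwines the actions of \<open>\<Sigma>R\<close> before and after \<open>Y\<close> has been applied to two
  adjacent legs.\<close>

lemma Yop_alternating:
  assumes "alternating scl f"
  shows "alternating scl (Yop f)"
  unfolding alternating_iff_Hecke[OF vs]
proof (intro allI)
  fix v w and a b :: 'n
  show "sc (Q b a) * Yop f (v @ b # a # w) + (if b < a then sc (1 - r) * Yop f (v @ a # b # w) else 0)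
      = sc (- r) * Yop f (v @ a # b # w)"
    using assms
  proof (induction v arbitrary: f)
    case Nil
    define G where "G a b u = (\<Sum>y\<in>UNIV. \<Sum>x\<in>UNIV. Y b y * Y a x * f (x # y # u))" for a b u
    have Yop2: "Yop f (a # b # w) = Yop (G a b) w" for a b
      by (simp add: G_def[abs_def] sum_distrib_left mult.assoc)
    have "sc (Q b a) * G b a u + (if b < a then sc (1 - r) * G a b u else 0) = sc (- r) * G a b u" for u
    proof -
      have "sc (Q b a) * G b a u + (if b < a then sc (1 - r) * G a b u else 0)
        = (\<Sum>y\<in>UNIV. \<Sum>x\<in>UNIV. (sc (Q b a) * (Y a y * Y b x)
            + (if b < a then sc (1 - r) * (Y b y * Y a x) else 0)) * f (x # y # u))"
        by (simp add: G_def sum_distrib_left mult.assoc sum.distrib[symmetric] distrib_right)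
      also have "\<dots> = (\<Sum>y\<in>UNIV. \<Sum>x\<in>UNIV. (sc (Q x y) * (Y b x * Y a y)
            + (if y < x then sc (1 - r) * (Y b y * Y a x) else 0)) * f (x # y # u))"
        by (simp only: YY)
      also have "\<dots> = (\<Sum>y\<in>UNIV. \<Sum>x\<in>UNIV. sc (Q x y) * (Y b x * Y a y) * f (x # y # u))
          + (\<Sum>y\<in>UNIV. \<Sum>x\<in>UNIV. (if y < x then sc (1 - r) * (Y b y * Y a x) else 0) * f (x # y # u))"
        by (simp add: distrib_right sum.distrib)
      also have "(\<Sum>y\<in>UNIV. \<Sum>x\<in>UNIV. sc (Q x y) * (Y b x * Y a y) * f (x # y # u))
          = (\<Sum>y\<in>UNIV. \<Sum>x\<in>UNIV. sc (Q y x) * (Y b y * Y a x) * f (y # x # u))"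
        by (rule sum.swap)
      also have "\<dots> + (\<Sum>y\<in>UNIV. \<Sum>x\<in>UNIV. (if y < x then sc (1 - r) * (Y b y * Y a x) else 0) * f (x # y # u))
         = (\<Sum>y\<in>UNIV. \<Sum>x\<in>UNIV. Y b y * Y a x * (sc (Q y x) * f (y # x # u)
            + (if y < x then sc (1 - r) * f (x # y # u) else 0)))"
        unfolding sum.distrib[symmetric]
        by (intro sum.cong refl) (simp add: distrib_left mult.assoc sc_left)
      also have "\<dots> = (\<Sum>y\<in>UNIV. \<Sum>x\<in>UNIV. Y b y * Y a x * (sc (- r) * f (x # y # u)))"
        using Nil[unfolded alternating_iff_Hecke[OF vs], rule_format, where v = "[]" and w = u, unfolded append_Nil]
        by (simp only:)
      also have "\<dots> = sc (- r) * G a b u"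
        by (simp add: G_def sum_distrib_left sc_left)
      finally show ?thesis .
    qed
    then have "Yop (\<lambda>u. sc (Q b a) * G b a u + (if b < a then sc (1 - r) * G a b u else 0)) w
        = Yop (\<lambda>u. sc (- r) * G a b u) w"
      by simp
    then show ?case
      unfolding append_Nil Yop2 by (cases "b < a") (simp_all add: Yop_add Yop_scale)
  next
    case (Cons c v)
    have "alternating scl (\<lambda>u. \<Sum>x\<in>UNIV. Y c x * f (x # u))"
      by (intro alternating_sum[OF vs] alternating_left alternating_Cons Cons.prems)
    from Cons.IH[OF this] show ?case by (simp only: append_Cons Yop_Cons Xcon_Cons)
  qed
qed

text \<open>Likewise with the relation between the entries of \<open>X\<close>; the product of the two weights is symmetric in the two legs.\<close>

lemma Xcon_alternating:
  assumes "alternating scl f"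
  shows "alternating scl (Xcon f)"
  unfolding alternating_iff_Hecke[OF vs]
proof (intro allI)
  fix v w and a b :: 'n
  show "sc (Q b a) * Xcon f (v @ b # a # w) + (if b < a then sc (1 - r) * Xcon f (v @ a # b # w) else 0)
      = sc (- r) * Xcon f (v @ a # b # w)"
    using assms
  proof (induction v arbitrary: f)
    case Nil
    define g where "g x y u = sc (wt x * wt y) * f (x # y # u)" for x y u
    define G where "G a b u = (\<Sum>y\<in>UNIV. \<Sum>x\<in>UNIV. g x y u * (X a x * X b y))" for a b u
    have g: "sc (Q y x) * g y x u + (if y < x then sc (1 - r) * g x y u else 0) = sc (- r) * g x y u" for x y u
    proof -
      have "sc (Q y x) * g y x u + (if y < x then sc (1 - r) * g x y u else 0)
        = sc (wt x * wt y) * (sc (Q y x) * f (y # x # u) + (if y < x then sc (1 - r) * f (x # y # u) else 0))"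
        by (cases "y < x") (simp_all add: g_def distrib_left mult.commute[of "wt y" "wt x"] scl_comm[of _ "wt x * wt y"])
      also have "\<dots> = sc (wt x * wt y) * (sc (- r) * f (x # y # u))"
        using Nil[unfolded alternating_iff_Hecke[OF vs], rule_format, where v = "[]" and w = u and a = x and b = y,
          unfolded append_Nil] by (simp only:)
      finally show ?thesis 
        by (simp only: g_def scl_comm[of "- r" "wt x * wt y"])
    qed
    have Xcon2: "Xcon f (a # b # w) = Xcon (G a b) w" for a b
    proof -
      have "sc (wt y) * ((\<Sum>x\<in>UNIV. sc (wt x) * (f (x # y # u) * X a x)) * X b y)
          = (\<Sum>x\<in>UNIV. g x y u * (X a x * X b y))" for y u
        unfolding g_def sum_distrib_left sum_distrib_right
        by (intro sum.cong refl) (simp only: sc_mult mult.assoc scl_comm[of "wt y"])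
      then show ?thesis unfolding Xcon_Cons G_def by (simp only:)
    qed
    have "sc (Q b a) * G b a u + (if b < a then sc (1 - r) * G a b u else 0) = sc (- r) * G a b u" for u
    proof -
      have "sc (Q b a) * G b a u + (if b < a then sc (1 - r) * G a b u else 0)
        = (\<Sum>y\<in>UNIV. \<Sum>x\<in>UNIV. g x y u * (sc (Q b a) * (X b x * X a y)
            + (if b < a then sc (1 - r) * (X a x * X b y) else 0)))"
        by (simp add: G_def sum_distrib_left sc_left sum.distrib[symmetric] distrib_left)
      also have "\<dots> = (\<Sum>y\<in>UNIV. \<Sum>x\<in>UNIV. g x y u * (sc (Q x y) * (X a y * X b x)
            + (if y < x then sc (1 - r) * (X a x * X b y) else 0)))"
        by (simp only: XX)
      also have "\<dots> = (\<Sum>y\<in>UNIV. \<Sum>x\<in>UNIV. g x y u * (sc (Q x y) * (X a y * X b x)))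
          + (\<Sum>y\<in>UNIV. \<Sum>x\<in>UNIV. g x y u * (if y < x then sc (1 - r) * (X a x * X b y) else 0))"
        by (simp add: distrib_left sum.distrib)
      also have "(\<Sum>y\<in>UNIV. \<Sum>x\<in>UNIV. g x y u * (sc (Q x y) * (X a y * X b x)))
          = (\<Sum>y\<in>UNIV. \<Sum>x\<in>UNIV. g y x u * (sc (Q y x) * (X a x * X b y)))"
        by (rule sum.swap)
      also have "\<dots> + (\<Sum>y\<in>UNIV. \<Sum>x\<in>UNIV. g x y u * (if y < x then sc (1 - r) * (X a x * X b y) else 0))
         = (\<Sum>y\<in>UNIV. \<Sum>x\<in>UNIV. (sc (Q y x) * g y x u
            + (if y < x then sc (1 - r) * g x y u else 0)) * (X a x * X b y))"
        unfolding sum.distrib[symmetric]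
        by (intro sum.cong refl) (simp add: distrib_right mult.assoc sc_left)
      also have "\<dots> = sc (- r) * G a b u"
        by (simp only: g G_def sum_distrib_left mult.assoc)
      finally show ?thesis .
    qed
    then have "Xcon (\<lambda>u. sc (Q b a) * G b a u + (if b < a then sc (1 - r) * G a b u else 0)) w
        = Xcon (\<lambda>u. sc (- r) * G a b u) w"
      by simp
    then show ?case
      unfolding append_Nil Xcon2 by (cases "b < a") (simp_all add: Xcon_add Xcon_left)
  next
    case (Cons c v)
    have "alternating scl (\<lambda>u. \<Sum>x\<in>UNIV. sc (wt x) * (f (x # u) * X c x))"
      by (intro alternating_sum[OF vs] alternating_scale[OF vs] alternating_right alternating_Cons Cons.prems)
    from Cons.IH[OF this] show ?case by (simp only: append_Cons Yop_Cons Xcon_Cons)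
  qed
qed

end

section \<open>Moving a generator through a row of generators\<close>

context qparam begin

text \<open>The matrix of transport: the part in which the auxiliary leg leaves with the letter \<open>p\<close>.\<close>

definition tr :: "'n \<Rightarrow> ('n list \<Rightarrow> 'f) \<Rightarrow> 'n list \<Rightarrow> 'n \<Rightarrow> 'f" where
  "tr p g b i = transport (*) (\<lambda>p' a. if p' = p then g a else 0) b i"

end

context quantum_pair begin

abbreviation Top :: "('n \<Rightarrow> 'n list \<Rightarrow> 'o) \<Rightarrow> 'n list \<Rightarrow> 'n \<Rightarrow> 'o" where
  "Top \<equiv> transport scl"

lemma Top_left: "z * Top F b i = Top (\<lambda>p a. z * F p a) b i"
  by (rule transport_hom[where h = "\<lambda>x. z * x"]) (simp_all add: distrib_left sc_left[of z])

text \<open>One leg: \<open>X R Y = Y R X\<close>. The two geometric sums in the relation account for the off-diagonal entries of R.\<close>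

lemma exchange_pointwise:
  fixes F :: "'n \<Rightarrow> 'n list \<Rightarrow> 'o" and c :: 'n
  defines "F' \<equiv> \<lambda>d a. sc (Q d c) * (\<Sum>x\<in>UNIV. Y c x * F d (x # a))
     + (if d < c then sc (1 - r) * (\<Sum>x\<in>UNIV. Y d x * F c (x # a)) else 0)"
  shows "(\<Sum>x\<in>UNIV. Y c x * (sc (Q p x) * (\<Sum>d\<in>UNIV. X p d * F d (x # a))
      + (if p < x then sc (1 - r) * (\<Sum>d\<in>UNIV. X x d * F d (p # a)) else 0)))
    = (\<Sum>d\<in>UNIV. X p d * F' d a)"
proof -
  let ?U = "UNIV :: 'n set"
  have "(\<Sum>x\<in>?U. Y c x * (sc (Q p x) * (\<Sum>d\<in>UNIV. X p d * F d (x # a))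
      + (if p < x then sc (1 - r) * (\<Sum>d\<in>UNIV. X x d * F d (p # a)) else 0)))
    = (\<Sum>x\<in>?U. \<Sum>d\<in>?U. sc (Q p x) * (Y c x * X p d) * F d (x # a))
      + (\<Sum>x\<in>?U. \<Sum>d\<in>?U. (if p < x then sc (1 - r) * (Y c x * X x d) else 0) * F d (p # a))"
    unfolding sum.distrib[symmetric]
    by (intro sum.cong refl) (simp add: distrib_left sum_distrib_left mult.assoc sc_left[of "Y _ _"] sum.distrib)
  also have "(\<Sum>x\<in>?U. \<Sum>d\<in>?U. (if p < x then sc (1 - r) * (Y c x * X x d) else 0) * F d (p # a))
    = (\<Sum>d\<in>?U. (\<Sum>x\<in>?U. if p < x then sc (1 - r) * (Y c x * X x d) else 0) * F d (p # a))"
    by (subst sum.swap) (simp add: sum_distrib_right)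
  also have "\<dots> = (\<Sum>d\<in>?U. (sc (1 - r) * (\<Sum>k\<in>{k. p < k}. Y c k * X k d)) * F d (p # a))"
    by (simp add: sum_distrib_left sum.If_cases)
  also have "\<dots> = (\<Sum>x\<in>?U. \<Sum>d\<in>?U. (if p = x then sc (1 - r) * (\<Sum>k\<in>{k. p < k}. Y c k * X k d) else 0) * F d (x # a))"
    by (subst sum.swap) (simp add: if_distrib[of "\<lambda>z. z * _"] cong: if_cong)
  also have "(\<Sum>x\<in>?U. \<Sum>d\<in>?U. sc (Q p x) * (Y c x * X p d) * F d (x # a)) + \<dots>
    = (\<Sum>x\<in>?U. \<Sum>d\<in>?U. (sc (Q p x) * (Y c x * X p d)
        + (if p = x then sc (1 - r) * (\<Sum>k\<in>{k. p < k}. Y c k * X k d) else 0)) * F d (x # a))"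
    by (simp add: sum.distrib distrib_right)
  also have "\<dots> = (\<Sum>x\<in>?U. \<Sum>d\<in>?U. (sc (Q d c) * (X p d * Y c x)
        + (if c = d then sc (1 - r) * (\<Sum>l\<in>{l. l < c}. X p l * Y l x) else 0)) * F d (x # a))"
    by (simp only: XY)
  also have "\<dots> = (\<Sum>x\<in>?U. \<Sum>d\<in>?U. sc (Q d c) * (X p d * Y c x) * F d (x # a))
     + (\<Sum>x\<in>?U. (sc (1 - r) * (\<Sum>l\<in>{l. l < c}. X p l * Y l x)) * F c (x # a))"
    by (simp add: sum.distrib distrib_right if_distrib[of "\<lambda>z. z * _"] cong: if_cong)
  also have "(\<Sum>x\<in>?U. \<Sum>d\<in>?U. sc (Q d c) * (X p d * Y c x) * F d (x # a))
     = (\<Sum>d\<in>?U. X p d * (sc (Q d c) * (\<Sum>x\<in>?U. Y c x * F d (x # a))))"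
    by (subst sum.swap) (simp add: sum_distrib_left mult.assoc sc_left[of "X _ _"])
  also have "(\<Sum>x\<in>?U. (sc (1 - r) * (\<Sum>l\<in>{l. l < c}. X p l * Y l x)) * F c (x # a))
     = (\<Sum>d\<in>{d. d < c}. X p d * (sc (1 - r) * (\<Sum>x\<in>?U. Y d x * F c (x # a))))"
    unfolding sum_distrib_left sum_distrib_right
    by (subst sum.swap) (simp add: mult.assoc sc_left[of "X _ _"])
  also have "\<dots> = (\<Sum>d\<in>?U. X p d * (if d < c then sc (1 - r) * (\<Sum>x\<in>?U. Y d x * F c (x # a)) else 0))"
    by (simp add: if_distrib[of "\<lambda>z. _ * z"] sum.If_cases cong: if_cong)
  finally show ?thesis
    unfolding F'_def distrib_left sum.distrib .
qed

text \<open>By induction on the legs, an \<open>X\<close> on the auxiliary leg moves from one side of the row of \<open>Y\<close>s to the other.\<close>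

lemma exchange:
  "Yop (\<lambda>b. Top (\<lambda>p a. \<Sum>d\<in>UNIV. X p d * F d a) b i) c
    = (\<Sum>m\<in>UNIV. X i m * Top (\<lambda>d e. Yop (F d) e) c m)"
proof (induction c arbitrary: F)
  case (Cons c1 c)
  define F' where "F' = (\<lambda>d a. sc (Q d c1) * (\<Sum>x\<in>UNIV. Y c1 x * F d (x # a))
     + (if d < c1 then sc (1 - r) * (\<Sum>x\<in>UNIV. Y d x * F c1 (x # a)) else 0))"
  have "Yop (\<lambda>b. Top (\<lambda>p a. \<Sum>d\<in>UNIV. X p d * F d a) b i) (c1 # c)
    = Yop (\<lambda>b. Top (\<lambda>p a. \<Sum>d\<in>UNIV. X p d * F' d a) b i) c"
    unfolding Yop_Cons transport.simps Top_left transport_sum[OF vs, symmetric]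
    by (simp only: exchange_pointwise F'_def)
  also have "\<dots> = (\<Sum>m\<in>UNIV. X i m * Top (\<lambda>d e. Yop (F' d) e) c m)" by (rule Cons.IH)
  also have "(\<lambda>d e. Yop (F' d) e) = (\<lambda>d e. sc (Q d c1) * Yop (F d) (c1 # e)
     + (if d < c1 then sc (1 - r) * Yop (F c1) (d # e) else 0))"
    by (intro ext) (simp add: F'_def Yop_add Yop_scale)
  finally show ?case by simp
qed simp

text \<open>If the auxiliary leg belongs to the same alternating tensor, then every crossing is an exchange of two of its
  legs and gives \<open>-r\<close>.\<close>

lemma transport_same:
  assumes "vector_space s" "alternating s h"
  shows "transport s (\<lambda>p a. h (p # a)) b m = s ((- r) ^ length b) (h (b @ [m]))"
  using assms(2)
proof (induction b arbitrary: h)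
  case Nil
  interpret vector_space s by fact
  show ?case by simp
next
  case (Cons x b)
  interpret vector_space s by fact
  have "transport s (\<lambda>p a. h (p # a)) (x # b) m = transport s (\<lambda>p a. s (- r) (h (x # p # a))) b m"
    using Cons.prems[unfolded alternating_iff_Hecke[OF assms(1)], rule_format, where v = "[]",
        unfolded append_Nil]
    by (simp only: transport.simps)
  also have "\<dots> = s (- r) (transport s (\<lambda>p a. h (x # p # a)) b m)"
    by (rule transport_scale[OF assms(1)])
  finally show ?case
    by (simp only: Cons.IH[OF alternating_Cons[OF Cons.prems]] scale_scale list.size append_Cons power_Suc power_add)
      simp
qed

text \<open>Closing the first leg against the auxiliary leg: \<open>exchange\<close> applied to a tensor whose first leg
  is joined to the auxiliary one, where the weighted trace of R is trivial by \<open>wt_trace\<close>.\<close>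

lemma partial_trace:
  assumes "alternating scl g"
  shows "(\<Sum>c\<in>UNIV. sc (wt c) * Yop (\<lambda>b. Top (\<lambda>p a. X p c * g a) b i) (c # w))
    = sc ((- r) ^ length w) * (\<Sum>m\<in>UNIV. X i m * Yop g (w @ [m]))"
proof -
  let ?h = "Yop g"
  have "Yop (\<lambda>b. Top (\<lambda>p a. X p c * g a) b i) (c # w)
      = (\<Sum>m\<in>UNIV. X i m * Top (\<lambda>p a. (if p = c then ?h (c # a) else 0)
          + (if p < c then sc (1 - r) * ?h (p # a) else 0)) w m)" for c
  proof -
    have "(\<lambda>p a. X p c * g a) = (\<lambda>p a. \<Sum>d\<in>UNIV. X p d * (if d = c then g a else 0))"
      by (simp add: if_distrib cong: if_cong)
    then have "Yop (\<lambda>b. Top (\<lambda>p a. X p c * g a) b i) (c # w)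
      = (\<Sum>m\<in>UNIV. X i m * Top (\<lambda>d e. Yop (\<lambda>a. if d = c then g a else 0) e) (c # w) m)"
      by (simp only: exchange)
    also have "(\<lambda>d e. Yop (\<lambda>a. if d = c then g a else 0) e) = (\<lambda>d e. if d = c then ?h e else 0)"
      by (intro ext) simp
    finally show ?thesis
      unfolding transport.simps by (simp add: if_distrib[of "\<lambda>z. _ * z"] cong: if_cong)
  qed
  then have "(\<Sum>c\<in>UNIV. sc (wt c) * Yop (\<lambda>b. Top (\<lambda>p a. X p c * g a) b i) (c # w))
    = (\<Sum>m\<in>UNIV. X i m * Top (\<lambda>p a. \<Sum>c\<in>UNIV. sc (wt c) * ((if p = c then ?h (c # a) else 0)
          + (if p < c then sc (1 - r) * ?h (p # a) else 0))) w m)"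
    by (simp add: sum_distrib_left transport_sum[OF vs] transport_scale[OF vs] sc_left[of "X _ _"])
       (rule sum.swap)
  also have "(\<lambda>p a. \<Sum>c\<in>UNIV. sc (wt c) * ((if p = c then ?h (c # a) else 0)
          + (if p < c then sc (1 - r) * ?h (p # a) else 0))) = (\<lambda>p a. ?h (p # a))"
  proof (intro ext)
    fix p a
    have "(\<Sum>c\<in>UNIV. sc (wt c) * ((if p = c then ?h (c # a) else 0)
          + (if p < c then sc (1 - r) * ?h (p # a) else 0)))
        = sc (wt p) * ?h (p # a) + (\<Sum>c\<in>{c. p < c}. sc (wt c) * (sc (1 - r) * ?h (p # a)))"
      by (simp add: distrib_left sum.distrib if_distrib[of "\<lambda>z. _ * z"] sum.If_cases cong: if_cong)
    also have "\<dots> = sc (wt p + (1 - r) * (\<Sum>c\<in>{c. p < c}. wt c)) * ?h (p # a)"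
      by (simp add: sc_add sc_mult sc_sum distrib_right sum_distrib_right sum_distrib_left mult.assoc
          scl_comm[of "wt _"])
    finally show "(\<Sum>c\<in>UNIV. sc (wt c) * ((if p = c then ?h (c # a) else 0)
          + (if p < c then sc (1 - r) * ?h (p # a) else 0))) = ?h (p # a)"
      by (simp only: wt_trace sc_1 mult_1)
  qed
  finally show ?thesis
    by (simp only: transport_same[OF vs Yop_alternating[OF assms]] sum_distrib_left sc_left[of "X _ _"])
qed

lemma Top_numeric:
  "Top (\<lambda>p a. x p * sc (g a)) b i = (\<Sum>p\<in>UNIV. sc (tr p g b i) * x p)"
proof -
  have "sc (tr p g b i) * x p = Top (\<lambda>p' a. if p' = p then x p' * sc (g a) else 0) b i" for p
  proof -
    have "sc (tr p g b i) * x p = Top (\<lambda>p' a. sc (if p' = p then g a else 0) * x p) b i"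
      unfolding tr_def
      by (rule transport_hom[where h = "\<lambda>z. sc z * x p"]) (simp_all add: sc_add sc_mult distrib_right mult.assoc)
    also have "(\<lambda>p' a. sc (if p' = p then g a else 0) * x p) = (\<lambda>p' a. if p' = p then x p' * sc (g a) else 0)"
      by (intro ext) (simp add: sc_comm)
    finally show ?thesis .
  qed
  then have "(\<Sum>p\<in>UNIV. sc (tr p g b i) * x p) = Top (\<lambda>p' a. \<Sum>p\<in>UNIV. if p' = p then x p' * sc (g a) else 0) b i"
    by (simp only: transport_sum[OF vs])
  then show ?thesis by simp
qed

text \<open>Read from left to right, an \<open>X\<close> on the left is brought to the right of all \<open>Y\<close>s, at the cost of transporting \<open>g\<close>; its
  leg becomes one that is closed by \<open>X\<close>.\<close>

lemma move_X:
  assumes "alternating (*) g"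
  shows "sc ((- r) ^ length w) * (\<Sum>m\<in>UNIV. X i m * Yop (\<lambda>b. sc (g b)) (w @ [m]))
    = (\<Sum>p\<in>UNIV. \<Sum>c\<in>UNIV. sc (wt c) * (Yop (\<lambda>b. sc (tr p g b i)) (c # w) * X p c))"
proof -
  have "sc ((- r) ^ length w) * (\<Sum>m\<in>UNIV. X i m * Yop (\<lambda>b. sc (g b)) (w @ [m]))
    = (\<Sum>c\<in>UNIV. sc (wt c) * Yop (\<lambda>b. Top (\<lambda>p a. X p c * sc (g a)) b i) (c # w))"
    by (rule partial_trace[OF alternating_sc[OF assms], symmetric])
  also have "\<dots> = (\<Sum>c\<in>UNIV. \<Sum>p\<in>UNIV. sc (wt c) * (Yop (\<lambda>b. sc (tr p g b i)) (c # w) * X p c))"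
    by (simp only: Top_numeric Yop_sum Yop_right sum_distrib_left)
  finally show ?thesis by (subst sum.swap)
qed

lemma move_X_contract:
  assumes "alternating (*) g"
  shows "sc ((- r) ^ (length w + length u)) * Xcon (\<lambda>v. \<Sum>m\<in>UNIV. X i m * Yop (\<lambda>b. sc (g b)) (v @ u @ [m])) w
       = (\<Sum>p\<in>UNIV. Xcon (\<lambda>v. Yop (\<lambda>b. sc (tr p g b i)) (v @ u)) (p # w))"
proof -
  have "sc ((- r) ^ (length w + length u)) * Xcon (\<lambda>v. \<Sum>m\<in>UNIV. X i m * Yop (\<lambda>b. sc (g b)) (v @ u @ [m])) w
     = Xcon (\<lambda>v. sc ((- r) ^ length (v @ u)) * (\<Sum>m\<in>UNIV. X i m * Yop (\<lambda>b. sc (g b)) ((v @ u) @ [m]))) w"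
    unfolding Xcon_left[symmetric] by (rule Xcon_cong_len) simp
  also have "\<dots> = (\<Sum>p\<in>UNIV. Xcon (\<lambda>v. Yop (\<lambda>b. sc (tr p g b i)) (v @ u)) (p # w))"
    by (simp only: move_X[OF assms] append_Cons Xcon_sum Xcon_Cons)
  finally show ?thesis .
qed

end

section \<open>The standard basis of the alternating functions\<close>

context qparam begin

lemma vs_f: "vector_space ((*) :: 'f \<Rightarrow> _)"
  by unfold_locales (simp_all add: algebra_simps)

abbreviation sl :: "'n set \<Rightarrow> 'n list" where "sl \<equiv> sorted_list_of_set"

lemma sort_distinct: "distinct w \<Longrightarrow> sort w = sl (set w)" for w :: "'n list"
  by (simp add: sorted_list_of_set_sort_remdups distinct_remdups_id)

lemma alternating_sl:
  assumes "vector_space s" "alternating s f"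
  shows "f w = s (eps_c w) (f (sl (set w)))"
proof (cases "distinct w")
  case True
  then show ?thesis using alternating_sort[OF assms, of w] by (simp add: sort_distinct)
next
  case False
  interpret vector_space s by fact
  show ?thesis using False by (simp add: alternating_vanish[OF assms] eps_c_not_distinct)
qed

lemma prod_list_set: "distinct v \<Longrightarrow> (\<Prod>y\<leftarrow>v. f y) = (\<Prod>y\<in>set v. f y :: 'f)"
  by (simp add: prod.distinct_set_conv_list)

lemma eps_c_Cons: "distinct v \<Longrightarrow> eps_c (x # v) = (\<Prod>y\<in>set v. inv_c x y) * eps_c v"
  by (simp add: prod_list_set)

lemma eps_c_snoc: "distinct v \<Longrightarrow> eps_c (v @ [x]) = eps_c v * (\<Prod>y\<in>set v. inv_c y x)"
  by (simp add: eps_c_append prod_list_set)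

lemma eps_r_Cons: "distinct v \<Longrightarrow> eps_r (x # v) = (\<Prod>y\<in>set v. inv_r x y) * eps_r v"
  by (simp add: prod_list_set)

lemma eps_r_snoc: "distinct v \<Longrightarrow> eps_r (v @ [x]) = eps_r v * (\<Prod>y\<in>set v. inv_r y x)"
  by (simp add: eps_r_append prod_list_set)

lemma eps_c_sl [simp]: "eps_c (sl K) = 1" and eps_r_sl [simp]: "eps_r (sl K) = 1"
  by (simp_all add: eps_c_sorted eps_r_sorted)

text \<open>The basis vector \<open>u\<^sub>K\<close> of the alternating functions: supported on the arrangements of \<open>K\<close>, with value \<open>1\<close> on the
  increasing one.\<close>

definition uv :: "'n set \<Rightarrow> 'n list \<Rightarrow> 'f" where
  "uv K b = (if set b = K then eps_c b else 0)"

lemma uv_alternating: "alternating (*) (uv K)"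
proof (rule alternatingI)
  fix v w and a b :: 'n
  assume ab: "a < b"
  have "set (v @ b # a # w) = set (v @ a # b # w)" by auto
  then show "uv K (v @ b # a # w) = - Q a b * uv K (v @ a # b # w)"
    by (simp only: uv_def alternatingD(1)[OF alternating_eps_c ab]) simp
next
  show "uv K (v @ a # a # w) = 0" for v w a
    by (simp only: uv_def alternatingD(2)[OF alternating_eps_c] if_cancel)
qed

lemma uv_sl: "uv K (sl K') = (if K = K' then 1 else 0)"
  by (auto simp: uv_def)

lemma uv_expand:
  assumes "alternating (*) f"
  shows "f b = (\<Sum>K\<in>UNIV. f (sl K) * uv K b)"
proof -
  have "(\<Sum>K\<in>UNIV. f (sl K) * uv K b) = f (sl (set b)) * eps_c b"
    by (simp add: uv_def if_distrib cong: if_cong)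
  then show ?thesis using alternating_sl[OF vs_f assms, of b] by (simp add: mult.commute)
qed

lemma uv_card: "length b \<noteq> card K \<Longrightarrow> uv K b = 0"
  by (cases "distinct b") (auto simp: uv_def distinct_card eps_c_not_distinct)

definition Qprod :: "'n \<Rightarrow> 'n set \<Rightarrow> 'f" where "Qprod p E = (\<Prod>y\<in>E. Q p y)"
definition Cl :: "'n set \<Rightarrow> 'n \<Rightarrow> 'f" where "Cl E x = (\<Prod>y\<in>E. inv_c y x)"
definition Cr :: "'n \<Rightarrow> 'n set \<Rightarrow> 'f" where "Cr x E = (\<Prod>y\<in>E. inv_c x y)"

lemma inv_c_nz: "y \<noteq> x \<Longrightarrow> inv_c y x \<noteq> 0"
  by (simp add: inv_c_def)

lemma Cl_nz: "x \<notin> E \<Longrightarrow> Cl E x \<noteq> 0"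
  unfolding Cl_def by (metis finite prod_zero_iff inv_c_nz)

text \<open>Splitting off the last leg of \<open>u\<^sub>K\<close> (Laplace expansion).\<close>

lemma uv_snoc:
  "uv K (b @ [i]) = (if i \<in> K then Cl (K - {i}) i * uv (K - {i}) b else 0)"
proof (cases "distinct (b @ [i])")
  case True
  then have "set (b @ [i]) = K \<longleftrightarrow> i \<in> K \<and> set b = K - {i}" by auto
  with True show ?thesis
    by (cases "i \<in> K"; cases "set b = K - {i}") (simp_all add: uv_def eps_c_snoc Cl_def)
next
  case False
  then have "uv K (b @ [i]) = 0" by (simp only: uv_def eps_c_not_distinct[OF False] if_cancel)
  moreover have "uv (K - {i}) b = 0"
  proof (cases "distinct b")
    case True
    with False have "i \<in> set b" by simp
    then have "set b \<noteq> K - {i}" by blast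
    then show ?thesis by (simp add: uv_def)
  next
    case False
    then show ?thesis by (simp only: uv_def eps_c_not_distinct[OF False] if_cancel)
  qed
  ultimately show ?thesis by simp
qed

lemma tr_skip: "p \<notin> set v \<Longrightarrow> tr p g (v @ w) i = (\<Prod>y\<leftarrow>v. Q p y) * tr p (\<lambda>u. g (v @ u)) w i"
proof (induction v arbitrary: g)
  case (Cons y v)
  have "tr p g ((y # v) @ w) i
      = transport (*) (\<lambda>p' a. Q p y * (if p' = p then g (y # a) else 0)) (v @ w) i"
    unfolding tr_def append_Cons transport.simps using Cons.prems
    by (intro arg_cong[of _ _ "\<lambda>F. transport (*) F (v @ w) i"] ext) auto
  also have "\<dots> = Q p y * tr p (\<lambda>a. g (y # a)) (v @ w) i"
    by (simp only: transport_scale[OF vs_f] tr_def)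
  finally show ?case using Cons by simp
qed simp

lemma tr_notin: "p \<notin> set b \<Longrightarrow> tr p g b i = (if i = p then (\<Prod>y\<leftarrow>b. Q p y) * g b else 0)"
  using tr_skip[of p b g "[]" i] by (auto simp: tr_def)

lemma tr_last: "p \<notin> set v \<Longrightarrow> tr p g (v @ [p]) i = (\<Prod>y\<leftarrow>v. Q p y) *
    (if i = p then g (v @ [p]) else if i < p then (1 - r) * g (v @ [i]) else 0)"
  by (cases "i = p") (simp_all add: tr_skip tr_def[of p _ "[p]"])

lemma tr_alternating: "alternating (*) g \<Longrightarrow> alternating (*) (\<lambda>b. tr p g b i)"
  unfolding tr_def
proof (rule transport_alternating)
  fix p'
  assume g: "alternating (*) g"
  show "alternating (*) (\<lambda>a. if p' = p then g a else 0)"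
  proof (cases "p' = p")
    case True
    with g show ?thesis by simp
  next
    case False
    then show ?thesis by (simp add: alternating_def)
  qed
qed

text \<open>On an increasing word the auxiliary leg can change its letter at most once before \<open>u\<^sub>K\<close> vanishes: either it keeps the letter
  \<open>i\<close>, or it exchanges \<open>i\<close> for a larger letter \<open>p\<close> of the word.\<close>

lemma tr_uv:
  "tr p (uv K) (sl K') i =
     (if p \<in> K' then
        (if i = p then (if K = K' then Qprod p (K' - {p}) else 0)
         else if i < p \<and> i \<notin> K' \<and> K = insert i (K' - {p})
           then (1 - r) * Qprod p (K' - {p}) * Cl (K' - {p}) i / Cl (K' - {p}) p else 0)
      else if i = p \<and> K = K' then Qprod p K' else 0)"
proof (cases "p \<in> K'")
  case False
  then show ?thesis by (auto simp: tr_notin prod_list_set Qprod_def uv_sl)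
next
  case True
  let ?v = "sl (K' - {p})"
  have set: "set (?v @ [p]) = K'" using True by auto
  have "tr p (uv K) (?v @ [p]) i = eps_c (?v @ [p]) * tr p (uv K) (sl K') i"
    using alternating_sl[OF vs_f tr_alternating[OF uv_alternating], where w = "?v @ [p]"] by (simp only: set)
  moreover have "eps_c (?v @ [p]) = Cl (K' - {p}) p" by (simp add: eps_c_snoc Cl_def)
  ultimately have e: "tr p (uv K) (sl K') i = tr p (uv K) (?v @ [p]) i / Cl (K' - {p}) p"
    using Cl_nz[of p "K' - {p}"] by simp
  have [simp]: "(\<Prod>y\<leftarrow>?v. Q p y) = Qprod p (K' - {p})" by (simp add: prod_list_set Qprod_def)
  show ?thesis
  proof (cases "i = p")
    case True
    have "uv K (?v @ [p]) = (if K = K' then Cl (K' - {p}) p else 0)"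
    proof -
      have "p \<in> K \<and> K - {p} = K' - {p} \<longleftrightarrow> K = K'" using \<open>p \<in> K'\<close> by blast
      moreover have "uv K (?v @ [p]) = (if p \<in> K \<and> K - {p} = K' - {p} then Cl (K' - {p}) p else 0)"
        unfolding uv_snoc uv_sl by (cases "p \<in> K"; cases "K - {p} = K' - {p}"; simp only: simp_thms if_True if_False mult_1_right mult_zero_right)
      ultimately show ?thesis by (simp only:)
    qed
    then show ?thesis unfolding e using True \<open>p \<in> K'\<close> Cl_nz[of p "K' - {p}"]
      by (simp add: tr_last)
  next
    case False
    have "uv K (?v @ [i]) = (if i \<notin> K' \<and> K = insert i (K' - {p}) then Cl (K' - {p}) i else 0)"
    proof -
      have "i \<in> K \<and> K - {i} = K' - {p} \<longleftrightarrow> i \<notin> K' \<and> K = insert i (K' - {p})"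
        using False by blast
      moreover have "uv K (?v @ [i]) = (if i \<in> K \<and> K - {i} = K' - {p} then Cl (K' - {p}) i else 0)"
        unfolding uv_snoc uv_sl by (cases "i \<in> K"; cases "K - {i} = K' - {p}"; simp only: simp_thms if_True if_False mult_1_right mult_zero_right)
      ultimately show ?thesis by (simp only:)
    qed
    then have u: "(if i < p then (1 - r) * uv K (?v @ [i]) else 0)
        = (if i < p \<and> i \<notin> K' \<and> K = insert i (K' - {p}) then (1 - r) * Cl (K' - {p}) i else 0)"
      by (cases "i < p"; cases "i \<notin> K' \<and> K = insert i (K' - {p})";
          simp only: simp_thms if_True if_False mult_zero_right)
    have "tr p (uv K) (?v @ [p]) i = Qprod p (K' - {p}) * (if i < p then (1 - r) * uv K (?v @ [i]) else 0)"
      using False by (simp add: tr_last)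
    then show ?thesis unfolding e u using False \<open>p \<in> K'\<close>
      by (cases "i < p \<and> i \<notin> K' \<and> K = insert i (K' - {p})") (simp_all only: simp_thms if_True if_False, simp_all)
  qed
qed

end

section \<open>Identities between products of the parameters\<close>

context qparam begin

text \<open>This is \<open>(-q)\<^sub>K\<^sub>>\<^sub>j\<close>, while \<open>Cl (K - {i}) i\<close> is \<open>(-q)\<^sub>i\<^sub><\<^sub>K\<close>.\<close>

definition Gr :: "'n \<Rightarrow> 'n set \<Rightarrow> 'f" where
  "Gr j E = (\<Prod>y\<in>E. if j < y then - Q y j else 1)"

lemma power_card_prod: "c ^ card {y \<in> E. P y} = (\<Prod>y\<in>E. if P y then c else 1 :: 'f)" for E :: "'n set"
  by (simp add: prod.If_cases Int_def)

lemma power_card_prod_all: "c ^ card E = (\<Prod>y\<in>E. c :: 'f)" for E :: "'n set"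
  by simp

lemma Q_inv: "i \<noteq> j \<Longrightarrow> Q j i = r / Q i j"
  using Q_mult[of i j] by (simp add: field_simps)

lemmas prod_defs = Gr_def Qprod_def Cl_def Cr_def

lemma coeff_first:
  assumes "i \<notin> E"
  shows "Qprod i E * Cr i E * r ^ card {y \<in> E. i < y} = (- r) ^ card E * Cl E i"
  unfolding prod_defs power_card_prod
  unfolding power_card_prod_all prod.distrib[symmetric]
proof (rule prod.cong[OF refl])
  fix y assume "y \<in> E"
  with assms have "y \<noteq> i" by auto
  then consider "y < i" | "i < y" by (meson linorder_neqE)
  then show "Q i y * inv_c i y * (if i < y then r else 1) = - r * inv_c y i"
    using \<open>y \<noteq> i\<close> Q_mult[of i y] by cases (auto simp: inv_c_def)
qed

lemma coeff_exchange:
  assumes "i \<notin> F" "p \<notin> F" "i < p"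
  shows "Qprod p F * Cl F i * Cr p F = r ^ card {y \<in> F. i < y \<and> y < p} * (Qprod i F * Cr i F * Cl F p)"
  unfolding prod_defs power_card_prod
  unfolding power_card_prod_all prod.distrib[symmetric]
proof (rule prod.cong[OF refl])
  fix y assume "y \<in> F"
  with assms have n: "y \<noteq> i" "y \<noteq> p" by auto
  then consider "y < i" "y < p" | "i < y" "y < p" | "i < y" "p < y"
    using assms(3) by (meson linorder_neqE less_trans)
  then show "Q p y * inv_c y i * inv_c p y
    = (if i < y \<and> y < p then r else 1) * (Q i y * inv_c i y * inv_c y p)"
    using n Q_mult[of i y] Q_mult[of p y] by cases (auto simp: inv_c_def)
qed

lemma coeff_exchange_diag:
  assumes "i \<notin> F" "p \<notin> F" "i < p"
  shows "Gr i F * Qprod p F * Cl F i * Cr p F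
    = (- r) ^ card F * r ^ card {y \<in> F. i < y \<and> y < p} * Cl F p"
  unfolding prod_defs power_card_prod
  unfolding power_card_prod_all prod.distrib[symmetric]
proof (rule prod.cong[OF refl])
  fix y assume "y \<in> F"
  with assms have n: "y \<noteq> i" "y \<noteq> p" by auto
  then consider "y < i" "y < p" | "i < y" "y < p" | "i < y" "p < y"
    using assms(3) by (meson linorder_neqE less_trans)
  then show "(if i < y then - Q y i else 1) * Q p y * inv_c y i * inv_c p y
    = - r * (if i < y \<and> y < p then r else 1) * inv_c y p"
    using n Q_inv[of y i] Q_inv[of y p] by cases (auto simp: inv_c_def)
qed

lemma coeff_diag:
  assumes "i \<notin> F"
  shows "Gr i F * Qprod i F * Cr i F = (- r) ^ card F"
  unfolding prod_defs power_card_prod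
  unfolding power_card_prod_all prod.distrib[symmetric]
proof (rule prod.cong[OF refl])
  fix y assume "y \<in> F"
  with assms have n: "y \<noteq> i" by auto
  then consider "y < i" | "i < y" by (meson linorder_neqE)
  then show "(if i < y then - Q y i else 1) * Q i y * inv_c i y = - r"
    using n Q_mult[of i y] Q_mult[of y i] by cases (auto simp: inv_c_def)
qed

lemma coeff_diag_rank:
  assumes "i \<notin> K"
  shows "Gr i K * Cl K i = r ^ card {y \<in> K. i < y}"
  unfolding prod_defs power_card_prod
  unfolding power_card_prod_all prod.distrib[symmetric]
proof (rule prod.cong[OF refl])
  fix y assume "y \<in> K"
  with assms have n: "y \<noteq> i" by auto
  then consider "y < i" | "i < y" by (meson linorder_neqE)
  then show "(if i < y then - Q y i else 1) * inv_c y i = (if i < y then r else 1)"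
    using n Q_mult[of y i] by cases (auto simp: inv_c_def)
qed

lemma Gr_insert: "y \<notin> E \<Longrightarrow> Gr j (insert y E) = (if j < y then - Q y j else 1) * Gr j E"
  and Qprod_insert: "y \<notin> E \<Longrightarrow> Qprod x (insert y E) = Q x y * Qprod x E"
  and Cl_insert: "y \<notin> E \<Longrightarrow> Cl (insert y E) x = inv_c y x * Cl E x"
  and Cr_insert: "y \<notin> E \<Longrightarrow> Cr x (insert y E) = inv_c x y * Cr x E"
  by (simp_all add: prod_defs)

lemma sum_rank_between:
  "(\<Sum>p\<in>{p\<in>E. i < p}. r ^ card {y \<in> E. i < y \<and> y < p}) = (\<Sum>k<card {p\<in>E. i < p}. r ^ k)"
  for E :: "'n set"
proof -
  have "{k \<in> {p \<in> E. i < p}. k < c} = {y \<in> E. i < y \<and> y < c}" for c by auto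
  then show ?thesis using sum_rank_below[of "{p\<in>E. i < p}"] by simp
qed

definition exc :: "'n set \<Rightarrow> 'n \<Rightarrow> 'n \<Rightarrow> 'f" where
  "exc F p i = (1 - r) * Qprod p F * Cl F i / Cl F p"

text \<open>The letters \<open>p > i\<close> of \<open>E\<close> are taken in increasing order; each contributes \<open>(1 - r)\<close> times a power of \<open>r\<close> given
  by its rank, and the sum telescopes against the first term.\<close>

lemma exchange_offdiag:
  assumes "i \<notin> E" "j \<notin> E" "i \<noteq> j"
  shows "Gr j (insert j E) * Qprod i (insert j E) * Cr i E
     + (\<Sum>p\<in>{p\<in>E. i < p}. Gr j (insert i (insert j E - {p})) * exc (insert j E - {p}) p i * Cr p (insert i (E - {p})))
    = - ((- r) ^ card E * (Gr j (insert i (insert j E)) * Cl (insert j E) i))"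
proof -
  let ?T = "Gr j (insert j E) * Qprod i (insert j E) * Cr i E"
  have "Gr j (insert i (insert j E - {p})) * exc (insert j E - {p}) p i * Cr p (insert i (E - {p}))
      = - (1 - r) * r ^ card {y \<in> E. i < y \<and> y < p} * ?T" if p: "p \<in> E" "i < p" for p
  proof -
    define F where "F = E - {p}"
    have E: "E = insert p F" and n: "p \<notin> F" "i \<notin> F" "j \<notin> F" "p \<noteq> i" "p \<noteq> j"
      using p assms by (auto simp: F_def)
    have jE: "insert j E - {p} = insert j F" using n by (auto simp: E)
    have rk: "{y \<in> E. i < y \<and> y < p} = {y \<in> F. i < y \<and> y < p}" by (auto simp: E)
    consider "j < i" "j < p" | "i < j" "j < p" | "i < j" "p < j"
      using p n assms(3) by (meson linorder_neqE less_trans)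
    then have j: "(if j < i then - Q i j else 1) * Q p j * inv_c j i = (if j < p then - Q p j else 1) * Q i j * inv_c j p"
      by cases (auto simp: inv_c_def)
    have z: "Cl F p \<noteq> 0" "inv_c j p \<noteq> 0" using n by (simp_all add: Cl_nz inv_c_nz)
    have "Gr j (insert i (insert j E - {p})) * exc (insert j E - {p}) p i * Cr p (insert i (E - {p}))
      = ((if j < i then - Q i j else 1) * Q p j * inv_c j i) * Gr j F * (1 - r) * (Qprod p F * Cl F i * Cr p F) * inv_c p i
          / (inv_c j p * Cl F p)"
      unfolding jE exc_def F_def[symmetric]
      using n assms(3) by (simp add: Gr_insert Qprod_insert Cl_insert Cr_insert)
    also have "\<dots> = ((if j < p then - Q p j else 1) * Q i j) * Gr j F * (1 - r)
         * (r ^ card {y \<in> F. i < y \<and> y < p} * (Qprod i F * Cr i F)) * inv_c p i"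
      unfolding j coeff_exchange[OF n(2,1) p(2)] using z by simp
    also have "inv_c p i = - Q i p" using p by (simp add: inv_c_def)
    also have "((if j < p then - Q p j else 1) * Q i j) * Gr j F * (1 - r)
         * (r ^ card {y \<in> F. i < y \<and> y < p} * (Qprod i F * Cr i F)) * - Q i p
       = - (1 - r) * r ^ card {y \<in> F. i < y \<and> y < p} *
         (((if j < p then - Q p j else 1) * Gr j F) * (Q i j * (Q i p * Qprod i F)) * (1 * Cr i F))"
      by (simp only: mult_ac mult_minus_left mult_minus_right mult_1_left)
    also have "1 * Cr i F = Cr i E" using n p less_not_sym[OF p(2)] by (simp add: E Cr_insert inv_c_def)
    also have "Q i j * (Q i p * Qprod i F) = Qprod i (insert j E)"
      using n assms by (simp add: E Qprod_insert)
    also have "(if j < p then - Q p j else 1) * Gr j F = Gr j (insert j E)"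
      using n assms by (simp add: E Gr_insert)
    finally show ?thesis by (simp only: rk)
  qed
  then have "(\<Sum>p\<in>{p\<in>E. i < p}. Gr j (insert i (insert j E - {p})) * exc (insert j E - {p}) p i * Cr p (insert i (E - {p})))
    = (\<Sum>p\<in>{p\<in>E. i < p}. - (1 - r) * r ^ card {y \<in> E. i < y \<and> y < p} * ?T)"
    by (intro sum.cong refl) simp
  also have "\<dots> = - (1 - r) * (\<Sum>p\<in>{p\<in>E. i < p}. r ^ card {y \<in> E. i < y \<and> y < p}) * ?T"
    by (simp only: sum_distrib_left sum_distrib_right)
  finally have "?T + (\<Sum>p\<in>{p\<in>E. i < p}. Gr j (insert i (insert j E - {p})) * exc (insert j E - {p}) p i * Cr p (insert i (E - {p})))
    = ?T - (1 - r) * (\<Sum>p\<in>{p\<in>E. i < p}. r ^ card {y \<in> E. i < y \<and> y < p}) * ?T"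
    by (simp only: mult_minus_left add_uminus_conv_diff)
  also have "\<dots> = r ^ card {p\<in>E. i < p} * ?T"
    unfolding sum_rank_between telescope by (simp add: algebra_simps)
  also have "\<dots> = (Gr j E * Q i j) * (Qprod i E * Cr i E * r ^ card {p\<in>E. i < p})"
    using assms by (simp add: Gr_insert Qprod_insert)
  also have "\<dots> = (Gr j E * Q i j) * ((- r) ^ card E * Cl E i)"
    by (simp only: coeff_first[OF assms(1)])
  also have "Q i j = - ((if j < i then - Q i j else 1) * inv_c j i)"
  proof -
    consider "j < i" | "i < j" using assms(3) by (meson linorder_neqE)
    then show ?thesis by cases (auto simp: inv_c_def)
  qed
  also have "(Gr j E * - ((if j < i then - Q i j else 1) * inv_c j i)) * ((- r) ^ card E * Cl E i)
     = - ((- r) ^ card E * (((if j < i then - Q i j else 1) * Gr j E) * (inv_c j i * Cl E i)))"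
    by (simp only: mult_ac mult_minus_left mult_minus_right)
  finally show ?thesis using assms by (simp add: Gr_insert Cl_insert insert_commute[of i j])
qed

text \<open>The same telescoping for \<open>i = j\<close>, where it leaves the two extreme terms.\<close>

lemma exchange_diag:
  assumes "i \<notin> K" "card K = Suc k"
  shows "(\<Sum>p\<in>{p\<in>K. i < p}. Gr i (insert i (K - {p})) * exc (K - {p}) p i * Cr p (K - {p}))
    = (- r) ^ k * (1 - Gr i (insert i K) * Cl K i)"
proof -
  have "Gr i (insert i (K - {p})) * exc (K - {p}) p i * Cr p (K - {p})
      = (- r) ^ k * ((1 - r) * r ^ card {y \<in> K. i < y \<and> y < p})" if p: "p \<in> K" "i < p" for p
  proof -
    have c: "card (K - {p}) = k" using p assms by simp
    have rk: "{y \<in> K - {p}. i < y \<and> y < p} = {y \<in> K. i < y \<and> y < p}" by auto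
    have z: "Cl (K - {p}) p \<noteq> 0" by (simp add: Cl_nz)
    have "Gr i (insert i (K - {p})) * exc (K - {p}) p i * Cr p (K - {p})
      = (1 - r) * (Gr i (K - {p}) * Qprod p (K - {p}) * Cl (K - {p}) i * Cr p (K - {p})) / Cl (K - {p}) p"
      using assms by (simp add: Gr_insert exc_def)
    also have "Gr i (K - {p}) * Qprod p (K - {p}) * Cl (K - {p}) i * Cr p (K - {p})
      = (- r) ^ k * r ^ card {y \<in> K. i < y \<and> y < p} * Cl (K - {p}) p"
      using coeff_exchange_diag[of i "K - {p}" p] assms p by (simp only: rk c) simp
    finally show ?thesis using z by simp
  qed
  then have "(\<Sum>p\<in>{p\<in>K. i < p}. Gr i (insert i (K - {p})) * exc (K - {p}) p i * Cr p (K - {p}))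
    = (- r) ^ k * ((1 - r) * (\<Sum>p\<in>{p\<in>K. i < p}. r ^ card {y \<in> K. i < y \<and> y < p}))"
    by (simp add: sum_distrib_left)
  then show ?thesis
    unfolding sum_rank_between telescope using assms
    by (simp add: Gr_insert coeff_diag_rank)
qed

end

section \<open>The recursion for the adjugate matrices\<close>

context quantum_pair begin

lemma alternating_Cons_sl:
  assumes "alternating scl f"
  shows "f (p # sl E) = sc (Cr p E) * f (sl (insert p E))"
  using alternating_sl[OF vs assms, of "p # sl E"] by (simp add: prod_list_set Cr_def)

text \<open>The recursion before contraction. The cases of \<open>tr_uv\<close> and the position of \<open>i\<close> and \<open>j\<close> relative to \<open>K'\<close>
  reduce it to the two identities above.\<close>

lemma main_coeff:
  assumes \<omega>: "alternating scl \<omega>" and card: "card K' = Suc k"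
  shows "(\<Sum>K\<in>{K. card K = Suc k \<and> j \<in> K}. \<Sum>p\<in>UNIV.
            sc (Gr j K * tr p (uv K) (sl K') i) * \<omega> (p # sl (K - {j})))
    = sc ((- r) ^ k) * ((if i = j then \<omega> (sl K') else 0)
        - (if i \<notin> K' \<and> j \<in> insert i K'
           then sc (Gr j (insert i K') * Cl K' i) * \<omega> (sl (insert i K' - {j})) else 0))"
    (is "?L = ?R")
proof (cases "i \<in> K'")
  case True
  have t: "tr p (uv K) (sl K') i = (if p = i then if K = K' then Qprod i (K' - {i}) else 0 else 0)" for p K
    unfolding tr_uv using True by auto
  have "?L = (\<Sum>K\<in>{K. card K = Suc k \<and> j \<in> K}.
      if K = K' then sc (Gr j K' * Qprod i (K' - {i})) * \<omega> (i # sl (K' - {j})) else 0)"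
    unfolding t by (intro sum.cong refl) (simp add: if_distrib[of "\<lambda>x. _ * x"] if_distrib[of sc] if_distrib[of "\<lambda>x. x * _"] cong: if_cong)
  also have "\<dots> = (if j \<in> K' then sc (Gr j K' * Qprod i (K' - {i})) * \<omega> (i # sl (K' - {j})) else 0)"
    using card by simp
  also have "\<dots> = ?R"
  proof (cases "j = i")
    case j: True
    define F where "F = K' - {i}"
    have F: "i \<notin> F" "K' = insert i F" "card F = k" using True card by (auto simp: F_def)
    have "Gr i K' * Qprod i F * Cr i F = (- r) ^ k"
      using coeff_diag[OF F(1)] F by (simp add: Gr_insert)
    then show ?thesis
      using j True by (simp add: alternating_Cons_sl[OF \<omega>] F_def[symmetric] insert_absorb
        mult.assoc[symmetric] sc_mult[symmetric]) (simp add: F(2))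
  next
    case False
    have "Cr i (K' - {j}) = 0" using True False by (auto simp: Cr_def inv_c_def)
    then show ?thesis using True False by (simp add: alternating_Cons_sl[OF \<omega>])
  qed
  finally show ?thesis .
next
  case False
  have t: "tr p (uv K) (sl K') i = (if p = i then if K = K' then Qprod i K' else 0 else 0)
     + (if p \<in> K' \<and> i < p then if K = insert i (K' - {p}) then exc (K' - {p}) p i else 0 else 0)" for p K
    unfolding tr_uv exc_def using False by auto
  let ?S = "{K. card K = Suc k \<and> j \<in> K}"
  have c: "card (insert i (K' - {p})) = Suc k" if "p \<in> K'" for p
    using that False card by (simp add: card_Suc_Diff1)
  have "?L = (\<Sum>p\<in>UNIV. \<Sum>K\<in>?S. sc (Gr j K * tr p (uv K) (sl K') i) * \<omega> (p # sl (K - {j})))"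
    by (rule sum.swap)
  also have "\<dots> = (\<Sum>p\<in>UNIV. (if p = i then (\<Sum>K\<in>?S. if K = K' then sc (Gr j K' * Qprod i K') * \<omega> (i # sl (K' - {j})) else 0) else 0)
      + (if p \<in> K' \<and> i < p then (\<Sum>K\<in>?S. if K = insert i (K' - {p}) then
          sc (Gr j (insert i (K' - {p})) * exc (K' - {p}) p i) * \<omega> (p # sl (insert i (K' - {p}) - {j})) else 0) else 0))"
  proof (rule sum.cong[OF refl])
    fix p
    have pick: "sc (Gr j K * (if K = C then c else 0)) * \<omega> (x # sl (K - {j}))
        = (if K = C then sc (Gr j C * c) * \<omega> (x # sl (C - {j})) else 0)" for K C c x
      by simp
    consider "p = i" "\<not> (p \<in> K' \<and> i < p)" | "p \<noteq> i" "p \<in> K' \<and> i < p" | "p \<noteq> i" "\<not> (p \<in> K' \<and> i < p)"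
      using False by blast
    then show "(\<Sum>K\<in>?S. sc (Gr j K * tr p (uv K) (sl K') i) * \<omega> (p # sl (K - {j})))
      = (if p = i then (\<Sum>K\<in>?S. if K = K' then sc (Gr j K' * Qprod i K') * \<omega> (i # sl (K' - {j})) else 0) else 0)
      + (if p \<in> K' \<and> i < p then (\<Sum>K\<in>?S. if K = insert i (K' - {p}) then
          sc (Gr j (insert i (K' - {p})) * exc (K' - {p}) p i) * \<omega> (p # sl (insert i (K' - {p}) - {j})) else 0) else 0)"
    proof cases
      case 1
      then show ?thesis unfolding t by (simp only: simp_thms less_irrefl if_True if_False add_0_right pick)
    next
      case 2
      then show ?thesis unfolding t by (simp only: simp_thms if_True if_False add_0_left pick)
    next
      case 3
      then show ?thesis unfolding t by (simp only: if_not_P[OF 3(2)] if_False add_0_left) simp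
    qed
  qed
  also have "\<dots> = (if j \<in> K' then sc (Gr j K' * Qprod i K') * \<omega> (i # sl (K' - {j})) else 0)
      + (\<Sum>p\<in>{p\<in>K'. i < p}. if j \<in> insert i (K' - {p}) then
          sc (Gr j (insert i (K' - {p})) * exc (K' - {p}) p i) * \<omega> (p # sl (insert i (K' - {p}) - {j})) else 0)"
    using card by (simp add: sum.distrib sum.If_cases Int_def c cong: conj_cong)
  also have "\<dots> = ?R"
  proof (cases "j = i")
    case j: True
    have "insert i (K' - {p}) - {i} = K' - {p}" for p using False by auto
    then have "(\<Sum>p\<in>{p\<in>K'. i < p}. if j \<in> insert i (K' - {p}) then
          sc (Gr j (insert i (K' - {p})) * exc (K' - {p}) p i) * \<omega> (p # sl (insert i (K' - {p}) - {j})) else 0)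
      = (\<Sum>p\<in>{p\<in>K'. i < p}. sc (Gr i (insert i (K' - {p})) * exc (K' - {p}) p i * Cr p (K' - {p})) * \<omega> (sl K'))"
      using j by (intro sum.cong refl)
        (simp add: alternating_Cons_sl[OF \<omega>] insert_absorb sc_mult mult.assoc)
    also have "\<dots> = sc ((- r) ^ k * (1 - Gr i (insert i K') * Cl K' i)) * \<omega> (sl K')"
      unfolding sum_distrib_right[symmetric] sc_sum[symmetric] exchange_diag[OF False card] ..
    finally show ?thesis using False j
      by (simp add: sc_mult[of "(-r)^k"] sc_diff left_diff_distrib right_diff_distrib mult.assoc)
  next
    case ij: False
    show ?thesis
    proof (cases "j \<in> K'")
      case j: True
      define E where "E = K' - {j}"
      have E: "i \<notin> E" "j \<notin> E" "i \<noteq> j" "K' = insert j E" "card E = k"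
        using j False card ij by (auto simp: E_def)
      have w: "insert i K' - {j} = insert i E" using E by auto
      have "(\<Sum>p\<in>{p\<in>K'. i < p}. if j \<in> insert i (K' - {p}) then
          sc (Gr j (insert i (K' - {p})) * exc (K' - {p}) p i) * \<omega> (p # sl (insert i (K' - {p}) - {j})) else 0)
        = (\<Sum>p\<in>{p\<in>E. i < p}.
          sc (Gr j (insert i (K' - {p})) * exc (K' - {p}) p i) * \<omega> (p # sl (insert i (K' - {p}) - {j})))"
        by (rule sum.mono_neutral_cong_right) (use E in auto)
      also have "\<dots> = (\<Sum>p\<in>{p\<in>E. i < p}. sc (Gr j (insert i (insert j E - {p})) * exc (insert j E - {p}) p i
            * Cr p (insert i (E - {p}))) * \<omega> (sl (insert i E)))"
      proof (intro sum.cong refl)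
        fix p assume p: "p \<in> {p\<in>E. i < p}"
        then have "insert i (K' - {p}) - {j} = insert i (E - {p})" "insert p (insert i (E - {p})) = insert i E"
          using E by auto
        then show "sc (Gr j (insert i (K' - {p})) * exc (K' - {p}) p i) * \<omega> (p # sl (insert i (K' - {p}) - {j}))
          = sc (Gr j (insert i (insert j E - {p})) * exc (insert j E - {p}) p i
            * Cr p (insert i (E - {p}))) * \<omega> (sl (insert i E))"
          by (simp only: alternating_Cons_sl[OF \<omega>] sc_mult mult.assoc E(4)[symmetric])
      qed
      also have "\<dots> = sc (\<Sum>p\<in>{p\<in>E. i < p}. Gr j (insert i (insert j E - {p})) * exc (insert j E - {p}) p i
            * Cr p (insert i (E - {p}))) * \<omega> (sl (insert i E))"
        by (simp only: sc_sum sum_distrib_right)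
      finally have sm: "(\<Sum>p\<in>{p\<in>K'. i < p}. if j \<in> insert i (K' - {p}) then
          sc (Gr j (insert i (K' - {p})) * exc (K' - {p}) p i) * \<omega> (p # sl (insert i (K' - {p}) - {j})) else 0)
        = sc (\<Sum>p\<in>{p\<in>E. i < p}. Gr j (insert i (insert j E - {p})) * exc (insert j E - {p}) p i
            * Cr p (insert i (E - {p}))) * \<omega> (sl (insert i E))" .
      have "sc (Gr j K' * Qprod i K') * \<omega> (i # sl (K' - {j}))
        = sc (Gr j (insert j E) * Qprod i (insert j E) * Cr i E) * \<omega> (sl (insert i E))"
        by (simp only: alternating_Cons_sl[OF \<omega>] sc_mult mult.assoc E(4)[symmetric] E_def[symmetric])
      then have "(if j \<in> K' then sc (Gr j K' * Qprod i K') * \<omega> (i # sl (K' - {j})) else 0)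
        + (\<Sum>p\<in>{p\<in>K'. i < p}. if j \<in> insert i (K' - {p}) then
          sc (Gr j (insert i (K' - {p})) * exc (K' - {p}) p i) * \<omega> (p # sl (insert i (K' - {p}) - {j})) else 0)
        = sc (- ((- r) ^ card E * (Gr j (insert i (insert j E)) * Cl (insert j E) i))) * \<omega> (sl (insert i E))"
        unfolding sm exchange_offdiag[OF E(1-3), symmetric] using j by (simp add: sc_add distrib_right)
      then show ?thesis using j False ij
        by (simp add: w E(5) E(4)[symmetric] sc_minus) (simp add: sc_mult mult.assoc)
    next
      case False
      then show ?thesis using ij by simp
    qed
  qed
  finally show ?thesis .
qed

lemma Yop_zero_fun: "Yop (\<lambda>b. 0) = (\<lambda>w. 0)"
  by (rule ext) simp

lemma Yop_scale_fun: "Yop (\<lambda>b. sc c * f b) = (\<lambda>w. sc c * Yop f w)"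
  by (rule ext) (rule Yop_scale)

lemma Yop_sum_fun: "Yop (\<lambda>b. \<Sum>x\<in>A. f x b) = (\<lambda>w. \<Sum>x\<in>A. Yop (f x) w)"
  by (rule ext) (rule Yop_sum)

definition yy :: "'n set \<Rightarrow> 'n list \<Rightarrow> 'o" where
  "yy K = Yop (\<lambda>b. sc (uv K b))"

lemma yy_alternating: "alternating scl (yy K)"
  unfolding yy_def by (intro Yop_alternating alternating_sc uv_alternating)

lemma yy_card: "length w \<noteq> card K \<Longrightarrow> yy K w = 0"
proof -
  assume "length w \<noteq> card K"
  then have "yy K w = Yop (\<lambda>b. 0) w"
    unfolding yy_def by (intro Yop_cong_len) (simp add: uv_card)
  then show ?thesis by simp
qed

lemma Xcon_yy_card: "length w \<noteq> card K \<Longrightarrow> Xcon (yy K) w = 0"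
proof -
  assume "length w \<noteq> card K"
  then have "Xcon (yy K) w = Xcon (\<lambda>b. 0) w"
    by (intro Xcon_cong_len) (simp add: yy_card)
  then show ?thesis by simp
qed

definition Zm :: "'n \<Rightarrow> 'n \<Rightarrow> 'o" where "Zm i l = (\<Sum>m\<in>UNIV. X i m * Y m l)"

text \<open>The coefficient matrices of the numerator, in the shape in which the recursion is proved: one leg
  of \<open>u\<^sub>K\<close> stays open and carries the letter \<open>i\<close>.\<close>

definition Am :: "nat \<Rightarrow> 'n \<Rightarrow> 'n \<Rightarrow> 'o" where
  "Am k i j = (\<Sum>K\<in>{K. card K = k \<and> j \<in> K}. sc (Gr j K) *
     Xcon (Yop (\<lambda>b. sc (uv K (b @ [i])))) (sl (K - {j})))"

text \<open>The sum of the quantum principal minors of \<open>XY\<close>: all legs of all \<open>u\<^sub>K\<close> with \<open>card K = k\<close> are closed.\<close>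

definition sm :: "nat \<Rightarrow> 'o" where
  "sm k = (\<Sum>K\<in>{K. card K = k}. Xcon (yy K) (sl K))"

lemma Xcon_tr:
  assumes "alternating (*) g"
  shows "Xcon (Yop (\<lambda>b. sc (tr p g b i))) w = (\<Sum>K\<in>UNIV. sc (tr p g (sl K) i) * Xcon (yy K) w)"
proof -
  have "(\<lambda>b. sc (tr p g b i)) = (\<lambda>b. \<Sum>K\<in>UNIV. sc (tr p g (sl K) i) * sc (uv K b))"
  proof (rule ext)
    fix b
    show "sc (tr p g b i) = (\<Sum>K\<in>UNIV. sc (tr p g (sl K) i) * sc (uv K b))"
      unfolding sc_sum[symmetric] sc_mult[symmetric] uv_expand[OF tr_alternating[OF assms, of p i], of b, symmetric] ..
  qed
  then show ?thesis
    by (simp only: Yop_sum_fun Yop_scale_fun Xcon_sum Xcon_left yy_def)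
qed

text \<open>The open leg is split off by \<open>uv_snoc\<close>, so only sets containing both \<open>i\<close> and \<open>j\<close> contribute.\<close>

lemma Am_alt:
  "Am k i j = (\<Sum>K\<in>{K. card K = k \<and> i \<in> K \<and> j \<in> K}.
     sc (Gr j K * Cl (K - {i}) i) * Xcon (yy (K - {i})) (sl (K - {j})))"
proof -
  have "Am k i j = (\<Sum>K\<in>{K. card K = k \<and> j \<in> K}. if i \<in> K then 
     sc (Gr j K * Cl (K - {i}) i) * Xcon (yy (K - {i})) (sl (K - {j})) else 0)"
    unfolding Am_def
    by (intro sum.cong refl) (simp add: uv_snoc yy_def Yop_scale_fun Yop_zero_fun Xcon_left sc_mult mult.assoc)
  also have "\<dots> = (\<Sum>K\<in>{K. card K = k \<and> i \<in> K \<and> j \<in> K}.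
     sc (Gr j K * Cl (K - {i}) i) * Xcon (yy (K - {i})) (sl (K - {j})))"
    by (rule sum.mono_neutral_cong_right) auto
  finally show ?thesis .
qed

lemma Z_Am:
  "(\<Sum>l\<in>UNIV. Zm i l * Am k l j) = (\<Sum>K\<in>{K. card K = k \<and> j \<in> K}. sc (Gr j K) *
     Xcon (\<lambda>v. \<Sum>m\<in>UNIV. X i m * yy K (v @ [m])) (sl (K - {j})))"
proof -
  have aux: "(\<Sum>l\<in>UNIV. Zm i l * Yop (\<lambda>b. sc (uv K (b @ [l]))) v) = (\<Sum>m\<in>UNIV. X i m * yy K (v @ [m]))" for K v
  proof -
    have "(\<Sum>l\<in>UNIV. Zm i l * Yop (\<lambda>b. sc (uv K (b @ [l]))) v)
      = (\<Sum>l\<in>UNIV. \<Sum>m\<in>UNIV. X i m * (Y m l * Yop (\<lambda>b. sc (uv K (b @ [l]))) v))"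
      by (simp add: Zm_def sum_distrib_right mult.assoc)
    also have "\<dots> = (\<Sum>m\<in>UNIV. \<Sum>l\<in>UNIV. X i m * (Y m l * Yop (\<lambda>b. sc (uv K (b @ [l]))) v))"
      by (rule sum.swap)
    finally show ?thesis by (simp add: yy_def Yop_snoc sum_distrib_left)
  qed
  have "(\<Sum>l\<in>UNIV. Zm i l * Am k l j) = (\<Sum>K\<in>{K. card K = k \<and> j \<in> K}. \<Sum>l\<in>UNIV. sc (Gr j K) *
     Xcon (\<lambda>v. Zm i l * Yop (\<lambda>b. sc (uv K (b @ [l]))) v) (sl (K - {j})))"
    unfolding Am_def sum_distrib_left
    by (subst sum.swap) (simp add: Xcon_left sc_left[of "Zm _ _"])
  also have "\<dots> = (\<Sum>K\<in>{K. card K = k \<and> j \<in> K}. sc (Gr j K) *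
     Xcon (\<lambda>v. \<Sum>l\<in>UNIV. Zm i l * Yop (\<lambda>b. sc (uv K (b @ [l]))) v) (sl (K - {j})))"
    by (simp add: sum_distrib_left Xcon_sum)
  also have "\<dots> = (\<Sum>K\<in>{K. card K = k \<and> j \<in> K}. sc (Gr j K) *
     Xcon (\<lambda>v. \<Sum>m\<in>UNIV. X i m * yy K (v @ [m])) (sl (K - {j})))"
    by (simp only: aux)
  finally show ?thesis .
qed

text \<open>Move the \<open>X\<close> of \<open>Z = XY\<close> through the \<open>Y\<close>s by \<open>move_X_contract\<close>, expand the transported tensor in the
  basis \<open>u\<^sub>K\<close>, and apply \<open>main_coeff\<close> to the closed function \<open>Xcon (yy K)\<close>.\<close>

lemma main_identity:
  "(\<Sum>l\<in>UNIV. Zm i l * Am (Suc k) l j) + Am (Suc (Suc k)) i j = (if i = j then sm (Suc k) else 0)"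
proof -
  let ?S = "{K :: 'n set. card K = Suc k \<and> j \<in> K}" and ?T = "{K' :: 'n set. card K' = Suc k}"
  have r: "- r \<noteq> 0" by simp
  have len: "length (sl (K - {j})) = k" if "K \<in> ?S" for K
    using that by simp
  have "sc ((- r) ^ k) * (\<Sum>l\<in>UNIV. Zm i l * Am (Suc k) l j)
    = (\<Sum>K\<in>?S. sc (Gr j K) * (sc ((- r) ^ (length (sl (K - {j})) + length ([] :: 'n list))) *
     Xcon (\<lambda>v. \<Sum>m\<in>UNIV. X i m * Yop (\<lambda>b. sc (uv K b)) (v @ [] @ [m])) (sl (K - {j}))))"
    unfolding Z_Am sum_distrib_left
    by (intro sum.cong refl) (simp add: len yy_def scl_comm[of "(- r) ^ k"])
  also have "\<dots> = (\<Sum>K\<in>?S. sc (Gr j K) * (\<Sum>p\<in>UNIV. Xcon (Yop (\<lambda>b. sc (tr p (uv K) b i))) (p # sl (K - {j}))))"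
    unfolding move_X_contract[OF uv_alternating] by simp
  also have "\<dots> = (\<Sum>K\<in>?S. \<Sum>p\<in>UNIV. \<Sum>K'\<in>UNIV. sc (Gr j K * tr p (uv K) (sl K') i) * Xcon (yy K') (p # sl (K - {j})))"
    by (simp only: Xcon_tr[OF uv_alternating] sum_distrib_left sc_mult mult.assoc)
  also have "\<dots> = (\<Sum>K\<in>?S. \<Sum>p\<in>UNIV. \<Sum>K'\<in>?T. sc (Gr j K * tr p (uv K) (sl K') i) * Xcon (yy K') (p # sl (K - {j})))"
  proof (rule sum.cong[OF refl], rule sum.cong[OF refl])
    fix K p assume "K \<in> ?S"
    then show "(\<Sum>K'\<in>UNIV. sc (Gr j K * tr p (uv K) (sl K') i) * Xcon (yy K') (p # sl (K - {j})))
      = (\<Sum>K'\<in>?T. sc (Gr j K * tr p (uv K) (sl K') i) * Xcon (yy K') (p # sl (K - {j})))"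
      by (intro sum.mono_neutral_right ballI) (auto simp: Xcon_yy_card simp del: Xcon_Cons)
  qed
  also have "\<dots> = (\<Sum>K'\<in>?T. \<Sum>K\<in>?S. \<Sum>p\<in>UNIV. sc (Gr j K * tr p (uv K) (sl K') i) * Xcon (yy K') (p # sl (K - {j})))"
    by (subst (2) sum.swap, subst sum.swap) (rule refl)
  also have "\<dots> = (\<Sum>K'\<in>?T. sc ((- r) ^ k) * ((if i = j then Xcon (yy K') (sl K') else 0)
        - (if i \<notin> K' \<and> j \<in> insert i K'
           then sc (Gr j (insert i K') * Cl K' i) * Xcon (yy K') (sl (insert i K' - {j})) else 0)))"
    by (intro sum.cong refl main_coeff Xcon_alternating yy_alternating) simp
  also have "\<dots> = sc ((- r) ^ k) * ((if i = j then sm (Suc k) else 0)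
     - (\<Sum>K'\<in>?T. if i \<notin> K' \<and> j \<in> insert i K'
           then sc (Gr j (insert i K') * Cl K' i) * Xcon (yy K') (sl (insert i K' - {j})) else 0))"
    unfolding sum_distrib_left[symmetric] sum_subtractf by (simp add: sm_def)
  also have "(\<Sum>K'\<in>?T. if i \<notin> K' \<and> j \<in> insert i K'
           then sc (Gr j (insert i K') * Cl K' i) * Xcon (yy K') (sl (insert i K' - {j})) else 0)
     = (\<Sum>K'\<in>{K'. card K' = Suc k \<and> i \<notin> K' \<and> j \<in> insert i K'}.
          sc (Gr j (insert i K') * Cl K' i) * Xcon (yy K') (sl (insert i K' - {j})))"
    by (rule sum.mono_neutral_cong_right) auto
  also have "\<dots> = Am (Suc (Suc k)) i j"
    unfolding Am_alt
  proof (rule sum.reindex_bij_witness[where i = "\<lambda>K. K - {i}" and j = "insert i"])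
    fix K' assume "K' \<in> {K'. card K' = Suc k \<and> i \<notin> K' \<and> j \<in> insert i K'}"
    then show "insert i K' - {i} = K'" "insert i K' \<in> {K. card K = Suc (Suc k) \<and> i \<in> K \<and> j \<in> K}"
      "sc (Gr j (insert i K') * Cl (insert i K' - {i}) i) * Xcon (yy (insert i K' - {i})) (sl (insert i K' - {j}))
       = sc (Gr j (insert i K') * Cl K' i) * Xcon (yy K') (sl (insert i K' - {j}))"
      by simp_all
  next
    fix K assume "K \<in> {K. card K = Suc (Suc k) \<and> i \<in> K \<and> j \<in> K}"
    then show "insert i (K - {i}) = K" "K - {i} \<in> {K'. card K' = Suc k \<and> i \<notin> K' \<and> j \<in> insert i K'}"
      by auto
  qed
  finally have "sc ((- r) ^ k) * (\<Sum>l\<in>UNIV. Zm i l * Am (Suc k) l j)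
     = sc ((- r) ^ k) * ((if i = j then sm (Suc k) else 0) - Am (Suc (Suc k)) i j)" .
  then have "sc (1 / (- r) ^ k) * (sc ((- r) ^ k) * (\<Sum>l\<in>UNIV. Zm i l * Am (Suc k) l j))
     = sc (1 / (- r) ^ k) * (sc ((- r) ^ k) * ((if i = j then sm (Suc k) else 0) - Am (Suc (Suc k)) i j))"
    by (rule arg_cong)
  then have "(\<Sum>l\<in>UNIV. Zm i l * Am (Suc k) l j) = (if i = j then sm (Suc k) else 0) - Am (Suc (Suc k)) i j"
    unfolding mult.assoc[symmetric] sc_mult[symmetric] using r by simp
  then show ?thesis by simp
qed

lemma Am_0: "Am 0 i j = 0"
proof -
  have "{K :: 'n set. card K = 0 \<and> j \<in> K} = {}" by auto
  then show ?thesis by (simp only: Am_def sum.empty)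
qed

lemma sm_0: "sm 0 = 1"
proof -
  have "{K :: 'n set. card K = 0} = {{}}" by auto
  then show ?thesis by (simp add: sm_def yy_def uv_def)
qed

lemma Am_1: "Am (Suc 0) i j = (if i = j then 1 else 0)"
proof -
  have "{K :: 'n set. card K = Suc 0 \<and> j \<in> K} = {{j}}" by (auto simp: card_Suc_eq)
  then show ?thesis by (auto simp: Am_def uv_def Gr_def)
qed

lemma main_identity_all:
  "(\<Sum>l\<in>UNIV. Zm i l * Am k l j) + Am (Suc k) i j = (if i = j then sm k else 0)"
  by (cases k) (simp_all add: main_identity Am_0 Am_1 sm_0)

end

section \<open>The quantum trace and centrality\<close>

context qparam begin

text \<open>The weights of the quantum trace that commutes with the generators. They run in the direction opposite to \<open>wt\<close>.\<close>

definition dw :: "'n \<Rightarrow> 'f" where "dw i = r ^ card {k. k < i}"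

lemma dw_interval:
  assumes "a < l"
  shows "dw l + (1 - r) * (\<Sum>b\<in>{b. a < b \<and> b < l}. dw b) = r * dw a"
proof -
  have d: "dw b = r * dw a * r ^ card {k \<in> {b. a < b \<and> b < l}. k < b}" if "a < b" "b \<le> l" for b
  proof -
    have "{k. k < b} = insert a ({k. k < a} \<union> {k \<in> {b. a < b \<and> b < l}. k < b})"
      using that by auto
    moreover have "card (insert a ({k. k < a} \<union> {k \<in> {b. a < b \<and> b < l}. k < b}))
        = Suc (card ({k. k < a} \<union> {k \<in> {b. a < b \<and> b < l}. k < b}))"
      by (rule card_insert_disjoint) auto
    moreover have "card ({k. k < a} \<union> {k \<in> {b. a < b \<and> b < l}. k < b})
        = card {k. k < a} + card {k \<in> {b. a < b \<and> b < l}. k < b}"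
      by (rule card_Un_disjoint) auto
    ultimately show ?thesis by (simp add: dw_def power_add)
  qed
  have "{k \<in> {b. a < b \<and> b < l}. k < l} = {b. a < b \<and> b < l}" by auto
  then have top: "dw l = r * dw a * r ^ card {b. a < b \<and> b < l}" using d[of l] assms by simp
  have between: "(\<Sum>b\<in>{b. a < b \<and> b < l}. dw b) = r * dw a * (\<Sum>k<card {b. a < b \<and> b < l}. r ^ k)"
  proof -
    have "(\<Sum>b\<in>{b. a < b \<and> b < l}. dw b)
      = (\<Sum>b\<in>{b. a < b \<and> b < l}. r * dw a * r ^ card {k \<in> {b. a < b \<and> b < l}. k < b})"
      by (intro sum.cong refl d) auto
    then show ?thesis by (simp only: sum_distrib_left[symmetric] sum_rank_below[OF finite])
  qed
  have "(1 - r) * (r * dw a * (\<Sum>k<n. r ^ k)) = r * dw a * ((1 - r) * (\<Sum>k<n. r ^ k))" for n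
    by (simp only: mult.left_commute)
  then show ?thesis unfolding top between telescope by (simp add: right_diff_distrib)
qed

lemma rank_split:
  assumes "i \<notin> S"
  shows "dw i * r ^ card {y \<in> S. i < y} = r ^ card S * r ^ card {k \<in> - S. k < i}"
proof -
  have 1: "card {k. k < i} = card {k \<in> - S. k < i} + card {k \<in> S. k < i}"
    by (subst card_Un_disjoint[symmetric]) (auto intro!: arg_cong[of _ _ card])
  have 2: "card S = card {k \<in> S. k < i} + card {k \<in> S. i < k}"
  proof (subst card_Un_disjoint[symmetric])
    show "card S = card ({k \<in> S. k < i} \<union> {k \<in> S. i < k})"
      using assms by (intro arg_cong[of _ _ card]) (auto dest: not_less_iff_gr_or_eq[THEN iffD1])
  qed auto
  show ?thesis unfolding dw_def 1 by (subst 2) (simp add: power_add)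
qed

lemma sum_rank_split:
  "(\<Sum>i\<in>- S. dw i * r ^ card {y \<in> S. i < y}) = r ^ card S * (\<Sum>k<CARD('n) - card S. r ^ k)"
proof -
  have "(\<Sum>i\<in>- S. dw i * r ^ card {y \<in> S. i < y}) = (\<Sum>i\<in>- S. r ^ card S * r ^ card {k \<in> - S. k < i})"
    by (intro sum.cong refl rank_split) simp
  then show ?thesis
    by (simp only: sum_distrib_left[symmetric] sum_rank_below[OF finite] Compl_eq_Diff_UNIV card_Diff_subset[OF finite subset_UNIV])
qed

lemma sum_dw: "(\<Sum>i\<in>UNIV. dw i) = (\<Sum>k<CARD('n). r ^ k)"
  using sum_rank_split[of "{}"] by simp

lemma qnum_split:
  assumes "k \<le> n"
  shows "(\<Sum>i<n. r ^ i) - r ^ k * (\<Sum>i<n - k. r ^ i) = (\<Sum>i<k. r ^ i)"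
proof -
  have "(\<Sum>i<k + m. r ^ i) = (\<Sum>i<k. r ^ i) + r ^ k * (\<Sum>i<m. r ^ i)" for m
    by (induction m) (simp_all add: power_add distrib_left)
  from this[of "n - k"] show ?thesis using assms by simp
qed

end

context quantum_pair begin

definition mm :: "('n \<Rightarrow> 'n \<Rightarrow> 'o) \<Rightarrow> ('n \<Rightarrow> 'n \<Rightarrow> 'o) \<Rightarrow> 'n \<Rightarrow> 'n \<Rightarrow> 'o" where
  "mm A B i j = (\<Sum>l\<in>UNIV. A i l * B l j)"

text \<open>The relation of \<open>Z = XY\<close> with \<open>X\<close>, and in \<open>exY\<close> that with \<open>Y\<close>, as a property of a matrix. It is linear and
  stable under products, so that it passes to polynomials in \<open>Z\<close>.\<close>

definition exX :: "('n \<Rightarrow> 'n \<Rightarrow> 'o) \<Rightarrow> bool" where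
  "exX M \<longleftrightarrow> (\<forall>a b c d.
     sc (Q a b) * (X a c * M b d) + (if a < b then sc (1 - r) * (X b c * M a d) else 0)
   = sc (Q a d) * (M b d * X a c) + (if a = d then sc (1 - r) * (\<Sum>l\<in>{l. a < l}. M b l * X l c) else 0))"

definition exY :: "('n \<Rightarrow> 'n \<Rightarrow> 'o) \<Rightarrow> bool" where
  "exY M \<longleftrightarrow> (\<forall>a b c d.
     sc (Q c d) * (M a c * Y b d) + (if d < c then sc (1 - r) * (M a d * Y b c) else 0)
   = sc (Q a d) * (Y b d * M a c) + (if a = d then sc (1 - r) * (\<Sum>l\<in>{l. a < l}. Y b l * M l c) else 0))"

lemma sum_if_eq_left: "(\<Sum>m\<in>UNIV. f m * (if m = c then z else 0)) = (f c * z :: 'o)" for c :: 'n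
  by (simp add: if_distrib[of "\<lambda>x. _ * x"] cong: if_cong)

lemma exX_Zm: "exX Zm"
  unfolding exX_def
proof (intro allI)
  fix a b c d
  have "sc (Q a b) * (X a c * Zm b d) + (if a < b then sc (1 - r) * (X b c * Zm a d) else 0)
    = (\<Sum>m\<in>UNIV. (sc (Q a b) * (X a c * X b m) + (if a < b then sc (1 - r) * (X b c * X a m) else 0)) * Y m d)"
    by (simp add: Zm_def sum_distrib_left sum.distrib distrib_right mult.assoc)
  also have "\<dots> = (\<Sum>m\<in>UNIV. (sc (Q c m) * (X b m * X a c) + (if m < c then sc (1 - r) * (X b c * X a m) else 0)) * Y m d)"
    by (rule sum.cong[OF refl]) (subst XX, rule refl)
  also have "\<dots> = (\<Sum>m\<in>UNIV. X b m * (sc (Q c m) * (X a c * Y m d)))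
      + (\<Sum>m\<in>{m. m < c}. X b c * (sc (1 - r) * (X a m * Y m d)))"
    by (simp add: distrib_right sum.distrib mult.assoc sc_left[of "X _ _"] if_distrib[of "\<lambda>x. x * _"] sum.If_cases cong: if_cong)
  also have "(\<Sum>m\<in>{m. m < c}. X b c * (sc (1 - r) * (X a m * Y m d)))
      = (\<Sum>m\<in>UNIV. X b m * (if m = c then sc (1 - r) * (\<Sum>l\<in>{l. l < c}. X a l * Y l d) else 0))"
    by (simp only: sum_if_eq_left) (simp add: sum_distrib_left)
  also have "(\<Sum>m\<in>UNIV. X b m * (sc (Q c m) * (X a c * Y m d))) + \<dots>
     = (\<Sum>m\<in>UNIV. X b m * (sc (Q c m) * (X a c * Y m d) + (if m = c then sc (1 - r) * (\<Sum>l\<in>{l. l < m}. X a l * Y l d) else 0)))"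
    by (simp add: distrib_left sum.distrib cong: if_cong)
  also have "\<dots> = (\<Sum>m\<in>UNIV. X b m * (sc (Q a d) * (Y m d * X a c) + (if a = d then sc (1 - r) * (\<Sum>k\<in>{k. a < k}. Y m k * X k c) else 0)))"
    by (simp only: XY)
  also have "\<dots> = sc (Q a d) * (Zm b d * X a c) + (if a = d then sc (1 - r) * (\<Sum>l\<in>{l. a < l}. Zm b l * X l c) else 0)"
  proof -
    define S where "S m = (\<Sum>k\<in>{k. a < k}. Y m k * X k c)" for m
    have eq: "(\<Sum>l\<in>{l. a < l}. Zm b l * X l c) = (\<Sum>m\<in>UNIV. X b m * S m)"
      unfolding Zm_def S_def sum_distrib_left sum_distrib_right by (subst sum.swap) (simp add: mult.assoc)
    show ?thesis unfolding eq S_def[symmetric]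
      by (simp add: Zm_def sum_distrib_left sum_distrib_right distrib_left sum.distrib mult.assoc sc_left[of "X _ _"])
  qed
  finally show "sc (Q a b) * (X a c * Zm b d) + (if a < b then sc (1 - r) * (X b c * Zm a d) else 0)
    = sc (Q a d) * (Zm b d * X a c) + (if a = d then sc (1 - r) * (\<Sum>l\<in>{l. a < l}. Zm b l * X l c) else 0)" .
qed

lemma exY_Zm: "exY Zm"
  unfolding exY_def
proof (intro allI)
  fix a b c d
  have "sc (Q a d) * (Y b d * Zm a c) + (if a = d then sc (1 - r) * (\<Sum>l\<in>{l. a < l}. Y b l * Zm l c) else 0)
    = (\<Sum>m\<in>UNIV. (sc (Q a d) * (Y b d * X a m) + (if a = d then sc (1 - r) * (\<Sum>k\<in>{k. a < k}. Y b k * X k m) else 0)) * Y m c)"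
  proof -
    define S where "S m = (\<Sum>k\<in>{k. a < k}. Y b k * X k m)" for m
    have eq: "(\<Sum>l\<in>{l. a < l}. Y b l * Zm l c) = (\<Sum>m\<in>UNIV. S m * Y m c)"
      unfolding Zm_def S_def sum_distrib_left sum_distrib_right by (subst sum.swap) (simp add: mult.assoc)
    show ?thesis unfolding eq S_def[symmetric]
      by (simp add: Zm_def sum_distrib_left distrib_right sum.distrib mult.assoc)
  qed
  also have "\<dots> = (\<Sum>m\<in>UNIV. (sc (Q m b) * (X a m * Y b d) + (if b = m then sc (1 - r) * (\<Sum>l\<in>{l. l < b}. X a l * Y l d) else 0)) * Y m c)"
    by (simp only: XY)
  also have "\<dots> = (\<Sum>m\<in>UNIV. sc (Q m b) * (X a m * (Y b d * Y m c))) + (\<Sum>m\<in>{m. m < b}. sc (1 - r) * (X a m * (Y m d * Y b c)))"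
    by (simp add: distrib_right sum.distrib mult.assoc if_distrib[of "\<lambda>x. x * _"] sum_distrib_left sum_distrib_right cong: if_cong)
  also have "\<dots> = (\<Sum>m\<in>UNIV. X a m * (sc (Q m b) * (Y b d * Y m c) + (if m < b then sc (1 - r) * (Y m d * Y b c) else 0)))"
    by (simp add: distrib_left sum.distrib sc_left[of "X _ _"] if_distrib[of "\<lambda>x. _ * x"] sum.If_cases cong: if_cong)
  also have "\<dots> = (\<Sum>m\<in>UNIV. X a m * (sc (Q c d) * (Y m c * Y b d) + (if d < c then sc (1 - r) * (Y m d * Y b c) else 0)))"
    by (rule sum.cong[OF refl]) (subst YY, rule refl)
  also have "\<dots> = sc (Q c d) * (Zm a c * Y b d) + (if d < c then sc (1 - r) * (Zm a d * Y b c) else 0)"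
    by (simp add: Zm_def sum_distrib_left sum_distrib_right distrib_left sum.distrib mult.assoc sc_left[of "X _ _"])
  finally show "sc (Q c d) * (Zm a c * Y b d) + (if d < c then sc (1 - r) * (Zm a d * Y b c) else 0)
    = sc (Q a d) * (Y b d * Zm a c) + (if a = d then sc (1 - r) * (\<Sum>l\<in>{l. a < l}. Y b l * Zm l c) else 0)" ..
qed

lemma exX_mm:
  assumes "exX M" "exX M'"
  shows "exX (mm M M')"
  unfolding exX_def
proof (intro allI)
  fix a b c d
  have "sc (Q a b) * (X a c * mm M M' b d) + (if a < b then sc (1 - r) * (X b c * mm M M' a d) else 0)
    = (\<Sum>m\<in>UNIV. (sc (Q a b) * (X a c * M b m) + (if a < b then sc (1 - r) * (X b c * M a m) else 0)) * M' m d)"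
    by (simp add: mm_def sum_distrib_left sum.distrib distrib_right mult.assoc)
  also have "\<dots> = (\<Sum>m\<in>UNIV. (sc (Q a m) * (M b m * X a c) + (if a = m then sc (1 - r) * (\<Sum>l\<in>{l. a < l}. M b l * X l c) else 0)) * M' m d)"
    by (simp only: assms(1)[unfolded exX_def])
  also have "\<dots> = (\<Sum>m\<in>UNIV. sc (Q a m) * (M b m * (X a c * M' m d))) + (\<Sum>m\<in>{m. a < m}. sc (1 - r) * (M b m * (X m c * M' a d)))"
    by (simp add: distrib_right sum.distrib mult.assoc if_distrib[of "\<lambda>x. x * _"] sum_distrib_left sum_distrib_right cong: if_cong)
  also have "\<dots> = (\<Sum>m\<in>UNIV. M b m * (sc (Q a m) * (X a c * M' m d) + (if a < m then sc (1 - r) * (X m c * M' a d) else 0)))"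
    by (simp add: distrib_left sum.distrib sc_left[of "M _ _"] if_distrib[of "\<lambda>x. _ * x"] sum.If_cases cong: if_cong)
  also have "\<dots> = (\<Sum>m\<in>UNIV. M b m * (sc (Q a d) * (M' m d * X a c) + (if a = d then sc (1 - r) * (\<Sum>l\<in>{l. a < l}. M' m l * X l c) else 0)))"
    by (simp only: assms(2)[unfolded exX_def])
  also have "\<dots> = sc (Q a d) * (mm M M' b d * X a c) + (if a = d then sc (1 - r) * (\<Sum>l\<in>{l. a < l}. mm M M' b l * X l c) else 0)"
  proof -
    define S where "S m = (\<Sum>l\<in>{l. a < l}. M' m l * X l c)" for m
    have eq: "(\<Sum>l\<in>{l. a < l}. mm M M' b l * X l c) = (\<Sum>m\<in>UNIV. M b m * S m)"
      unfolding mm_def S_def sum_distrib_left sum_distrib_right by (subst sum.swap) (simp add: mult.assoc)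
    show ?thesis unfolding eq S_def[symmetric]
      by (simp add: mm_def sum_distrib_left sum_distrib_right distrib_left sum.distrib mult.assoc sc_left[of "M _ _"])
  qed
  finally show "sc (Q a b) * (X a c * mm M M' b d) + (if a < b then sc (1 - r) * (X b c * mm M M' a d) else 0)
    = sc (Q a d) * (mm M M' b d * X a c) + (if a = d then sc (1 - r) * (\<Sum>l\<in>{l. a < l}. mm M M' b l * X l c) else 0)" .
qed

lemma exY_mm:
  assumes "exY M" "exY M'"
  shows "exY (mm M M')"
  unfolding exY_def
proof (intro allI)
  fix a b c d
  have "sc (Q c d) * (mm M M' a c * Y b d) + (if d < c then sc (1 - r) * (mm M M' a d * Y b c) else 0)
    = (\<Sum>m\<in>UNIV. M a m * (sc (Q c d) * (M' m c * Y b d) + (if d < c then sc (1 - r) * (M' m d * Y b c) else 0)))"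
    by (simp add: mm_def sum_distrib_left sum_distrib_right sum.distrib distrib_left mult.assoc sc_left[of "M _ _"])
  also have "\<dots> = (\<Sum>m\<in>UNIV. M a m * (sc (Q m d) * (Y b d * M' m c) + (if m = d then sc (1 - r) * (\<Sum>l\<in>{l. m < l}. Y b l * M' l c) else 0)))"
    by (simp only: assms(2)[unfolded exY_def])
  also have "\<dots> = (\<Sum>m\<in>UNIV. sc (Q m d) * (M a m * (Y b d * M' m c))) + (\<Sum>m\<in>{m. d < m}. sc (1 - r) * (M a d * (Y b m * M' m c)))"
    by (simp add: distrib_left sum.distrib sc_left[of "M _ _"] if_distrib[of "\<lambda>x. _ * x"] sum_distrib_left cong: if_cong)
  also have "\<dots> = (\<Sum>m\<in>UNIV. (sc (Q m d) * (M a m * Y b d) + (if d < m then sc (1 - r) * (M a d * Y b m) else 0)) * M' m c)"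
    by (simp add: distrib_right sum.distrib mult.assoc if_distrib[of "\<lambda>x. x * _"] sum.If_cases cong: if_cong)
  also have "\<dots> = (\<Sum>m\<in>UNIV. (sc (Q a d) * (Y b d * M a m) + (if a = d then sc (1 - r) * (\<Sum>l\<in>{l. a < l}. Y b l * M l m) else 0)) * M' m c)"
    by (simp only: assms(1)[unfolded exY_def])
  also have "\<dots> = sc (Q a d) * (Y b d * mm M M' a c) + (if a = d then sc (1 - r) * (\<Sum>l\<in>{l. a < l}. Y b l * mm M M' l c) else 0)"
  proof -
    define S where "S m = (\<Sum>l\<in>{l. a < l}. Y b l * M l m)" for m
    have eq: "(\<Sum>l\<in>{l. a < l}. Y b l * mm M M' l c) = (\<Sum>m\<in>UNIV. S m * M' m c)"
      unfolding mm_def S_def sum_distrib_left sum_distrib_right by (subst sum.swap) (simp add: mult.assoc)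
    show ?thesis unfolding eq S_def[symmetric]
      by (simp add: mm_def sum_distrib_left distrib_right sum.distrib mult.assoc)
  qed
  finally show "sc (Q c d) * (mm M M' a c * Y b d) + (if d < c then sc (1 - r) * (mm M M' a d * Y b c) else 0)
    = sc (Q a d) * (Y b d * mm M M' a c) + (if a = d then sc (1 - r) * (\<Sum>l\<in>{l. a < l}. Y b l * mm M M' l c) else 0)" .
qed

definition com :: "'o \<Rightarrow> bool" where
  "com z \<longleftrightarrow> (\<forall>a c. z * X a c = X a c * z \<and> z * Y a c = Y a c * z)"

text \<open>The weights \<open>dw\<close> are chosen to absorb the triangular corrections in the exchange relations.\<close>

lemma telescope_dw:
  fixes m :: "'n \<Rightarrow> 'o"
  shows "(\<Sum>b\<in>{b. a < b}. sc (dw b) * (m b + sc (1 - r) * (\<Sum>l\<in>{l. b < l}. m l)))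
    = sc (r * dw a) * (\<Sum>l\<in>{l. a < l}. m l)"
proof -
  have "(\<Sum>b\<in>{b. a < b}. sc (dw b) * (sc (1 - r) * (\<Sum>l\<in>{l. b < l}. m l)))
    = (\<Sum>b\<in>{b. a < b}. \<Sum>l\<in>{l. b < l}. sc ((1 - r) * dw b) * m l)"
    by (simp add: sum_distrib_left sc_mult mult.assoc scl_comm[of "1 - r"])
  also have "\<dots> = (\<Sum>l\<in>{l. a < l}. \<Sum>b\<in>{b. a < b \<and> b < l}. sc ((1 - r) * dw b) * m l)"
    by (subst sum.Sigma, simp, simp, subst sum.Sigma, simp, simp)
       (rule sum.reindex_bij_witness[where i = prod.swap and j = prod.swap], auto)
  also have "\<dots> = (\<Sum>l\<in>{l. a < l}. sc ((1 - r) * (\<Sum>b\<in>{b. a < b \<and> b < l}. dw b)) * m l)"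
    by (simp only: sum_distrib_left sc_sum sum_distrib_right)
  finally have "(\<Sum>b\<in>{b. a < b}. sc (dw b) * (m b + sc (1 - r) * (\<Sum>l\<in>{l. b < l}. m l)))
    = (\<Sum>l\<in>{l. a < l}. sc (dw l + (1 - r) * (\<Sum>b\<in>{b. a < b \<and> b < l}. dw b)) * m l)"
    by (simp add: distrib_left sum.distrib sc_add distrib_right)
  also have "\<dots> = (\<Sum>l\<in>{l. a < l}. sc (r * dw a) * m l)"
    by (intro sum.cong refl) (simp add: dw_interval)
  finally show ?thesis by (simp add: sum_distrib_left)
qed

lemma telescope_dw':
  fixes m t :: "'n \<Rightarrow> 'o"
  assumes "\<And>b. a < b \<Longrightarrow> sc r * t b = m b + sc (1 - r) * (\<Sum>l\<in>{l. b < l}. m l)"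
  shows "sc (dw a) * (\<Sum>l\<in>{l. a < l}. m l) = (\<Sum>b\<in>{b. a < b}. sc (dw b) * t b)"
proof -
  have "sc r * (\<Sum>b\<in>{b. a < b}. sc (dw b) * t b)
     = (\<Sum>b\<in>{b. a < b}. sc (dw b) * (m b + sc (1 - r) * (\<Sum>l\<in>{l. b < l}. m l)))"
    unfolding sum_distrib_left[of "sc r"] scl_comm[of r] by (intro sum.cong refl) (simp only: assms mem_Collect_eq)
  also have "\<dots> = sc r * (sc (dw a) * (\<Sum>l\<in>{l. a < l}. m l))"
    unfolding telescope_dw by (simp add: sc_mult mult.assoc)
  finally have "sc (1 / r) * (sc r * (\<Sum>b\<in>{b. a < b}. sc (dw b) * t b))
     = sc (1 / r) * (sc r * (sc (dw a) * (\<Sum>l\<in>{l. a < l}. m l)))"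
    by (rule arg_cong)
  then show ?thesis unfolding mult.assoc[symmetric] sc_mult[symmetric] by (simp add: sc_mult mult.assoc)
qed

text \<open>Sum the exchange relation over the diagonal with the weights \<open>dw\<close>; the corrections on the two sides
  cancel by \<open>telescope_dw\<close>.\<close>

lemma trace_com_X:
  assumes "exX M"
  shows "(\<Sum>b\<in>UNIV. sc (dw b) * M b b) * X a c = X a c * (\<Sum>b\<in>UNIV. sc (dw b) * M b b)"
proof -
  note E = assms[unfolded exX_def, rule_format]
  define m where "m l = M a l * X l c" for l
  define t where "t b = sc (1 / Q a b) * (X b c * M a b)" for b
  have "sc r * t b = m b + sc (1 - r) * (\<Sum>l\<in>{l. b < l}. m l)" if "a < b" for b
  proof -
    have "sc r * t b = sc (Q b a) * (X b c * M a b)"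
      unfolding t_def mult.assoc[symmetric] sc_mult[symmetric] using Q_inv[of a b] that by simp
    then show ?thesis using E[of b a c b] that less_not_sym[OF that] by (simp add: m_def)
  qed
  from telescope_dw'[of a t m, OF this]
  have tele: "sc (dw a) * (\<Sum>l\<in>{l. a < l}. m l) = (\<Sum>b\<in>{b. a < b}. sc (dw b) * t b)" .
  have diff: "X a c * M b b - M b b * X a c = (if b = a then sc (1 - r) * (\<Sum>l\<in>{l. a < l}. m l)
      else if a < b then - (sc (1 - r) * t b) else 0)" for b
  proof (cases "b = a")
    case True
    then show ?thesis using E[of a a c a] by (simp add: m_def)
  next
    case False
    have "sc (Q a b) * (X a c * M b b - M b b * X a c) = - (if a < b then sc (1 - r) * (X b c * M a b) else 0)"
      using E[of a b c b] False by (simp add: right_diff_distrib algebra_simps eq_neg_iff_add_eq_0)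
    then have "sc (1 / Q a b) * (sc (Q a b) * (X a c * M b b - M b b * X a c))
       = sc (1 / Q a b) * (- (if a < b then sc (1 - r) * (X b c * M a b) else 0))"
      by (rule arg_cong)
    then show ?thesis using False
      unfolding mult.assoc[symmetric] sc_mult[symmetric]
      by (simp add: t_def mult.assoc[symmetric] sc_mult[symmetric] mult.commute)
  qed
  have "X a c * (\<Sum>b\<in>UNIV. sc (dw b) * M b b) - (\<Sum>b\<in>UNIV. sc (dw b) * M b b) * X a c
     = (\<Sum>b\<in>UNIV. sc (dw b) * (X a c * M b b - M b b * X a c))"
    by (simp add: sum_distrib_left sum_distrib_right right_diff_distrib sum_subtractf sc_left[of "X _ _"] mult.assoc)
  also have "\<dots> = (\<Sum>b\<in>UNIV. (if b = a then sc (dw a) * (sc (1 - r) * (\<Sum>l\<in>{l. a < l}. m l)) else 0)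
      - (if a < b then sc (dw b) * (sc (1 - r) * t b) else 0))"
    unfolding diff by (intro sum.cong refl) auto
  also have "\<dots> = sc (dw a) * (sc (1 - r) * (\<Sum>l\<in>{l. a < l}. m l)) - (\<Sum>b\<in>{b. a < b}. sc (dw b) * (sc (1 - r) * t b))"
    by (simp add: sum_subtractf sum.If_cases)
  also have "\<dots> = sc (1 - r) * (sc (dw a) * (\<Sum>l\<in>{l. a < l}. m l) - (\<Sum>b\<in>{b. a < b}. sc (dw b) * t b))"
    by (simp only: right_diff_distrib sum_distrib_left scl_comm[of "1 - r"])
  also have "\<dots> = 0" by (simp only: tele diff_self mult_zero_right)
  finally show ?thesis by simp
qed

lemma trace_com_Y:
  assumes "exY M"
  shows "(\<Sum>b\<in>UNIV. sc (dw b) * M b b) * Y b d = Y b d * (\<Sum>b\<in>UNIV. sc (dw b) * M b b)"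
proof -
  note E = assms[unfolded exY_def, rule_format]
  define m where "m l = Y b l * M l d" for l
  define t where "t a = sc (1 / Q a d) * (M a d * Y b a)" for a
  have "sc r * t l = m l + sc (1 - r) * (\<Sum>l'\<in>{l'. l < l'}. m l')" if "d < l" for l
  proof -
    have "sc r * t l = sc (Q d l) * (M l d * Y b l)"
      unfolding t_def mult.assoc[symmetric] sc_mult[symmetric] using Q_inv[of l d] that by simp
    then show ?thesis using E[of d l l b] that less_not_sym[OF that] by (simp add: m_def)
  qed
  from telescope_dw'[of d t m, OF this]
  have tele: "sc (dw d) * (\<Sum>l\<in>{l. d < l}. m l) = (\<Sum>b\<in>{b. d < b}. sc (dw b) * t b)" .
  have diff: "M a a * Y b d - Y b d * M a a = (if a = d then sc (1 - r) * (\<Sum>l\<in>{l. d < l}. m l)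
      else if d < a then - (sc (1 - r) * t a) else 0)" for a
  proof (cases "a = d")
    case True
    then show ?thesis using E[of d d d b] by (simp add: m_def)
  next
    case False
    have "sc (Q a d) * (M a a * Y b d - Y b d * M a a) = - (if d < a then sc (1 - r) * (M a d * Y b a) else 0)"
      using E[of a d a b] False by (simp add: right_diff_distrib algebra_simps eq_neg_iff_add_eq_0)
    then have "sc (1 / Q a d) * (sc (Q a d) * (M a a * Y b d - Y b d * M a a))
       = sc (1 / Q a d) * (- (if d < a then sc (1 - r) * (M a d * Y b a) else 0))"
      by (rule arg_cong)
    then show ?thesis using False
      unfolding mult.assoc[symmetric] sc_mult[symmetric]
      by (simp add: t_def mult.assoc[symmetric] sc_mult[symmetric] mult.commute)
  qed
  have "(\<Sum>a\<in>UNIV. sc (dw a) * M a a) * Y b d - Y b d * (\<Sum>a\<in>UNIV. sc (dw a) * M a a)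
     = (\<Sum>a\<in>UNIV. sc (dw a) * (M a a * Y b d - Y b d * M a a))"
    by (simp add: sum_distrib_left sum_distrib_right right_diff_distrib sum_subtractf sc_left[of "Y _ _"] mult.assoc)
  also have "\<dots> = (\<Sum>a\<in>UNIV. (if a = d then sc (dw d) * (sc (1 - r) * (\<Sum>l\<in>{l. d < l}. m l)) else 0)
      - (if d < a then sc (dw a) * (sc (1 - r) * t a) else 0))"
    unfolding diff by (intro sum.cong refl) auto
  also have "\<dots> = sc (dw d) * (sc (1 - r) * (\<Sum>l\<in>{l. d < l}. m l)) - (\<Sum>a\<in>{a. d < a}. sc (dw a) * (sc (1 - r) * t a))"
    by (simp add: sum_subtractf sum.If_cases)
  also have "\<dots> = sc (1 - r) * (sc (dw d) * (\<Sum>l\<in>{l. d < l}. m l) - (\<Sum>a\<in>{a. d < a}. sc (dw a) * t a))"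
    by (simp only: right_diff_distrib sum_distrib_left scl_comm[of "1 - r"])
  also have "\<dots> = 0" by (simp only: tele diff_self mult_zero_right)
  finally show ?thesis by simp
qed

lemma trace_com:
  assumes "exX M" "exY M" 
  shows "com (\<Sum>b\<in>UNIV. sc (dw b) * M b b)"
  using trace_com_X[OF assms(1)] trace_com_Y[OF assms(2)] by (simp add: com_def)

lemma exX_affine:
  assumes "exX M" "com s"
  shows "exX (\<lambda>i j. (if i = j then s else 0) - M i j)"
  unfolding exX_def
proof (intro allI)
  fix a b c d
  have s: "X i j * s = s * X i j" for i j using assms(2) by (simp add: com_def)
  have "sc (Q a b) * (X a c * (if b = d then s else 0)) + (if a < b then sc (1 - r) * (X b c * (if a = d then s else 0)) else 0)
   = sc (Q a d) * ((if b = d then s else 0) * X a c) + (if a = d then sc (1 - r) * (\<Sum>l\<in>{l. a < l}. (if b = l then s else 0) * X l c) else 0)"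
    by (auto simp: s if_distrib[of "\<lambda>x. x * _"] cong: if_cong)
  moreover note assms(1)[unfolded exX_def, rule_format, of a b c d]
  ultimately show "sc (Q a b) * (X a c * ((if b = d then s else 0) - M b d)) + (if a < b then sc (1 - r) * (X b c * ((if a = d then s else 0) - M a d)) else 0)
   = sc (Q a d) * (((if b = d then s else 0) - M b d) * X a c) + (if a = d then sc (1 - r) * (\<Sum>l\<in>{l. a < l}. ((if b = l then s else 0) - M b l) * X l c) else 0)"
    unfolding left_diff_distrib right_diff_distrib sum_subtractf
    by (cases "a < b"; cases "a = d") (simp_all only: if_True if_False right_diff_distrib, simp_all add: algebra_simps)
qed

lemma exY_affine:
  assumes "exY M" "com s"
  shows "exY (\<lambda>i j. (if i = j then s else 0) - M i j)"
  unfolding exY_def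
proof (intro allI)
  fix a b c d
  have s: "s * Y i j = Y i j * s" for i j using assms(2) by (simp add: com_def)
  have "sc (Q c d) * ((if a = c then s else 0) * Y b d) + (if d < c then sc (1 - r) * ((if a = d then s else 0) * Y b c) else 0)
   = sc (Q a d) * (Y b d * (if a = c then s else 0)) + (if a = d then sc (1 - r) * (\<Sum>l\<in>{l. a < l}. Y b l * (if l = c then s else 0)) else 0)"
    by (auto simp: s if_distrib[of "\<lambda>x. _ * x"] cong: if_cong)
  moreover note assms(1)[unfolded exY_def, rule_format, of c d a b]
  ultimately show "sc (Q c d) * (((if a = c then s else 0) - M a c) * Y b d) + (if d < c then sc (1 - r) * (((if a = d then s else 0) - M a d) * Y b c) else 0)
   = sc (Q a d) * (Y b d * ((if a = c then s else 0) - M a c)) + (if a = d then sc (1 - r) * (\<Sum>l\<in>{l. a < l}. Y b l * ((if l = c then s else 0) - M l c)) else 0)"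
    unfolding left_diff_distrib right_diff_distrib sum_subtractf
    by (cases "d < c"; cases "a = d") (simp_all only: if_True if_False right_diff_distrib, simp_all add: algebra_simps)
qed

text \<open>On the diagonal, the coefficient of a minor is a power of \<open>r\<close> given by the rank of \<open>i\<close>
  in the complement of \<open>K - {i}\<close>; the sum over \<open>i\<close> is a geometric series.\<close>

lemma trace_Am:
  "(\<Sum>i\<in>UNIV. sc (dw i) * Am (Suc k) i i) = sc (r ^ k * (\<Sum>j<CARD('n) - k. r ^ j)) * sm k"
proof -
  have "(\<Sum>i\<in>UNIV. sc (dw i) * Am (Suc k) i i)
    = (\<Sum>i\<in>UNIV. \<Sum>K\<in>{K. card K = Suc k \<and> i \<in> K}. sc (dw i * (Gr i K * Cl (K - {i}) i)) * Xcon (yy (K - {i})) (sl (K - {i})))"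
    by (simp add: Am_alt sum_distrib_left sc_mult mult.assoc)
  also have "\<dots> = (\<Sum>(i, K)\<in>(SIGMA i:UNIV. {K. card K = Suc k \<and> i \<in> K}). sc (dw i * (Gr i K * Cl (K - {i}) i)) * Xcon (yy (K - {i})) (sl (K - {i})))"
    by (rule sum.Sigma) auto
  also have "\<dots> = (\<Sum>(S, i)\<in>(SIGMA S:{S. card S = k}. - S). sc (dw i * r ^ card {y \<in> S. i < y}) * Xcon (yy S) (sl S))"
  proof (rule sum.reindex_bij_witness[where j = "\<lambda>(i, K). (K - {i}, i)" and i = "\<lambda>(S, i). (i, insert i S)"])
    fix z assume "z \<in> (SIGMA i:UNIV. {K :: 'n set. card K = Suc k \<and> i \<in> K})"
    then obtain i K where z: "z = (i, K)" and K: "card K = Suc k" "i \<in> K" by auto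
    show "(case case z of (i, K) \<Rightarrow> (K - {i}, i) of (S, i) \<Rightarrow> (i, insert i S)) = z"
      using z K by auto
    show "(case z of (i, K) \<Rightarrow> (K - {i}, i)) \<in> (SIGMA S:{S. card S = k}. - S)"
      using z K by auto
    have "Gr i K = Gr i (K - {i})"
      using Gr_insert[of i "K - {i}" i] K by (simp add: insert_absorb)
    then have "Gr i K * Cl (K - {i}) i = r ^ card {y \<in> K - {i}. i < y}"
      using coeff_diag_rank[of i "K - {i}"] by simp
    then show "(case case z of (i, K) \<Rightarrow> (K - {i}, i) of (S, i) \<Rightarrow> sc (dw i * r ^ card {y \<in> S. i < y}) * Xcon (yy S) (sl S))
      = (case z of (i, K) \<Rightarrow> sc (dw i * (Gr i K * Cl (K - {i}) i)) * Xcon (yy (K - {i})) (sl (K - {i})))"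
      using z by (simp only: prod.case)
  next
    fix z assume "z \<in> (SIGMA S:{S :: 'n set. card S = k}. - S)"
    then obtain i S where z: "z = (S, i)" and K: "card S = k" "i \<notin> S" by auto
    show "(case case z of (S, i) \<Rightarrow> (i, insert i S) of (i, K) \<Rightarrow> (K - {i}, i)) = z"
      using z K by auto
    show "(case z of (S, i) \<Rightarrow> (i, insert i S)) \<in> (SIGMA i:UNIV. {K. card K = Suc k \<and> i \<in> K})"
      using z K by simp
  qed
  also have "\<dots> = (\<Sum>S\<in>{S. card S = k}. \<Sum>i\<in>- S. sc (dw i * r ^ card {y \<in> S. i < y}) * Xcon (yy S) (sl S))"
    by (rule sum.Sigma[symmetric]) auto
  also have "\<dots> = (\<Sum>S\<in>{S. card S = k}. sc (r ^ k * (\<Sum>j<CARD('n) - k. r ^ j)) * Xcon (yy S) (sl S))"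
    by (rule sum.cong[OF refl]) (simp only: sum_distrib_right[symmetric] sc_sum[symmetric] sum_rank_split mem_Collect_eq)
  finally show ?thesis by (simp only: sm_def sum_distrib_left)
qed

text \<open>Newton's identity: take the quantum trace of the recursion.\<close>

lemma trace_Z_Am:
  assumes "k \<le> CARD('n)"
  shows "(\<Sum>i\<in>UNIV. sc (dw i) * mm Zm (Am k) i i) = sc (\<Sum>j<k. r ^ j) * sm k"
proof -
  have "(\<Sum>i\<in>UNIV. sc (dw i) * mm Zm (Am k) i i) + (\<Sum>i\<in>UNIV. sc (dw i) * Am (Suc k) i i)
    = (\<Sum>i\<in>UNIV. sc (dw i) * (mm Zm (Am k) i i + Am (Suc k) i i))"
    by (simp only: distrib_left sum.distrib)
  also have "\<dots> = sc (\<Sum>j<CARD('n). r ^ j) * sm k"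
    unfolding mm_def main_identity_all by (simp add: sum_distrib_right[symmetric] sc_sum[symmetric] sum_dw)
  finally have "(\<Sum>i\<in>UNIV. sc (dw i) * mm Zm (Am k) i i)
     = sc ((\<Sum>j<CARD('n). r ^ j) - r ^ k * (\<Sum>j<CARD('n) - k. r ^ j)) * sm k"
    unfolding trace_Am sc_diff left_diff_distrib by (simp add: eq_diff_eq)
  then show ?thesis by (simp only: qnum_split[OF assms])
qed

lemma com_scale: "com z \<Longrightarrow> com (sc c * z)"
  by (simp add: com_def sc_left[of "X _ _"] sc_left[of "Y _ _"] mult.assoc)

text \<open>Simultaneous induction: the exchange relations for \<open>A\<^sub>k\<close> make the quantum trace of \<open>Z A\<^sub>k\<close> central, hence
  \<open>sm k\<close>, hence the recursion passes them on to the next matrix.\<close>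

lemma sm_com: "com (sm k)" and exX_Am: "exX (Am k)" and exY_Am: "exY (Am k)"
proof -
  have "exX (Am k) \<and> exY (Am k) \<and> com (sm k)"
  proof (induction k)
    case 0
    show ?case by (simp add: exX_def exY_def com_def Am_0 sm_0)
  next
    case (Suc k)
    have A: "Am (Suc k) = (\<lambda>i j. (if i = j then sm k else 0) - mm Zm (Am k) i j)"
    proof (intro ext)
      fix i j
      show "Am (Suc k) i j = (if i = j then sm k else 0) - mm Zm (Am k) i j"
        using main_identity_all[of i k j] by (simp add: mm_def eq_diff_eq add.commute)
    qed
    have X: "exX (Am (Suc k))" unfolding A
      using Suc by (intro exX_affine exX_mm exX_Zm) auto
    have Y: "exY (Am (Suc k))" unfolding A
      using Suc by (intro exY_affine exY_mm exY_Zm) auto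
    have "com (sm (Suc k))"
    proof (cases "Suc k \<le> CARD('n)")
      case True
      have "com (sc (1 / (\<Sum>j<Suc k. r ^ j)) * (sc (\<Sum>j<Suc k. r ^ j) * sm (Suc k)))"
        unfolding trace_Z_Am[OF True, symmetric]
        by (intro com_scale trace_com exX_mm exX_Zm X exY_mm exY_Zm Y)
      moreover have "sc (1 / (\<Sum>j<Suc k. r ^ j)) * (sc (\<Sum>j<Suc k. r ^ j) * sm (Suc k)) = sm (Suc k)"
        unfolding mult.assoc[symmetric] sc_mult[symmetric] using qnum_nz[of "Suc k"] by simp
      ultimately show ?thesis by simp
    next
      case False
      have "card K \<noteq> Suc k" for K :: "'n set"
        using False card_mono[of "UNIV :: 'n set" K] by auto
      then have "{K :: 'n set. card K = Suc k} = {}" by simp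
      then have "sm (Suc k) = 0" by (simp only: sm_def sum.empty)
      then show ?thesis by (simp add: com_def)
    qed
    with X Y show ?case by simp
  qed
  then show "com (sm k)" "exX (Am k)" "exY (Am k)" by auto
qed

lemma com_Zm: "com s \<Longrightarrow> s * Zm i j = Zm i j * s"
proof -
  assume c: "com s"
  have "s * (X i m * Y m j) = X i m * Y m j * s" for m
  proof -
    have "s * (X i m * Y m j) = (s * X i m) * Y m j" by (simp only: mult.assoc)
    also have "\<dots> = X i m * (s * Y m j)" using c by (simp only: com_def mult.assoc)
    also have "\<dots> = X i m * (Y m j * s)" using c by (simp only: com_def)
    finally show ?thesis by (simp only: mult.assoc)
  qed
  then show ?thesis by (simp add: Zm_def sum_distrib_left sum_distrib_right)
qed

lemma mm_assoc: "mm A (mm B C) = mm (mm A B) C"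
proof (intro ext)
  fix i j
  show "mm A (mm B C) i j = mm (mm A B) C i j"
    unfolding mm_def sum_distrib_left sum_distrib_right
    by (subst sum.swap) (simp add: mult.assoc)
qed

lemma Am_commute_Zm: "mm (Am k) Zm = mm Zm (Am k)"
proof (induction k)
  case 0
  show ?case by (intro ext) (simp add: mm_def Am_0)
next
  case (Suc k)
  have A: "Am (Suc k) i j = (if i = j then sm k else 0) - mm Zm (Am k) i j" for i j
    using main_identity_all[of i k j] by (simp add: mm_def eq_diff_eq add.commute)
  show ?case
  proof (intro ext)
    fix i j
    have "mm (Am (Suc k)) Zm i j = sm k * Zm i j - mm (mm Zm (Am k)) Zm i j"
      unfolding mm_def[of "Am (Suc k)"] A left_diff_distrib sum_subtractf
      by (simp add: mm_def[of "mm Zm (Am k)"] if_distrib[of "\<lambda>x. x * _"] cong: if_cong)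
    also have "\<dots> = Zm i j * sm k - mm Zm (mm Zm (Am k)) i j"
      by (simp only: com_Zm[OF sm_com] mm_assoc[symmetric] Suc)
    also have "\<dots> = mm Zm (Am (Suc k)) i j"
      unfolding mm_def[of Zm "Am (Suc k)"] A right_diff_distrib sum_subtractf
      by (simp add: mm_def[of Zm "mm Zm (Am k)"] if_distrib[of "\<lambda>x. _ * x"] cong: if_cong)
    finally show "mm (Am (Suc k)) Zm i j = mm Zm (Am (Suc k)) i j" .
  qed
qed

end

section \<open>Transferring quantum traces between legs\<close>

context qparam begin

abbreviation words :: "nat \<Rightarrow> 'n list set" where "words n \<equiv> {w. length w = n}"

lemma finite_words: "finite (words n)"
  using finite_lists_length_eq[of "UNIV :: 'n set" n] by simp

lemma sum_words_Suc: "(\<Sum>w\<in>words (Suc n). f w) = (\<Sum>x\<in>UNIV. \<Sum>w\<in>words n. f (x # w))"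
  for f :: "'n list \<Rightarrow> 'm::comm_monoid_add"
proof -
  have "(\<Sum>x\<in>UNIV. \<Sum>w\<in>words n. f (x # w)) = (\<Sum>(x, w)\<in>UNIV \<times> words n. f (x # w))"
    by (rule sum.cartesian_product)
  also have "\<dots> = (\<Sum>w\<in>words (Suc n). f w)"
    by (rule sum.reindex_bij_witness[where i = "\<lambda>w. (hd w, tl w)" and j = "\<lambda>(x, w). x # w"])
       (auto simp: length_Suc_conv)
  finally show ?thesis ..
qed

lemma sum_words_snoc: "(\<Sum>w\<in>words (Suc n). f w) = (\<Sum>w\<in>words n. \<Sum>x\<in>UNIV. f (w @ [x]))"
  for f :: "'n list \<Rightarrow> 'm::comm_monoid_add"
proof -
  have "(\<Sum>w\<in>words n. \<Sum>x\<in>UNIV. f (w @ [x])) = (\<Sum>(w, x)\<in>words n \<times> UNIV. f (w @ [x]))"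
    by (rule sum.cartesian_product)
  also have "\<dots> = (\<Sum>w\<in>words (Suc n). f w)"
    by (rule sum.reindex_bij_witness[where i = "\<lambda>w. (butlast w, last w)" and j = "\<lambda>(w, x). w @ [x]"])
       (auto intro!: append_butlast_last_id)
  finally show ?thesis ..
qed

text \<open>The kernel of the projection onto the alternating tensors, up to a factorial; it is zero when \<open>c\<close> has a repetition.\<close>

definition AA :: "'n list \<Rightarrow> 'n list \<Rightarrow> 'f" where
  "AA c b = eps_r c * uv (set c) b"

lemma AA_alternating: "alternating (*) (AA c)"
  unfolding AA_def by (intro alternating_scale[OF vs_f] uv_alternating)

lemma tr_scale: "tr p (\<lambda>b. c * g b) b i = c * tr p g b i"
  unfolding tr_def
  by (subst transport_scale[OF vs_f, symmetric])
     (rule arg_cong[of _ _ "\<lambda>F. transport (*) F b i"], intro ext, simp)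

lemma tr_AA: "tr p (AA c) b i = eps_r c * tr p (uv (set c)) b i"
proof -
  have "AA c = (\<lambda>b. eps_r c * uv (set c) b)" by (rule ext) (rule AA_def)
  then show ?thesis by (simp only: tr_scale)
qed

lemma Cl_inv_r: "i \<notin> E \<Longrightarrow> Cl E i * (\<Prod>y\<in>E. inv_r y i) = r ^ card {y \<in> E. i < y}"
  unfolding Cl_def power_card_prod prod.distrib[symmetric]
proof (rule prod.cong[OF refl])
  fix y assume "i \<notin> E" "y \<in> E"
  then have n: "y \<noteq> i" by auto
  then consider "y < i" | "i < y" by (meson linorder_neqE)
  then show "inv_c y i * inv_r y i = (if i < y then r else 1)"
    using n Q_mult[of i y] by cases (auto simp: inv_c_def inv_r_def)
qed

lemma Qprod_inv_r: "p \<notin> E \<Longrightarrow> Qprod p E = (- 1) ^ card E * (\<Prod>y\<in>E. inv_r p y) * Cl E p"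
  unfolding Cl_def Qprod_def power_card_prod_all prod.distrib[symmetric]
proof (rule prod.cong[OF refl])
  fix y assume "p \<notin> E" "y \<in> E"
  then have n: "y \<noteq> p" by auto
  then consider "y < p" | "p < y" by (meson linorder_neqE)
  then show "Q p y = - 1 * inv_r p y * inv_c y p"
    using n by cases (auto simp: inv_c_def inv_r_def)
qed

text \<open>The transport of the last leg of the projection to the first one, with quantum trace: the
  weights \<open>dw\<close> make all terms but one cancel, again by telescoping.\<close>

lemma trace_A_sl:
  "(\<Sum>i\<in>UNIV. dw i * tr p (AA (a @ [i])) (sl K') i) = (- r) ^ length a * AA (p # a) (sl K')"
proof (cases "distinct a")
  case False
  then have "eps_r (a @ [i]) = 0" "eps_r (p # a) = 0" for i
    by (auto intro!: eps_r_not_distinct)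
  then show ?thesis by (simp only: AA_def tr_AA mult_zero_left mult_zero_right sum.neutral_const)
next
  case True
  define E where "E = set a"
  have len: "length a = card E" using True by (simp add: E_def distinct_card)
  have AAi: "tr p (AA (a @ [i])) b i = (if i \<in> E then 0 else eps_r a * (\<Prod>y\<in>E. inv_r y i) * tr p (uv (insert i E)) b i)" for i b
  proof (cases "i \<in> E")
    case i: True
    then have "eps_r (a @ [i]) = 0" by (intro eps_r_not_distinct) (simp add: E_def)
    then show ?thesis using i by (simp add: tr_AA)
  next
    case False
    then show ?thesis using True
      by (simp add: tr_AA eps_r_snoc E_def)
  qed
  have rhs: "AA (p # a) (sl K') = (if p \<notin> E \<and> K' = insert p E then (\<Prod>y\<in>E. inv_r p y) * eps_r a else 0)"
  proof (cases "p \<in> E")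
    case p: True
    then have "eps_r (p # a) = 0" by (intro eps_r_not_distinct) (simp add: E_def)
    then show ?thesis using p by (simp only: AA_def) simp
  next
    case False
    then show ?thesis using True
      by (auto simp: AA_def uv_sl eps_r_Cons E_def[symmetric] simp del: eps_r.simps)
  qed
  show ?thesis
  proof (cases "p \<notin> E \<and> K' = insert p E")
    case False
    have "(if i \<in> E then 0 else eps_r a * (\<Prod>y\<in>E. inv_r y i) * tr p (uv (insert i E)) (sl K') i) = 0" for i
    proof (cases "i \<in> E")
      case i: False
      have "tr p (uv (insert i E)) (sl K') i = 0"
      proof (cases "p \<in> K'")
        case pK: True
        show ?thesis
        proof (cases "i = p")
          case True
          with False i pK show ?thesis unfolding tr_uv by auto
        next
          case ip: False
          have "\<not> (i \<notin> K' \<and> insert i E = insert i (K' - {p}))"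
          proof
            assume h: "i \<notin> K' \<and> insert i E = insert i (K' - {p})"
            then have "E = K' - {p}" using i by auto
            then show False using False pK by auto
          qed
          then show ?thesis unfolding tr_uv using ip pK by auto
        qed
      next
        case pK: False
        then show ?thesis unfolding tr_uv by auto
      qed
      then show ?thesis by simp
    qed simp
    then show ?thesis unfolding AAi rhs if_not_P[OF False] by simp
  next
    case pE: True
    then have p: "p \<notin> E" and K': "K' = insert p E" by auto
    have K'p: "K' - {p} = E" using p K' by auto
    have t: "tr p (uv (insert i E)) (sl K') i = (if i = p then Qprod p E else if i < p then (1 - r) * Qprod p E * Cl E i / Cl E p else 0)"
      if "i \<notin> E" for i
      unfolding tr_uv K'p using K' that p by auto
    have z: "Cl E p \<noteq> 0" using p by (rule Cl_nz)
    define B where "B = {i \<in> - E. i < p}"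
    have term_i: "dw i * (eps_r a * (\<Prod>y\<in>E. inv_r y i) * ((1 - r) * Qprod p E * Cl E i / Cl E p))
        = (Qprod p E / Cl E p * eps_r a * r ^ card E) * ((1 - r) * r ^ card {k \<in> B. k < i})" if "i \<in> B" for i
    proof -
      have "{k \<in> B. k < i} = {k \<in> - E. k < i}" using that by (auto simp: B_def)
      moreover have "dw i * (Cl E i * (\<Prod>y\<in>E. inv_r y i)) = r ^ card E * r ^ card {k \<in> - E. k < i}"
        using that by (simp add: Cl_inv_r rank_split B_def)
      ultimately have "dw i * (Cl E i * (\<Prod>y\<in>E. inv_r y i)) = r ^ card E * r ^ card {k \<in> B. k < i}" by simp
      moreover have "dw i * (eps_r a * (\<Prod>y\<in>E. inv_r y i) * ((1 - r) * Qprod p E * Cl E i / Cl E p))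
        = (dw i * (Cl E i * (\<Prod>y\<in>E. inv_r y i))) * ((1 - r) * Qprod p E / Cl E p * eps_r a)"
        by (simp add: mult_ac)
      ultimately show ?thesis by (simp add: mult_ac)
    qed
    have term_p: "dw p * (eps_r a * (\<Prod>y\<in>E. inv_r y p) * Qprod p E)
        = (Qprod p E / Cl E p * eps_r a * r ^ card E) * r ^ card B"
    proof -
      have "dw p * (Cl E p * (\<Prod>y\<in>E. inv_r y p)) = r ^ card E * r ^ card B"
        using p by (simp add: Cl_inv_r rank_split B_def)
      moreover have "dw p * (eps_r a * (\<Prod>y\<in>E. inv_r y p) * Qprod p E)
         = (dw p * (Cl E p * (\<Prod>y\<in>E. inv_r y p))) * (Qprod p E / Cl E p * eps_r a)"
        using z by (simp add: mult_ac)
      ultimately show ?thesis by (simp add: mult_ac)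
    qed
    have "(\<Sum>i\<in>UNIV. dw i * tr p (AA (a @ [i])) (sl K') i)
      = (\<Sum>i\<in>UNIV. (if i = p then dw p * (eps_r a * (\<Prod>y\<in>E. inv_r y p) * Qprod p E) else 0)
         + (if i \<in> B then dw i * (eps_r a * (\<Prod>y\<in>E. inv_r y i) * ((1 - r) * Qprod p E * Cl E i / Cl E p)) else 0))"
      unfolding AAi
    proof (rule sum.cong[OF refl])
      fix i
      consider "i \<in> E" | "i = p" | "i \<notin> E" "i \<noteq> p" by blast
      then show "dw i * (if i \<in> E then 0 else eps_r a * (\<Prod>y\<in>E. inv_r y i) * tr p (uv (insert i E)) (sl K') i)
        = (if i = p then dw p * (eps_r a * (\<Prod>y\<in>E. inv_r y p) * Qprod p E) else 0)
         + (if i \<in> B then dw i * (eps_r a * (\<Prod>y\<in>E. inv_r y i) * ((1 - r) * Qprod p E * Cl E i / Cl E p)) else 0)"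
        using p by cases (auto simp: t B_def)
    qed
    also have "\<dots> = dw p * (eps_r a * (\<Prod>y\<in>E. inv_r y p) * Qprod p E)
        + (\<Sum>i\<in>B. dw i * (eps_r a * (\<Prod>y\<in>E. inv_r y i) * ((1 - r) * Qprod p E * Cl E i / Cl E p)))"
      by (simp add: sum.distrib sum.If_cases)
    also have "\<dots> = (Qprod p E / Cl E p * eps_r a * r ^ card E) * r ^ card B
        + (\<Sum>i\<in>B. (Qprod p E / Cl E p * eps_r a * r ^ card E) * ((1 - r) * r ^ card {k \<in> B. k < i}))"
      unfolding term_p by (intro arg_cong2[where f = "(+)"] refl sum.cong term_i)
    also have "\<dots> = (Qprod p E / Cl E p * eps_r a * r ^ card E) * (r ^ card B + (1 - r) * (\<Sum>i<card B. r ^ i))"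
      by (simp only: sum_distrib_left[symmetric] sum_rank_below[OF finite] distrib_left)
    also have "\<dots> = Qprod p E / Cl E p * eps_r a * r ^ card E"
      by (simp add: telescope)
    also have "\<dots> = (- r) ^ card E * ((\<Prod>y\<in>E. inv_r p y) * eps_r a)"
      unfolding Qprod_inv_r[OF p] using z by (simp add: power_minus[of r] mult_ac)
    finally show ?thesis unfolding rhs if_P[OF pE] len .
  qed
qed

lemma trace_A:
  "(\<Sum>i\<in>UNIV. dw i * tr p (AA (a @ [i])) b i) = (- r) ^ length a * AA (p # a) b"
proof -
  have "alternating (*) (\<lambda>b. \<Sum>i\<in>UNIV. dw i * tr p (AA (a @ [i])) b i)"
    by (intro alternating_sum[OF vs_f] alternating_scale[OF vs_f] tr_alternating AA_alternating)
  from alternating_sl[OF vs_f this, of b]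
  have "(\<Sum>i\<in>UNIV. dw i * tr p (AA (a @ [i])) b i) = eps_c b * ((- r) ^ length a * AA (p # a) (sl (set b)))"
    by (simp only: trace_A_sl)
  also have "\<dots> = (- r) ^ length a * (eps_c b * AA (p # a) (sl (set b)))"
    by (simp only: mult.left_commute)
  also have "eps_c b * AA (p # a) (sl (set b)) = AA (p # a) b"
    by (rule alternating_sl[OF vs_f AA_alternating, symmetric])
  finally show ?thesis .
qed

definition qnum :: "nat \<Rightarrow> 'f" where "qnum n = (\<Sum>k<n. r ^ k)"
text \<open>The \<open>r\<close>-factorial, \<open>[n]!\<close> for \<open>r = q^2\<close>.\<close>

definition qf :: "nat \<Rightarrow> 'f" where "qf n = (\<Prod>k=1..n. qnum k)"

lemma qf_nz: "qf n \<noteq> 0"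
  unfolding qf_def qnum_def by (simp add: qnum_nz)

lemma qf_Suc: "qf (Suc n) = qf n * qnum (Suc n)"
  by (simp add: qf_def)

text \<open>The generating function of the number of inversions, since an inversion contributes \<open>q\<^sub>a\<^sub>b q\<^sub>b\<^sub>a = r\<close>.\<close>

lemma perm_sum: "(\<Sum>a\<in>permutations_of_set K. eps_r a * eps_c a) = qf (card K)" for K :: "'n set"
proof (induction "card K" arbitrary: K)
  case 0
  then show ?case by (simp add: qf_def)
next
  case (Suc n)
  then have ne: "K \<noteq> {}" by auto
  have pr: "(\<Prod>y\<in>K - {x}. inv_r x y) * (\<Prod>y\<in>K - {x}. inv_c x y) = r ^ card {y \<in> K. y < x}" for x
  proof -
    have "(\<Prod>y\<in>K - {x}. inv_r x y) * (\<Prod>y\<in>K - {x}. inv_c x y) = (\<Prod>y\<in>K - {x}. if y < x then r else 1)"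
      unfolding prod.distrib[symmetric]
    proof (rule prod.cong[OF refl])
      fix y assume "y \<in> K - {x}"
      then show "inv_r x y * inv_c x y = (if y < x then r else 1)"
        using Q_mult[of x y] by (auto simp: inv_r_def inv_c_def)
    qed
    also have "\<dots> = r ^ card {y \<in> K - {x}. y < x}" by (rule power_card_prod[symmetric])
    also have "{y \<in> K - {x}. y < x} = {y \<in> K. y < x}" by auto
    finally show ?thesis .
  qed
  have "(\<Sum>a\<in>permutations_of_set K. eps_r a * eps_c a)
    = (\<Sum>x\<in>K. \<Sum>a\<in>(#) x ` permutations_of_set (K - {x}). eps_r a * eps_c a)"
    unfolding permutations_of_set_nonempty[OF ne] by (rule sum.UNION_disjoint) auto
  also have "\<dots> = (\<Sum>x\<in>K. \<Sum>a\<in>permutations_of_set (K - {x}). r ^ card {y \<in> K. y < x} * (eps_r a * eps_c a))"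
  proof (rule sum.cong[OF refl])
    fix x
    have "(\<Sum>a\<in>(#) x ` permutations_of_set (K - {x}). eps_r a * eps_c a)
      = (\<Sum>a\<in>permutations_of_set (K - {x}). eps_r (x # a) * eps_c (x # a))"
      by (subst sum.reindex) (auto simp: inj_on_def)
    also have "\<dots> = (\<Sum>a\<in>permutations_of_set (K - {x}). r ^ card {y \<in> K. y < x} * (eps_r a * eps_c a))"
    proof (rule sum.cong[OF refl])
      fix a assume "a \<in> permutations_of_set (K - {x})"
      then have "distinct a" "set a = K - {x}" by (auto simp: permutations_of_set_def)
      then have "eps_r (x # a) * eps_c (x # a) = ((\<Prod>y\<in>K - {x}. inv_r x y) * (\<Prod>y\<in>K - {x}. inv_c x y)) * (eps_r a * eps_c a)"
        by (simp only: eps_r_Cons eps_c_Cons mult_ac)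
      then show "eps_r (x # a) * eps_c (x # a) = r ^ card {y \<in> K. y < x} * (eps_r a * eps_c a)"
        by (simp only: pr)
    qed
    finally show "(\<Sum>a\<in>(#) x ` permutations_of_set (K - {x}). eps_r a * eps_c a)
      = (\<Sum>a\<in>permutations_of_set (K - {x}). r ^ card {y \<in> K. y < x} * (eps_r a * eps_c a))" .
  qed
  also have "\<dots> = (\<Sum>x\<in>K. r ^ card {y \<in> K. y < x} * qf n)"
    unfolding sum_distrib_left[symmetric]
  proof (rule sum.cong[OF refl])
    fix x assume "x \<in> K"
    then have "card (K - {x}) = n" using Suc(2) by simp
    with Suc(1)[of "K - {x}"] show "r ^ card {y \<in> K. y < x} * (\<Sum>a\<in>permutations_of_set (K - {x}). eps_r a * eps_c a)
      = r ^ card {y \<in> K. y < x} * qf n" by simp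
  qed
  also have "\<dots> = qf (Suc n)"
    unfolding sum_distrib_right[symmetric] sum_rank_below[OF finite] Suc(2)[symmetric] qf_Suc qnum_def
    by (rule mult.commute)
  finally show ?case by (simp only: Suc(2))
qed

lemma sum_words_distinct:
  fixes f :: "'n list \<Rightarrow> 'm::comm_monoid_add"
  assumes "\<And>w. \<not> distinct w \<Longrightarrow> f w = 0"
  shows "(\<Sum>w\<in>words k. f w) = (\<Sum>K\<in>{K. card K = k}. \<Sum>w\<in>permutations_of_set K. f w)"
proof -
  have "(\<Sum>K\<in>{K. card K = k}. \<Sum>w\<in>permutations_of_set K. f w) = (\<Sum>w\<in>(\<Union>K\<in>{K. card K = k}. permutations_of_set K). f w)"
    by (rule sum.UNION_disjoint[symmetric]) (auto dest: permutations_of_setD(1))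
  also have "(\<Union>K\<in>{K :: 'n set. card K = k}. permutations_of_set K) = {w. length w = k \<and> distinct w}"
    by (auto simp: permutations_of_set_def distinct_card)
  also have "(\<Sum>w\<in>{w. length w = k \<and> distinct w}. f w) = (\<Sum>w\<in>words k. f w)"
    by (rule sum.mono_neutral_left) (auto simp: finite_words assms)
  finally show ?thesis ..
qed

end

context quantum_pair begin

text \<open>\<open>X\<close> applied to every leg, with all factors on the left.\<close>

primrec Xl :: "('n list \<Rightarrow> 'o) \<Rightarrow> 'n list \<Rightarrow> 'o" where
  Xl_Nil: "Xl f [] = f []"
| Xl_Cons: "Xl f (a # w) = (\<Sum>c\<in>UNIV. X a c * Xl (\<lambda>u. f (c # u)) w)"

lemma Xl_add: "Xl (\<lambda>u. f u + g u) w = Xl f w + Xl g w"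
  by (induction w arbitrary: f g) (simp_all add: distrib_left sum.distrib)

lemma Xl_zero [simp]: "Xl (\<lambda>u. 0) w = 0"
  by (induction w) simp_all

lemma Xl_sum: "Xl (\<lambda>u. \<Sum>x\<in>A. f x u) w = (\<Sum>x\<in>A. Xl (f x) w)"
  by (induction A rule: infinite_finite_induct) (simp_all add: Xl_add)

lemma Xl_scale: "Xl (\<lambda>u. sc c * f u) w = sc c * Xl f w"
  by (induction w arbitrary: f) (simp_all add: sum_distrib_left sc_left[of "X _ _"])

lemma Xl_cong_len:
  "(\<And>b. length b = length w \<Longrightarrow> f b = g b) \<Longrightarrow> Xl f w = Xl g w"
proof (induction w arbitrary: f g)
  case (Cons c w)
  show ?case unfolding Xl_Cons
    by (intro sum.cong refl arg_cong[where f = "\<lambda>z. X c _ * z"] Cons.IH) (simp only: Cons.prems list.size)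
qed simp

lemma Xl_snoc: "Xl f (w @ [i]) = Xl (\<lambda>u. \<Sum>m\<in>UNIV. X i m * f (u @ [m])) w"
  by (induction w arbitrary: f) simp_all

text \<open>Interpolates between \<open>k\<close> closing factors \<open>X\<close> on the right (\<open>p = 0\<close>) and \<open>k\<close> factors \<open>X\<close> on the left (\<open>p = k\<close>).\<close>

definition \<Phi> :: "nat \<Rightarrow> nat \<Rightarrow> 'o" where
  "\<Phi> k p = (\<Sum>a\<in>words (k - p). \<Sum>c\<in>words p. sc (prod_list (map dw c)) *
     Xl (\<lambda>m. Xcon (\<lambda>v. Yop (\<lambda>b. sc (AA (a @ c) b)) (v @ m)) a) c)"

text \<open>One factor \<open>X\<close> is moved by \<open>move_X_contract\<close>, and \<open>trace_A\<close> absorbs the transport.\<close>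

lemma \<Phi>_step:
  assumes "p < k"
  shows "\<Phi> k (Suc p) = \<Phi> k p"
proof -
  obtain n where n: "k - p = Suc n" "k - Suc p = n" using assms by (metis Suc_diff_Suc)
  have inner: "(\<Sum>i\<in>UNIV. sc (dw i) * (\<Sum>l\<in>UNIV. X i l * Xcon (\<lambda>v. Yop (\<lambda>b. sc (AA (a @ c @ [i]) b)) (v @ m @ [l])) a))
      = (\<Sum>x\<in>UNIV. Xcon (\<lambda>v. Yop (\<lambda>b. sc (AA (x # a @ c) b)) (v @ m)) (x # a))"
    if "length m = length c" for a c m
  proof -
    define z where "z = (- r) ^ (length a + length m)"
    have z: "z \<noteq> 0" by (simp add: z_def)
    have "sc z * (\<Sum>i\<in>UNIV. sc (dw i) * (\<Sum>l\<in>UNIV. X i l * Xcon (\<lambda>v. Yop (\<lambda>b. sc (AA (a @ c @ [i]) b)) (v @ m @ [l])) a))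
      = (\<Sum>i\<in>UNIV. sc (dw i) * (sc z * Xcon (\<lambda>v. \<Sum>l\<in>UNIV. X i l * Yop (\<lambda>b. sc (AA (a @ c @ [i]) b)) (v @ m @ [l])) a))"
      by (simp only: Xcon_sum Xcon_left sum_distrib_left[of "sc z"] scl_comm[of z])
    also have "\<dots> = (\<Sum>i\<in>UNIV. \<Sum>x\<in>UNIV. sc (dw i) * Xcon (\<lambda>v. Yop (\<lambda>b. sc (tr x (AA (a @ c @ [i])) b i)) (v @ m)) (x # a))"
      unfolding z_def move_X_contract[OF AA_alternating] sum_distrib_left ..
    also have "\<dots> = (\<Sum>x\<in>UNIV. Xcon (\<lambda>v. Yop (\<lambda>b. sc (\<Sum>i\<in>UNIV. dw i * tr x (AA ((a @ c) @ [i])) b i)) (v @ m)) (x # a))"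
      by (subst sum.swap) (simp only: sc_sum sc_mult Yop_sum Yop_scale Xcon_sum Xcon_left append_assoc)
    also have "\<dots> = (\<Sum>x\<in>UNIV. sc z * Xcon (\<lambda>v. Yop (\<lambda>b. sc (AA (x # a @ c) b)) (v @ m)) (x # a))"
      unfolding trace_A sc_mult Yop_scale Xcon_left z_def by (simp add: that)
    finally have "sc (1 / z) * (sc z * (\<Sum>i\<in>UNIV. sc (dw i) * (\<Sum>l\<in>UNIV. X i l * Xcon (\<lambda>v. Yop (\<lambda>b. sc (AA (a @ c @ [i]) b)) (v @ m @ [l])) a)))
       = sc (1 / z) * (sc z * (\<Sum>x\<in>UNIV. Xcon (\<lambda>v. Yop (\<lambda>b. sc (AA (x # a @ c) b)) (v @ m)) (x # a)))"
      by (simp only: sum_distrib_left)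
    then show ?thesis unfolding mult.assoc[symmetric] sc_mult[symmetric] using z by simp
  qed
  have "\<Phi> k (Suc p) = (\<Sum>a\<in>words n. \<Sum>c\<in>words p. \<Sum>i\<in>UNIV. sc (prod_list (map dw (c @ [i]))) *
     Xl (\<lambda>m. Xcon (\<lambda>v. Yop (\<lambda>b. sc (AA (a @ c @ [i]) b)) (v @ m)) a) (c @ [i]))"
    unfolding \<Phi>_def n sum_words_snoc ..
  also have "\<dots> = (\<Sum>a\<in>words n. \<Sum>c\<in>words p. sc (prod_list (map dw c)) *
     Xl (\<lambda>m. \<Sum>i\<in>UNIV. sc (dw i) * (\<Sum>l\<in>UNIV. X i l * Xcon (\<lambda>v. Yop (\<lambda>b. sc (AA (a @ c @ [i]) b)) (v @ m @ [l])) a)) c)"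
    unfolding Xl_snoc Xl_sum Xl_scale sum_distrib_left
    by (intro sum.cong refl) (simp add: sc_mult mult.assoc Xl_scale Xl_sum sum_distrib_left)
  also have "\<dots> = (\<Sum>a\<in>words n. \<Sum>c\<in>words p. sc (prod_list (map dw c)) *
     Xl (\<lambda>m. \<Sum>x\<in>UNIV. Xcon (\<lambda>v. Yop (\<lambda>b. sc (AA (x # a @ c) b)) (v @ m)) (x # a)) c)"
    by (rule sum.cong[OF refl], rule sum.cong[OF refl], rule arg_cong[where f = "\<lambda>z. sc _ * z"], rule Xl_cong_len)
       (rule inner, simp)
  also have "\<dots> = (\<Sum>a\<in>words n. \<Sum>x\<in>UNIV. \<Sum>c\<in>words p. sc (prod_list (map dw c)) *
     Xl (\<lambda>m. Xcon (\<lambda>v. Yop (\<lambda>b. sc (AA (x # a @ c) b)) (v @ m)) (x # a)) c)"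
    unfolding Xl_sum sum_distrib_left by (intro sum.cong refl) (rule sum.swap)
  also have "\<dots> = (\<Sum>x\<in>UNIV. \<Sum>a\<in>words n. \<Sum>c\<in>words p. sc (prod_list (map dw c)) *
     Xl (\<lambda>m. Xcon (\<lambda>v. Yop (\<lambda>b. sc (AA (x # a @ c) b)) (v @ m)) (x # a)) c)"
    by (rule sum.swap)
  also have "\<dots> = \<Phi> k p"
    unfolding \<Phi>_def n sum_words_Suc append_Cons ..
  finally show ?thesis .
qed

lemma \<Phi>_0: "\<Phi> k 0 = sc (qf k) * sm k"
proof -
  have w0: "words 0 = {[]}" by auto
  have t: "Xcon (\<lambda>v. Yop (\<lambda>b. sc (AA a b)) v) a = sc (eps_r a * eps_c a) * Xcon (yy (set a)) (sl (set a))" for a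
  proof -
    have "Xcon (\<lambda>v. Yop (\<lambda>b. sc (AA a b)) v) a = sc (eps_r a) * Xcon (yy (set a)) a"
      by (simp only: AA_def sc_mult Yop_scale Xcon_left yy_def)
    also have "Xcon (yy (set a)) a = sc (eps_c a) * Xcon (yy (set a)) (sl (set a))"
      by (rule alternating_sl[OF vs Xcon_alternating[OF yy_alternating]])
    finally show ?thesis by (simp only: sc_mult mult.assoc)
  qed
  have "\<Phi> k 0 = (\<Sum>a\<in>words k. sc (eps_r a * eps_c a) * Xcon (yy (set a)) (sl (set a)))"
    unfolding \<Phi>_def w0 by (simp add: t)
  also have "\<dots> = (\<Sum>K\<in>{K. card K = k}. \<Sum>a\<in>permutations_of_set K. sc (eps_r a * eps_c a) * Xcon (yy (set a)) (sl (set a)))"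
    by (rule sum_words_distinct) (simp add: eps_c_not_distinct)
  also have "\<dots> = (\<Sum>K\<in>{K. card K = k}. sc (\<Sum>a\<in>permutations_of_set K. eps_r a * eps_c a) * Xcon (yy K) (sl K))"
    unfolding sc_sum sum_distrib_right
    by (intro sum.cong refl) (simp add: permutations_of_set_def)
  also have "\<dots> = sc (qf k) * sm k"
    unfolding perm_sum sm_def sum_distrib_left by (intro sum.cong refl) simp
  finally show ?thesis .
qed

lemma \<Phi>_all: "\<Phi> k k = sc (qf k) * sm k"
proof -
  have "p \<le> k \<Longrightarrow> \<Phi> k p = \<Phi> k 0" for p
    by (induction p) (simp_all add: \<Phi>_step)
  then show ?thesis by (simp add: \<Phi>_0)
qed

lemma \<Phi>_k: "\<Phi> k k = (\<Sum>K\<in>{K. card K = k}. sc (\<Prod>x\<in>K. dw x) *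
    (\<Sum>c\<in>permutations_of_set K. sc (eps_r c) * Xl (yy K) c))"
proof -
  have w0: "words 0 = {[]}" by auto
  have "\<Phi> k k = (\<Sum>c\<in>words k. sc (prod_list (map dw c)) * (sc (eps_r c) * Xl (yy (set c)) c))"
    unfolding \<Phi>_def diff_self_eq_0 w0
    by (simp add: AA_def sc_mult Yop_scale Xl_scale yy_def)
  also have "\<dots> = (\<Sum>K\<in>{K. card K = k}. \<Sum>c\<in>permutations_of_set K. sc (prod_list (map dw c)) * (sc (eps_r c) * Xl (yy (set c)) c))"
    by (rule sum_words_distinct) (simp add: eps_r_not_distinct)
  also have "\<dots> = (\<Sum>K\<in>{K. card K = k}. sc (\<Prod>x\<in>K. dw x) *
    (\<Sum>c\<in>permutations_of_set K. sc (eps_r c) * Xl (yy K) c))"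
    unfolding sum_distrib_left
    by (intro sum.cong refl) (auto simp: permutations_of_set_def prod_list_set)
  finally show ?thesis .
qed

end

section \<open>Powers of the operator that defines \<open>\<sigma>(k)\<close>\<close>

context quantum_pair begin

text \<open>The product of the operators \<open>\<Sigma>R\<close> on the first \<open>n + 1\<close> legs. The value on words that are too short is a default.\<close>

primrec Jop :: "nat \<Rightarrow> ('n list \<Rightarrow> 'o) \<Rightarrow> 'n list \<Rightarrow> 'o" where
  "Jop 0 f w = f w"
| "Jop (Suc n) f w = (case w of a # b # v \<Rightarrow>
      sc (Q b a) * Jop n (\<lambda>u. f (b # u)) (a # v)
      + (if b < a then sc (1 - r) * Jop n (\<lambda>u. f (a # u)) (b # v) else 0)
    | _ \<Rightarrow> f w)"

text \<open>\<open>X\<close> on the first \<open>m\<close> legs only; similarly \<open>YLn\<close>, and \<open>Ysite\<close> for \<open>Y\<close> on leg \<open>m\<close>.\<close>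

primrec XLn :: "nat \<Rightarrow> ('n list \<Rightarrow> 'o) \<Rightarrow> 'n list \<Rightarrow> 'o" where
  "XLn 0 f w = f w"
| "XLn (Suc m) f w = (case w of a # v \<Rightarrow> \<Sum>c\<in>UNIV. X a c * XLn m (\<lambda>u. f (c # u)) v | [] \<Rightarrow> f w)"

primrec YLn :: "nat \<Rightarrow> ('n list \<Rightarrow> 'o) \<Rightarrow> 'n list \<Rightarrow> 'o" where
  "YLn 0 f w = f w"
| "YLn (Suc m) f w = (case w of a # v \<Rightarrow> YLn m (\<lambda>u. \<Sum>x\<in>UNIV. Y a x * f (x # u)) v | [] \<Rightarrow> f w)"

primrec Ysite :: "nat \<Rightarrow> ('n list \<Rightarrow> 'o) \<Rightarrow> 'n list \<Rightarrow> 'o" where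
  "Ysite 0 f w = (case w of a # v \<Rightarrow> \<Sum>x\<in>UNIV. Y a x * f (x # v) | [] \<Rightarrow> f w)"
| "Ysite (Suc m) f w = (case w of a # v \<Rightarrow> Ysite m (\<lambda>u. f (a # u)) v | [] \<Rightarrow> f w)"

lemma Jop_left: "Jop n (\<lambda>u. z * f u) w = z * Jop n f w"
  by (induction n arbitrary: f w) (auto split: list.split simp: distrib_left sc_left[of z])

lemma Jop_add: "Jop n (\<lambda>u. f u + g u) w = Jop n f w + Jop n g w"
  by (induction n arbitrary: f g w) (auto split: list.split simp: distrib_left)

lemma Jop_zero: "Jop n (\<lambda>u. 0) w = 0"
  by (induction n arbitrary: w) (auto split: list.split)

lemma Jop_sum: "Jop n (\<lambda>u. \<Sum>x\<in>A. f x u) w = (\<Sum>x\<in>A. Jop n (f x) w)"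
  by (induction A rule: infinite_finite_induct) (simp_all add: Jop_add Jop_zero)

lemma Jop_cong_len:
  "(\<And>b. length b = length w \<Longrightarrow> f b = g b) \<Longrightarrow> Jop n f w = Jop n g w"
proof (induction n arbitrary: f g w)
  case (Suc n)
  have "Jop n (\<lambda>u. f (b # u)) (a # v) = Jop n (\<lambda>u. g (b # u)) (a # v)" if "w = a # b # v" for a b v
    by (rule Suc.IH) (simp add: Suc.prems that)
  moreover have "Jop n (\<lambda>u. f (a # u)) (b # v) = Jop n (\<lambda>u. g (a # u)) (b # v)" if "w = a # b # v" for a b v
    by (rule Suc.IH) (simp add: Suc.prems that)
  moreover have "f w = g w" by (rule Suc.prems) simp
  ultimately show ?case by (auto split: list.split)
qed simp

lemma XLn_add: "XLn n (\<lambda>u. f u + g u) w = XLn n f w + XLn n g w"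
  by (induction n arbitrary: f g w) (auto split: list.split simp: distrib_left sum.distrib)

lemma XLn_scale: "XLn n (\<lambda>u. sc c * f u) w = sc c * XLn n f w"
  by (induction n arbitrary: f w) (auto split: list.split simp: sum_distrib_left sc_left[of "X _ _"])

lemma XLn_zero [simp]: "XLn n (\<lambda>u. 0) w = 0"
  by (induction n arbitrary: w) (auto split: list.split)

lemma XLn_cong_len:
  "(\<And>b. length b = length w \<Longrightarrow> f b = g b) \<Longrightarrow> XLn n f w = XLn n g w"
proof (induction n arbitrary: f g w)
  case (Suc n)
  have "XLn n (\<lambda>u. f (c # u)) v = XLn n (\<lambda>u. g (c # u)) v" if "w = a # v" for a c v
    by (rule Suc.IH) (simp add: Suc.prems that)
  moreover have "f w = g w" by (rule Suc.prems) simp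
  ultimately show ?case by (auto split: list.split)
qed simp

lemma XLn_split: "XLn (length a) f (a @ w) = Xl (\<lambda>u. f (u @ w)) a"
  by (induction a arbitrary: f) simp_all

lemma YLn_split: "YLn (length a) f (a @ w) = Yop (\<lambda>u. f (u @ w)) a"
  by (induction a arbitrary: f) simp_all

lemma Ysite_split: "Ysite (length a) f (a @ x # w) = (\<Sum>y\<in>UNIV. Y x y * f (a @ y # w))"
  by (induction a arbitrary: f) simp_all

lemma Ysite_YLn: "m < length w \<Longrightarrow> Ysite m (YLn m f) w = YLn (Suc m) f w"
proof -
  assume m: "m < length w"
  define a x v where "a = take m w" and "x = w ! m" and "v = drop (Suc m) w"
  have w: "w = a @ x # v" and la: "length a = m"
    using m by (simp_all add: a_def x_def v_def id_take_nth_drop)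
  have "YLn (Suc m) f w = YLn (length (a @ [x])) f ((a @ [x]) @ v)" using la by (simp add: w)
  also have "\<dots> = (\<Sum>y\<in>UNIV. Y x y * Yop (\<lambda>b. f (b @ y # v)) a)"
    unfolding YLn_split Yop_snoc by simp
  finally show ?thesis
    unfolding w la[symmetric] Ysite_split by (simp add: YLn_split)
qed

text \<open>The relation \<open>Y R X = X R Y\<close> along a row: the factor \<open>Y\<close> passes \<open>m\<close> factors \<open>X\<close> and arrives on the next free leg.\<close>

lemma shift_X:
  "m \<le> length w \<Longrightarrow> (\<Sum>x\<in>UNIV. Y a x * Jop m (XLn m G) (x # w))
    = XLn m (\<lambda>u. Jop m (Ysite m G) (a # u)) w"
proof (induction m arbitrary: G w a)
  case (Suc m)
  then obtain b v where w: "w = b # v" "m \<le> length v" by (cases w) auto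
  define H where "H c u = Jop m (XLn m (\<lambda>z. G (c # z))) u" for c u
  have "Jop (Suc m) (XLn (Suc m) G) (x # b # v)
     = sc (Q b x) * (\<Sum>c\<in>UNIV. X b c * H c (x # v))
      + (if b < x then sc (1 - r) * (\<Sum>c\<in>UNIV. X x c * H c (b # v)) else 0)" for x
    by (simp add: Jop_sum Jop_left H_def)
  then have "(\<Sum>x\<in>UNIV. Y a x * Jop (Suc m) (XLn (Suc m) G) (x # w))
    = (\<Sum>d\<in>UNIV. X b d * (sc (Q d a) * (\<Sum>x\<in>UNIV. Y a x * H d (x # v))
     + (if d < a then sc (1 - r) * (\<Sum>x\<in>UNIV. Y d x * H a (x # v)) else 0)))"
    unfolding w(1) by (simp only: exchange_pointwise)
  also have "\<dots> = (\<Sum>d\<in>UNIV. X b d * XLn m (\<lambda>u. Jop (Suc m) (Ysite (Suc m) G) (a # d # u)) v)"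
    unfolding H_def Suc.IH[OF w(2)]
    by (rule sum.cong[OF refl]) (simp add: XLn_add XLn_scale)
  also have "\<dots> = XLn (Suc m) (\<lambda>u. Jop (Suc m) (Ysite (Suc m) G) (a # u)) w"
    by (simp add: w(1))
  finally show ?case .
qed simp

lemma Jop_append: "length a = Suc n \<Longrightarrow> Jop n f (a @ w) = Jop n (\<lambda>u. f (u @ w)) a"
proof (induction n arbitrary: f a)
  case (Suc n)
  then obtain x y v where a: "a = x # y # v" "length v = n" by (auto simp: length_Suc_conv)
  show ?case using Suc.IH[of "x # v"] Suc.IH[of "y # v"] a by simp
qed simp

lemma Jop_alternating:
  "alternating scl f \<Longrightarrow> n < length w \<Longrightarrow> Jop n f w = sc ((- r) ^ n) * f w"
proof (induction n arbitrary: f w)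
  case (Suc n)
  then obtain a b v where w: "w = a # b # v" "n \<le> length v"
    by (cases w; cases "tl w") auto
  have H: "sc (Q b a) * f (b # a # v) + (if b < a then sc (1 - r) * f (a # b # v) else 0) = sc (- r) * f (a # b # v)"
    using Suc.prems(1)[unfolded alternating_iff_Hecke[OF vs], rule_format, where v = "[]", unfolded append_Nil] .
  have "Jop (Suc n) f w = sc (Q b a) * (sc ((- r) ^ n) * f (b # a # v)) 
      + (if b < a then sc (1 - r) * (sc ((- r) ^ n) * f (a # b # v)) else 0)"
    using Suc.IH[OF alternating_Cons[OF Suc.prems(1)], of "_ # v"] w by simp
  also have "\<dots> = sc ((- r) ^ n) * (sc (Q b a) * f (b # a # v) + (if b < a then sc (1 - r) * f (a # b # v) else 0))"
    by (cases "b < a") (simp_all only: if_True if_False distrib_left scl_comm[of _ "(- r) ^ n"] add_0_right)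
  also have "\<dots> = sc ((- r) ^ Suc n) * f w"
    unfolding H w(1) power_Suc sc_mult mult.assoc by (rule scl_comm)
  finally show ?case .
qed simp

text \<open>On the legs where the function is still alternating each \<open>\<Sigma>R\<close> is the scalar \<open>-r\<close>.\<close>

lemma Jop_trunc:
  "(\<And>a. length a = m \<Longrightarrow> alternating scl (\<lambda>w. f (a @ w))) \<Longrightarrow> m \<le> n \<Longrightarrow> n < length w \<Longrightarrow>
    Jop n f w = sc ((- r) ^ (n - m)) * Jop m f w"
proof (induction m arbitrary: f n w)
  case 0
  then show ?case using Jop_alternating[of f n w] by simp
next
  case (Suc m)
  then obtain n' where n: "n = Suc n'" "m \<le> n'" by (cases n) auto
  with Suc.prems obtain a b v where w: "w = a # b # v" "n' \<le> length v"
    by (cases w; cases "tl w") auto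
  have alt: "alternating scl (\<lambda>w. f (x # a @ w))" if "length a = m" for x a
    using Suc.prems(1)[of "x # a"] that by simp
  have IH: "Jop n' (\<lambda>u. f (x # u)) (y # v) = sc ((- r) ^ (n' - m)) * Jop m (\<lambda>u. f (x # u)) (y # v)" for x y
    by (rule Suc.IH) (use alt n w in auto)
  have "Jop n f w = sc (Q b a) * (sc ((- r) ^ (n' - m)) * Jop m (\<lambda>u. f (b # u)) (a # v)) 
      + (if b < a then sc (1 - r) * (sc ((- r) ^ (n' - m)) * Jop m (\<lambda>u. f (a # u)) (b # v)) else 0)"
    unfolding n(1) w(1) by (simp add: IH)
  also have "\<dots> = sc ((- r) ^ (n' - m)) * (sc (Q b a) * Jop m (\<lambda>u. f (b # u)) (a # v) 
      + (if b < a then sc (1 - r) * Jop m (\<lambda>u. f (a # u)) (b # v) else 0))"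
    by (cases "b < a") (simp_all only: if_True if_False distrib_left scl_comm[of _ "(- r) ^ (n' - m)"] add_0_right)
  finally show ?case unfolding n(1) w(1) by simp
qed

definition U0 :: "'n list \<Rightarrow> 'o" where "U0 w = sc (eps_c w)"

lemma U0_alternating: "alternating scl U0"
  unfolding U0_def by (rule alternating_sc[OF alternating_eps_c])

text \<open>\<open>X\<close> and \<open>Y\<close> applied to the first \<open>m\<close> legs of \<open>u\<close>.\<close>

definition FF :: "nat \<Rightarrow> 'n list \<Rightarrow> 'o" where "FF m = XLn m (YLn m U0)"

lemma Xl_alt: "(\<And>u. alternating scl (h u)) \<Longrightarrow> alternating scl (\<lambda>w. Xl (\<lambda>u. h u w) a)"
proof (induction a arbitrary: h)
  case (Cons a v)
  show ?case unfolding Xl_Cons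
    by (intro alternating_sum[OF vs] alternating_left Cons.IH Cons.prems)
qed simp

lemma Yop_alt: "(\<And>u. alternating scl (h u)) \<Longrightarrow> alternating scl (\<lambda>w. Yop (\<lambda>u. h u w) a)"
proof (induction a arbitrary: h)
  case (Cons a v)
  show ?case unfolding Yop_Cons
    by (rule Cons.IH) (intro alternating_sum[OF vs] alternating_left Cons.prems)
qed simp

lemma FF_split: "FF (length a) (a @ w) = Xl (\<lambda>u. Yop (\<lambda>b. U0 (b @ w)) u) a"
  unfolding FF_def XLn_split by (rule Xl_cong_len) (metis YLn_split)

definition Dop :: "nat \<Rightarrow> ('n list \<Rightarrow> 'o) \<Rightarrow> 'n list \<Rightarrow> 'o" where
  "Dop n f w = (case w of a # v \<Rightarrow> \<Sum>b\<in>UNIV. Zm a b * Jop n f (b # v) | [] \<Rightarrow> f w)"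

lemma Dop_cong_len:
  "(\<And>b. length b = length w \<Longrightarrow> f b = g b) \<Longrightarrow> Dop n f w = Dop n g w"
  unfolding Dop_def by (cases w) (auto intro!: sum.cong arg_cong[where f = "\<lambda>z. Zm _ _ * z"] Jop_cong_len)

lemma Dop_scale: "Dop n (\<lambda>u. sc c * f u) w = sc c * Dop n f w"
  unfolding Dop_def by (cases w) (simp_all add: Jop_left sum_distrib_left sc_left[of "Zm _ _"])

lemma Dop_FF:
  assumes "m \<le> n" "n < length w"
  shows "Dop n (FF m) w = sc ((- r) ^ n) * FF (Suc m) w"
proof -
  obtain a v where w: "w = a # v" and nv: "n \<le> length v" using assms by (cases w) auto
  have alt: "alternating scl (\<lambda>w. FF m (a @ w))" if "length a = m" for a
  proof -
    have "alternating scl (\<lambda>w. Xl (\<lambda>u. Yop (\<lambda>b. U0 (b @ w)) u) a)"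
      by (intro Xl_alt Yop_alt alternating_append U0_alternating)
    then show ?thesis by (simp only: FF_split[of a] that[symmetric])
  qed
  have J: "Jop n (FF m) (b # v) = sc ((- r) ^ (n - m)) * Jop m (FF m) (b # v)" for b
    by (rule Jop_trunc[OF alt assms(1)]) (use assms(2) w in simp_all)
  have Y: "Jop m (Ysite m (YLn m U0)) u = sc ((- r) ^ m) * YLn (Suc m) U0 u" if "m < length u" for u
  proof -
    define c e where "c = take (Suc m) u" and "e = drop (Suc m) u"
    have u: "u = c @ e" and lc: "length c = Suc m" using that by (simp_all add: c_def e_def)
    have "Jop m (Ysite m (YLn m U0)) u = Jop m (YLn (Suc m) U0) u"
      using that by (intro Jop_cong_len Ysite_YLn) simp
    also have "\<dots> = Jop m (\<lambda>b. YLn (Suc m) U0 (b @ e)) c"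
      unfolding u by (rule Jop_append[OF lc])
    also have "\<dots> = Jop m (Yop (\<lambda>b. U0 (b @ e))) c"
      by (rule Jop_cong_len) (metis lc YLn_split)
    also have "\<dots> = sc ((- r) ^ m) * Yop (\<lambda>b. U0 (b @ e)) c"
      by (rule Jop_alternating) (simp_all add: lc Yop_alternating alternating_snoc U0_alternating)
    finally show ?thesis by (metis u lc YLn_split)
  qed
  have "Dop n (FF m) w = (\<Sum>b\<in>UNIV. \<Sum>c\<in>UNIV. X a c * (Y c b * (sc ((- r) ^ (n - m)) * Jop m (FF m) (b # v))))"
    unfolding Dop_def w by (simp add: J Zm_def sum_distrib_right mult.assoc)
  also have "\<dots> = sc ((- r) ^ (n - m)) * (\<Sum>c\<in>UNIV. X a c * (\<Sum>b\<in>UNIV. Y c b * Jop m (FF m) (b # v)))"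
    by (subst sum.swap) (simp add: sum_distrib_left sc_left[of "X _ _"] sc_left[of "Y _ _"])
  also have "\<dots> = sc ((- r) ^ (n - m)) * (\<Sum>c\<in>UNIV. X a c * XLn m (\<lambda>u. Jop m (Ysite m (YLn m U0)) (c # u)) v)"
    unfolding FF_def using nv assms by (simp add: shift_X)
  also have "\<dots> = sc ((- r) ^ (n - m)) * (\<Sum>c\<in>UNIV. X a c * XLn m (\<lambda>u. sc ((- r) ^ m) * YLn (Suc m) U0 (c # u)) v)"
  proof -
    have "XLn m (\<lambda>u. Jop m (Ysite m (YLn m U0)) (c # u)) v = XLn m (\<lambda>u. sc ((- r) ^ m) * YLn (Suc m) U0 (c # u)) v" for c
      by (rule XLn_cong_len, rule Y) (use nv assms in simp)
    then show ?thesis by (simp only:)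
  qed
  also have "\<dots> = sc ((- r) ^ (n - m) * (- r) ^ m) * XLn (Suc m) (YLn (Suc m) U0) w"
    unfolding XLn_scale w by (simp add: sum_distrib_left sc_left[of "X _ _"] sc_mult mult.assoc del: YLn.simps)
  also have "(- r) ^ (n - m) * (- r) ^ m = (- r) ^ n" using assms by (simp flip: power_add)
  finally show ?thesis by (simp only: FF_def)
qed

text \<open>After \<open>m\<close> steps the operators \<open>\<Sigma>R\<close> beyond the first \<open>m\<close> legs only see alternating legs and give scalars. The others
  carry the new \<open>Y\<close> past the \<open>m\<close> old factors \<open>X\<close> by \<open>shift_X\<close>.\<close>

lemma Dop_power:
  assumes "n < length w" "m \<le> Suc n"
  shows "(Dop n ^^ m) U0 w = sc ((- r) ^ (n * m)) * FF m w"
  using assms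
proof (induction m arbitrary: w)
  case 0
  then show ?case by (simp add: FF_def)
next
  case (Suc m)
  have "(Dop n ^^ Suc m) U0 w = Dop n (\<lambda>u. sc ((- r) ^ (n * m)) * FF m u) w"
    unfolding funpow.simps comp_def by (rule Dop_cong_len, rule Suc.IH) (use Suc.prems in auto)
  also have "\<dots> = sc ((- r) ^ (n * m)) * (sc ((- r) ^ n) * FF (Suc m) w)"
    using Suc.prems by (simp only: Dop_scale) (simp add: Dop_FF)
  also have "\<dots> = sc ((- r) ^ (n * Suc m)) * FF (Suc m) w"
    by (simp add: mult.assoc[symmetric] sc_mult[symmetric] power_add mult.commute)
  finally show ?case .
qed

end

context qparam begin

lemma sum_words_append:
  fixes f :: "'n list \<Rightarrow> 'm::comm_monoid_add"
  shows "(\<Sum>w\<in>words (k + n). f w) = (\<Sum>v\<in>words n. \<Sum>a\<in>words k. f (a @ v))"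
proof (induction k arbitrary: f)
  case 0
  have "words 0 = {[]}" by auto
  then show ?case by simp
next
  case (Suc k)
  show ?case
    unfolding add_Suc sum_words_Suc Suc append_Cons by (rule sum.swap)
qed

definition Cc :: "'n set \<Rightarrow> 'f" where "Cc K = (\<Prod>x\<in>K. \<Prod>y\<in>- K. inv_c x y)"
definition Cr' :: "'n set \<Rightarrow> 'f" where "Cr' K = (\<Prod>x\<in>K. \<Prod>y\<in>- K. inv_r x y)"

lemma complement_words:
  fixes v b :: "'n list"
  assumes "distinct v" "length b = k" "CARD('n) = k + length v" "K = - set v"
  shows "distinct (b @ v) \<longleftrightarrow> distinct b \<and> set b = K"
proof -
  have cK: "card K = k" using assms by (simp add: Compl_eq_Diff_UNIV card_Diff_subset distinct_card)
  show ?thesis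
  proof
    assume d: "distinct (b @ v)"
    then have "set b \<subseteq> K" "card (set b) = card K" using assms cK by (auto simp: distinct_card)
    then have "set b = K" by (intro card_subset_eq) auto
    with d show "distinct b \<and> set b = K" by simp
  next
    assume "distinct b \<and> set b = K"
    then show "distinct (b @ v)" using assms by auto
  qed
qed

lemma eps_c_complement:
  assumes "distinct v" "length b = k" "CARD('n) = k + length v" "K = - set v"
  shows "eps_c (b @ v) = eps_c v * Cc K * uv K b"
proof (cases "distinct b \<and> set b = K")
  case True
  then show ?thesis using assms
    by (simp add: eps_c_append uv_def Cc_def prod_list_set)
next
  case False
  then have "eps_c (b @ v) = 0" using complement_words[OF assms] by (simp add: eps_c_not_distinct)
  moreover have "uv K b = 0" using False by (auto simp: uv_def eps_c_not_distinct)
  ultimately show ?thesis by simp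
qed

lemma eps_r_complement:
  assumes "distinct v" "length b = k" "CARD('n) = k + length v" "K = - set v"
  shows "eps_r (b @ v) = (if b \<in> permutations_of_set K then eps_r v * Cr' K * eps_r b else 0)"
proof (cases "distinct b \<and> set b = K")
  case True
  then show ?thesis using assms
    by (simp add: eps_r_append Cr'_def prod_list_set permutations_of_set_def)
next
  case False
  then show ?thesis using complement_words[OF assms]
    by (auto simp add: eps_r_not_distinct permutations_of_set_def)
qed

lemma prod_ranks: "(\<Prod>x\<in>K. r ^ card {y \<in> K. y < x}) = r ^ (\<Sum>i<card K. i)" for K :: "'n set"
proof -
  have "finite K" by simp
  then show ?thesis
  proof (induction K rule: finite_linorder_max_induct)
    case (insert b A)
    have "{k \<in> insert b A. k < c} = {k \<in> A. k < c}" if "c \<in> A" for c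
      using insert.hyps(2) that by (auto dest: less_asym)
    moreover have "{k \<in> insert b A. k < b} = A" using insert.hyps(2) by auto
    moreover have "b \<notin> A" using insert.hyps(2) by blast
    ultimately show ?case using insert by (simp add: power_add mult.commute)
  qed simp
qed

lemma complement_weight:
  assumes "card K = k"
  shows "r ^ (\<Sum>i<k. i) * (Cr' K * Cc K) = (\<Prod>x\<in>K. dw x)"
proof -
  have "Cr' K * Cc K = (\<Prod>x\<in>K. r ^ card {y \<in> - K. y < x})"
    unfolding Cr'_def Cc_def prod.distrib[symmetric] power_card_prod
  proof (intro prod.cong refl)
    fix x y assume "x \<in> K" "y \<in> - K"
    then have "x \<noteq> y" by auto
    then show "inv_r x y * inv_c x y = (if y < x then r else 1)"
      using Q_mult[of x y] by (auto simp: inv_r_def inv_c_def)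
  qed
  moreover have "dw x = r ^ card {y \<in> K. y < x} * r ^ card {y \<in> - K. y < x}" for x
  proof -
    have "card {y. y < x} = card ({y \<in> K. y < x} \<union> {y \<in> - K. y < x})"
      by (intro arg_cong[of _ _ card]) auto
    also have "\<dots> = card {y \<in> K. y < x} + card {y \<in> - K. y < x}"
      by (rule card_Un_disjoint) auto
    finally show ?thesis by (simp add: dw_def power_add)
  qed
  ultimately show ?thesis
    by (simp only: prod.distrib prod_ranks assms)
qed

end

context quantum_pair begin

lemma scl_scl: "sc x * (sc y * z) = sc (x * y) * z"
  by (simp only: sc_mult mult.assoc)

text \<open>Pairing with \<open>v\<close>: the legs beyond the first \<open>k\<close> contribute a factorial by \<open>perm_sum\<close>, and the first \<open>k\<close> legs give
  \<open>\<Phi> k k\<close>.\<close>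

lemma sigma_words:
  assumes "k \<le> CARD('n)"
  shows "sc (r ^ (\<Sum>i<k. i)) * (\<Sum>w\<in>words CARD('n). sc (eps_r w) * FF k w)
    = sc (qf (CARD('n) - k) * qf k) * sm k"
proof -
  define n where "n = CARD('n) - k"
  have N: "CARD('n) = k + n" using assms by (simp add: n_def)
  define P where "P K = (\<Sum>c\<in>permutations_of_set K. sc (eps_r c) * Xl (yy K) c)" for K
  define g where "g v = (\<Sum>a\<in>words k. sc (eps_r (a @ v)) * FF k (a @ v))" for v
  have g0: "g v = 0" if "\<not> distinct v" for v
  proof -
    have "eps_r (a @ v) = 0" for a using that by (intro eps_r_not_distinct) simp
    then show ?thesis by (simp add: g_def)
  qed
  have g1: "g v = sc (eps_r v * eps_c v * (Cr' K * Cc K)) * P K"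
    if v: "distinct v" "length v = n" and K: "K = - set v" for v K
  proof -
    have N': "CARD('n) = k + length v" using N v by simp
    have "FF k (a @ v) = sc (eps_c v * Cc K) * Xl (yy K) a" if "length a = k" for a
    proof -
      have "FF k (a @ v) = Xl (\<lambda>u. Yop (\<lambda>b. U0 (b @ v)) u) a" using FF_split[of a] that by simp
      also have "\<dots> = Xl (\<lambda>u. sc (eps_c v * Cc K) * yy K u) a"
      proof (rule Xl_cong_len)
        fix u :: "'n list" assume u: "length u = length a"
        have "Yop (\<lambda>b. U0 (b @ v)) u = Yop (\<lambda>b. sc (eps_c v * Cc K) * sc (uv K b)) u"
          by (rule Yop_cong_len)
             (simp only: U0_def eps_c_complement[OF v(1) _ N' K] u that sc_mult)
        then show "Yop (\<lambda>b. U0 (b @ v)) u = sc (eps_c v * Cc K) * yy K u"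
          by (simp only: Yop_scale yy_def)
      qed
      finally show ?thesis by (simp only: Xl_scale)
    qed
    then have "g v = (\<Sum>a\<in>words k. if a \<in> permutations_of_set K then
        sc (eps_r v * eps_c v * (Cr' K * Cc K)) * (sc (eps_r a) * Xl (yy K) a) else 0)"
      unfolding g_def
      by (intro sum.cong refl) (simp add: eps_r_complement[OF v(1) _ N' K] scl_scl mult_ac)
    also have "\<dots> = (\<Sum>a\<in>permutations_of_set K. sc (eps_r v * eps_c v * (Cr' K * Cc K)) * (sc (eps_r a) * Xl (yy K) a))"
    proof (rule sum.mono_neutral_cong_right)
      have "card K = k" using N' v K by (simp add: Compl_eq_Diff_UNIV card_Diff_subset distinct_card)
      then show "permutations_of_set K \<subseteq> words k"
        by (auto simp: permutations_of_set_def distinct_card)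
    qed (auto simp: finite_words)
    finally show ?thesis by (simp only: P_def sum_distrib_left)
  qed
  have "(\<Sum>w\<in>words CARD('n). sc (eps_r w) * FF k w) = (\<Sum>v\<in>words n. g v)"
    unfolding N sum_words_append g_def ..
  also have "\<dots> = (\<Sum>K'\<in>{K'. card K' = n}. \<Sum>v\<in>permutations_of_set K'. g v)"
    by (rule sum_words_distinct) (rule g0)
  also have "\<dots> = (\<Sum>K'\<in>{K'. card K' = n}. sc (qf n * (Cr' (- K') * Cc (- K'))) * P (- K'))"
  proof (rule sum.cong[OF refl])
    fix K' :: "'n set" assume K': "K' \<in> {K'. card K' = n}"
    have "(\<Sum>v\<in>permutations_of_set K'. g v)
      = (\<Sum>v\<in>permutations_of_set K'. sc (eps_r v * eps_c v * (Cr' (- K') * Cc (- K'))) * P (- K'))"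
      using K' by (intro sum.cong refl g1) (auto simp: permutations_of_set_def distinct_card)
    also have "\<dots> = sc ((\<Sum>v\<in>permutations_of_set K'. eps_r v * eps_c v) * (Cr' (- K') * Cc (- K'))) * P (- K')"
      by (simp only: sum_distrib_right sc_sum)
    finally show "(\<Sum>v\<in>permutations_of_set K'. g v) = sc (qf n * (Cr' (- K') * Cc (- K'))) * P (- K')"
      using K' by (simp only: perm_sum mem_Collect_eq)
  qed
  also have "\<dots> = (\<Sum>K\<in>{K. card K = k}. sc (qf n * (Cr' K * Cc K)) * P K)"
    by (rule sum.reindex_bij_witness[where i = uminus and j = uminus])
       (auto simp: Compl_eq_Diff_UNIV card_Diff_subset N)
  finally have "sc (r ^ (\<Sum>i<k. i)) * (\<Sum>w\<in>words CARD('n). sc (eps_r w) * FF k w)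
    = (\<Sum>K\<in>{K. card K = k}. sc (qf n) * (sc (r ^ (\<Sum>i<k. i) * (Cr' K * Cc K)) * P K))"
    by (simp add: sum_distrib_left scl_scl mult.left_commute)
  also have "\<dots> = sc (qf n) * \<Phi> k k"
    unfolding \<Phi>_k sum_distrib_left[symmetric] P_def[symmetric]
    by (intro arg_cong[where f = "\<lambda>z. sc _ * z"] sum.cong refl) (simp add: complement_weight)
  finally show ?thesis unfolding \<Phi>_all n_def by (simp add: sc_mult mult.assoc)
qed

end

section \<open>Adjugate matrices in terms of minors\<close>

context quantum_pair begin

text \<open>The coefficients of \<open>Yop\<close> and, for \<open>xw\<close>, of \<open>Xcon\<close>. For permutations these are the words in the minors.\<close>

primrec yw :: "'n list \<Rightarrow> 'n list \<Rightarrow> 'o" where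
  "yw [] b = 1"
| "yw (c # v) b = yw v (tl b) * Y c (hd b)"

primrec xw :: "'n list \<Rightarrow> 'n list \<Rightarrow> 'o" where
  "xw [] b = 1"
| "xw (a # v) b = X a (hd b) * xw v (tl b)"

lemma Yop_words: "Yop f c = (\<Sum>b\<in>words (length c). yw c b * f b)"
proof (induction c arbitrary: f)
  case Nil
  have "words 0 = {[]}" by auto
  then show ?case by simp
next
  case (Cons c v)
  have "Yop f (c # v) = (\<Sum>b\<in>words (length v). \<Sum>x\<in>UNIV. yw v b * (Y c x * f (x # b)))"
    by (simp add: Cons sum_distrib_left)
  also have "\<dots> = (\<Sum>b\<in>words (length (c # v)). yw (c # v) b * f b)"
    unfolding list.size One_nat_def add_Suc_right add_0_right sum_words_Suc by (subst sum.swap) (simp add: mult.assoc)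
  finally show ?case .
qed

lemma Xcon_words: "Xcon f a = (\<Sum>c\<in>words (length a). sc (prod_list (map wt c)) * (f c * xw a c))"
proof (induction a arbitrary: f)
  case Nil
  have "words 0 = {[]}" by auto
  then show ?case by simp
next
  case (Cons a v)
  have "Xcon f (a # v) = (\<Sum>c\<in>words (length v). \<Sum>x\<in>UNIV. sc (prod_list (map wt c)) * (sc (wt x) * (f (x # c) * X a x) * xw v c))"
    by (simp add: Cons sum_distrib_left sum_distrib_right)
  also have "\<dots> = (\<Sum>c\<in>words (length (a # v)). sc (prod_list (map wt c)) * (f c * xw (a # v) c))"
    unfolding list.size One_nat_def add_Suc_right add_0_right sum_words_Suc
    by (subst sum.swap) (simp add: mult.assoc scl_scl mult.commute)
  finally show ?case .
qed

text \<open>Transposed action of \<open>Y\<close>, needed to see that the quantum minor is also alternating in its other argument.\<close>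

primrec YR :: "('n list \<Rightarrow> 'o) \<Rightarrow> 'n list \<Rightarrow> 'o" where
  "YR f [] = f []"
| "YR f (b # w) = (\<Sum>c\<in>UNIV. YR (\<lambda>u. f (c # u)) w * Y c b)"

lemma YR_add: "YR (\<lambda>u. f u + g u) w = YR f w + YR g w"
  by (induction w arbitrary: f g) (simp_all add: distrib_right sum.distrib)

lemma YR_zero [simp]: "YR (\<lambda>u. 0) w = 0"
  by (induction w) simp_all

lemma YR_scale: "YR (\<lambda>u. sc c * f u) w = sc c * YR f w"
  by (induction w arbitrary: f) (simp_all add: sum_distrib_left mult.assoc)

lemma YR_words: "YR f b = (\<Sum>c\<in>words (length b). f c * yw c b)"
proof (induction b arbitrary: f)
  case Nil
  have "words 0 = {[]}" by auto
  then show ?case by simp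
next
  case (Cons b v)
  show ?case
    unfolding list.size One_nat_def add_Suc_right add_0_right sum_words_Suc
    by (simp add: Cons sum_distrib_right mult.assoc)
qed

text \<open>Transposing \<open>Q\<close> exchanges the roles of rows and columns, that is, of \<open>eps_c\<close> and \<open>eps_r\<close>.\<close>

lemma dual: "qparam r (\<lambda>a b. Q b a)"
  by unfold_locales (simp_all add: Q_mult qnum_nz)

interpretation dual: qparam r "\<lambda>a b. Q b a" by (rule dual)

lemma dual_inv_c: "dual.inv_c = inv_r"
  by (intro ext) (simp add: dual.inv_c_def inv_r_def)

lemma dual_eps_c: "dual.eps_c w = eps_r w"
  by (induction w) (simp_all add: dual_inv_c)

lemma YR_alternating:
  assumes "dual.alternating scl f"
  shows "dual.alternating scl (YR f)"
  unfolding dual.alternating_iff_Hecke[OF vs]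
proof (intro allI)
  fix v w and a b :: 'n
  show "sc (Q a b) * YR f (v @ b # a # w) + (if b < a then sc (1 - r) * YR f (v @ a # b # w) else 0)
      = sc (- r) * YR f (v @ a # b # w)"
    using assms
  proof (induction v arbitrary: f)
    case Nil
    define g where "g x y = YR (\<lambda>u. f (x # y # u)) w" for x y
    have g: "sc (Q x y) * g y x + (if y < x then sc (1 - r) * g x y else 0) = sc (- r) * g x y" for x y
    proof -
      have "sc (- r) * g x y = YR (\<lambda>u. sc (Q x y) * f (y # x # u) + (if y < x then sc (1 - r) * f (x # y # u) else 0)) w"
        unfolding g_def YR_scale[symmetric]
        using Nil[unfolded dual.alternating_iff_Hecke[OF vs], rule_format, where v = "[]" and a = x and b = y, unfolded append_Nil]
        by (simp only:)
      then show ?thesis by (cases "y < x") (simp_all add: YR_add YR_scale g_def)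
    qed
    have YR2: "YR f (a # b # w) = (\<Sum>x\<in>UNIV. \<Sum>y\<in>UNIV. g x y * (Y y b * Y x a))" for a b
      by (simp add: g_def sum_distrib_right mult.assoc)
    have "sc (Q a b) * YR f (b # a # w) + (if b < a then sc (1 - r) * YR f (a # b # w) else 0)
      = (\<Sum>x\<in>UNIV. \<Sum>y\<in>UNIV. g x y * (sc (Q a b) * (Y y a * Y x b) + (if b < a then sc (1 - r) * (Y y b * Y x a) else 0)))"
      unfolding YR2 by (simp add: sum_distrib_left sc_left[of "g _ _"] sum.distrib distrib_left)
    also have "\<dots> = (\<Sum>x\<in>UNIV. \<Sum>y\<in>UNIV. g x y * (sc (Q y x) * (Y x b * Y y a) + (if y < x then sc (1 - r) * (Y y b * Y x a) else 0)))"
      by (simp only: YY[of _ _ b a])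
    also have "\<dots> = (\<Sum>x\<in>UNIV. \<Sum>y\<in>UNIV. g x y * (sc (Q y x) * (Y x b * Y y a)))
       + (\<Sum>x\<in>UNIV. \<Sum>y\<in>UNIV. g x y * (if y < x then sc (1 - r) * (Y y b * Y x a) else 0))"
      by (simp add: distrib_left sum.distrib)
    also have "(\<Sum>x\<in>UNIV. \<Sum>y\<in>UNIV. g x y * (sc (Q y x) * (Y x b * Y y a)))
       = (\<Sum>x\<in>UNIV. \<Sum>y\<in>UNIV. g y x * (sc (Q x y) * (Y y b * Y x a)))"
      by (rule sum.swap)
    also have "\<dots> + (\<Sum>x\<in>UNIV. \<Sum>y\<in>UNIV. g x y * (if y < x then sc (1 - r) * (Y y b * Y x a) else 0))
       = (\<Sum>x\<in>UNIV. \<Sum>y\<in>UNIV. (sc (Q x y) * g y x + (if y < x then sc (1 - r) * g x y else 0)) * (Y y b * Y x a))"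
      unfolding sum.distrib[symmetric]
      by (intro sum.cong refl) (simp add: distrib_right mult.assoc sc_left[of "g _ _"])
    also have "\<dots> = sc (- r) * YR f (a # b # w)"
      unfolding YR2 g by (simp only: sum_distrib_left mult.assoc)
    finally show ?case unfolding append_Nil .
  next
    case (Cons c v)
    have IH: "sc (Q a b) * YR (\<lambda>u. f (x # u)) (v @ b # a # w) + (if b < a then sc (1 - r) * YR (\<lambda>u. f (x # u)) (v @ a # b # w) else 0)
      = sc (- r) * YR (\<lambda>u. f (x # u)) (v @ a # b # w)" for x
      by (rule Cons.IH[OF dual.alternating_Cons[OF Cons.prems]])
    have "sc (Q a b) * YR f ((c # v) @ b # a # w) + (if b < a then sc (1 - r) * YR f ((c # v) @ a # b # w) else 0)
      = (\<Sum>x\<in>UNIV. (sc (Q a b) * YR (\<lambda>u. f (x # u)) (v @ b # a # w) + (if b < a then sc (1 - r) * YR (\<lambda>u. f (x # u)) (v @ a # b # w) else 0)) * Y x c)"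
      by (simp add: sum_distrib_left mult.assoc sum.distrib distrib_right)
    also have "\<dots> = sc (- r) * YR f ((c # v) @ a # b # w)"
      unfolding IH by (simp only: append_Cons YR.simps sum_distrib_left mult.assoc)
    finally show ?case .
  qed
qed

definition Ymin :: "'n set \<Rightarrow> 'n set \<Rightarrow> 'o" where
  "Ymin L K = (\<Sum>c\<in>permutations_of_set L. sc (eps_r c) * yw c (sl K))"

lemma sum_words_perm:
  fixes f :: "'n list \<Rightarrow> 'm::comm_monoid_add"
  assumes "card K = k" "\<And>w. w \<notin> permutations_of_set K \<Longrightarrow> f w = 0"
  shows "(\<Sum>w\<in>words k. f w) = (\<Sum>w\<in>permutations_of_set K. f w)"
proof (rule sum.mono_neutral_right)
  show "permutations_of_set K \<subseteq> words k" using assms(1) by (auto simp: permutations_of_set_def distinct_card)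
qed (auto simp: finite_words assms(2))

lemma yy_sl:
  assumes "card L = card K"
  shows "yy K (sl L) = Ymin L K"
proof -
  define k where "k = card K"
  define vv where "vv c = sc (if set c = L then eps_r c else 0)" for c :: "'n list"
  have uv_perm: "b \<notin> permutations_of_set K \<Longrightarrow> uv K b = 0" for b
    by (auto simp: uv_def permutations_of_set_def eps_c_not_distinct)
  have vv_perm: "c \<notin> permutations_of_set L \<Longrightarrow> vv c = 0" for c
    by (auto simp: vv_def permutations_of_set_def eps_r_not_distinct)
  have vv_alt: "dual.alternating scl vv"
  proof -
    have vv_uv: "vv c = sc (dual.uv L c)" for c
      by (simp add: vv_def dual.uv_def dual_eps_c)
    show ?thesis
    proof (rule dual.alternatingI)
      show "vv (v @ b # a # w) = sc (- Q b a) * vv (v @ a # b # w)" if "a < b" for v w a b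
        unfolding vv_uv dual.alternatingD(1)[OF dual.uv_alternating that] by (rule sc_mult)
      show "vv (v @ a # a # w) = 0" for v w a
        unfolding vv_uv dual.alternatingD(2)[OF dual.uv_alternating] by (rule sc_0)
    qed
  qed
  have Zs: "YR vv b = sc (eps_r b) * Ymin L K" if "b \<in> permutations_of_set K" for b
  proof -
    have "YR vv b = sc (dual.eps_c b) * YR vv (sl (set b))"
      by (rule dual.alternating_sl[OF vs YR_alternating[OF vv_alt]])
    also have "set b = K" using that by (simp add: permutations_of_set_def)
    also have "YR vv (sl K) = (\<Sum>c\<in>permutations_of_set L. vv c * yw c (sl K))"
      unfolding YR_words by (rule sum_words_perm) (simp_all add: assms vv_perm)
    also have "\<dots> = Ymin L K" unfolding Ymin_def vv_def
      by (intro sum.cong refl) (simp add: permutations_of_set_def)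
    finally show ?thesis by (simp only: dual_eps_c)
  qed
  have ys: "yy K c = sc (eps_c c) * yy K (sl L)" if "c \<in> permutations_of_set L" for c
    using alternating_sl[OF vs yy_alternating, of K c] that by (simp add: permutations_of_set_def)
  have "(\<Sum>c\<in>words k. vv c * yy K c) = (\<Sum>c\<in>permutations_of_set L. vv c * yy K c)"
    by (rule sum_words_perm) (simp_all add: k_def assms vv_perm)
  also have "\<dots> = (\<Sum>c\<in>permutations_of_set L. sc (eps_r c * eps_c c) * yy K (sl L))"
  proof (rule sum.cong[OF refl])
    fix c assume c: "c \<in> permutations_of_set L"
    show "vv c * yy K c = sc (eps_r c * eps_c c) * yy K (sl L)"
      unfolding ys[OF c] using c by (simp add: scl_scl vv_def permutations_of_set_def)
  qed
  also have "\<dots> = sc (qf k) * yy K (sl L)"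
    unfolding sum_distrib_right[symmetric] sc_sum[symmetric] perm_sum assms k_def ..
  finally have 1: "(\<Sum>c\<in>words k. vv c * yy K c) = sc (qf k) * yy K (sl L)" .
  have "(\<Sum>c\<in>words k. vv c * yy K c) = (\<Sum>c\<in>words k. \<Sum>b\<in>words k. vv c * (yw c b * sc (uv K b)))"
    unfolding yy_def by (intro sum.cong refl) (simp add: Yop_words sum_distrib_left)
  also have "\<dots> = (\<Sum>b\<in>words k. \<Sum>c\<in>words k. vv c * (yw c b * sc (uv K b)))"
    by (rule sum.swap)
  also have "\<dots> = (\<Sum>b\<in>words k. sc (uv K b) * YR vv b)"
    by (intro sum.cong refl) (simp add: YR_words sum_distrib_left sc_comm[of "yw _ _"] sc_left[of "vv _"])
  also have "\<dots> = (\<Sum>b\<in>permutations_of_set K. sc (uv K b) * YR vv b)"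
    by (rule sum_words_perm) (simp_all add: k_def uv_perm)
  also have "\<dots> = (\<Sum>b\<in>permutations_of_set K. sc (eps_r b * eps_c b) * Ymin L K)"
    by (intro sum.cong refl) (simp add: Zs scl_scl uv_def permutations_of_set_def mult.commute)
  also have "\<dots> = sc (qf k) * Ymin L K"
    unfolding sum_distrib_right[symmetric] sc_sum[symmetric] perm_sum k_def ..
  finally have "sc (1 / qf k) * (sc (qf k) * yy K (sl L)) = sc (1 / qf k) * (sc (qf k) * Ymin L K)"
    unfolding 1 by (rule arg_cong)
  then show ?thesis unfolding scl_scl using qf_nz[of k] by simp
qed

definition Xmin :: "'n set \<Rightarrow> 'n set \<Rightarrow> 'o" where
  "Xmin J L = (\<Sum>c\<in>permutations_of_set L. sc (eps_c c) * xw (sl J) c)"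

lemma Xcon_yy:
  assumes "card J = card K"
  shows "Xcon (yy K) (sl J) = (\<Sum>L\<in>{L. card L = card K}. sc (\<Prod>l\<in>L. wt l) * (Ymin L K * Xmin J L))"
proof -
  have "Xcon (yy K) (sl J) = (\<Sum>c\<in>words (card K). sc (prod_list (map wt c)) * (yy K c * xw (sl J) c))"
    unfolding Xcon_words by (simp add: assms)
  also have "\<dots> = (\<Sum>L\<in>{L. card L = card K}. \<Sum>c\<in>permutations_of_set L. sc (prod_list (map wt c)) * (yy K c * xw (sl J) c))"
    by (rule sum_words_distinct) (simp add: alternating_vanish[OF vs yy_alternating])
  also have "\<dots> = (\<Sum>L\<in>{L. card L = card K}. sc (\<Prod>l\<in>L. wt l) * (Ymin L K * Xmin J L))"
  proof (rule sum.cong[OF refl])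
    fix L :: "'n set" assume "L \<in> {L. card L = card K}"
    then have L: "card L = card K" by simp
    have "sc (prod_list (map wt c)) * (yy K c * xw (sl J) c) = sc (\<Prod>l\<in>L. wt l) * (Ymin L K * (sc (eps_c c) * xw (sl J) c))"
      if "c \<in> permutations_of_set L" for c
      using alternating_sl[OF vs yy_alternating, of K c] that
      by (simp add: permutations_of_set_def prod_list_set yy_sl[OF L] mult.assoc sc_left[of "Ymin _ _"])
    then show "(\<Sum>c\<in>permutations_of_set L. sc (prod_list (map wt c)) * (yy K c * xw (sl J) c))
        = sc (\<Prod>l\<in>L. wt l) * (Ymin L K * Xmin J L)"
      by (simp add: Xmin_def sum_distrib_left)
  qed
  finally show ?thesis .
qed

text \<open>Cauchy-Binet: the functions closed in \<open>Am_alt\<close> are alternating in the closed letters, so the sum over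
  words in these letters reduces to a sum over sets \<open>L\<close>, and each summand factors into two minors.\<close>

lemma Am_minors:
  "Am k i j = (\<Sum>K\<in>{K. card K = k \<and> i \<in> K \<and> j \<in> K}. sc (Gr j K * Cl (K - {i}) i) *
     (\<Sum>L\<in>{L. card L = k - 1}. sc (\<Prod>l\<in>L. wt l) * (Ymin L (K - {i}) * Xmin (K - {j}) L)))"
  unfolding Am_alt by (intro sum.cong refl) (simp add: Xcon_yy)

text \<open>\<open>\<Sigma>R\<close> on the legs \<open>j\<close> and \<open>j + 1\<close>, counted from \<open>0\<close>.\<close>

definition Sg :: "nat \<Rightarrow> ('n list \<Rightarrow> 'o) \<Rightarrow> 'n list \<Rightarrow> 'o" where
  "Sg j g w = sc (Q (w ! Suc j) (w ! j)) * g (w[j := w ! Suc j, Suc j := w ! j])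
     + (if w ! Suc j < w ! j then sc (1 - r) * g w else 0)"

lemma Sg_Suc: "Sg (Suc j) g (x # u) = Sg j (\<lambda>u. g (x # u)) u"
  by (simp add: Sg_def)

lemma foldr_Sg_Suc: "foldr Sg (map Suc ns) f (x # u) = foldr Sg ns (\<lambda>u. f (x # u)) u"
proof (induction ns arbitrary: u)
  case (Cons n ns)
  show ?case by (simp add: Sg_Suc Cons)
qed simp

lemma foldr_Sg: "n < length w \<Longrightarrow> foldr Sg [0..<n] f w = Jop n f w"
proof (induction n arbitrary: f w)
  case (Suc n)
  then obtain a b v where w: "w = a # b # v" "n \<le> length v"
    by (cases w; cases "tl w") auto
  have "[0..<Suc n] = 0 # map Suc [0..<n]" by (simp only: map_Suc_upt upt_conv_Cons zero_less_Suc)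
  then show ?case
    using w by (simp add: Sg_def[of 0] foldr_Sg_Suc Suc.IH del: upt_Suc)
qed simp

end

section \<open>The algebra \<open>\<O>\<close> as an instance\<close>

lemma q_power: "q ^ k = Fract (Poly_Mapping.single (Poly_Mapping.single ind_q (int k)) 1) 1"
proof (induction k)
  case 0
  show ?case by (simp add: One_fract_def)
next
  case (Suc k)
  then show ?case
    by (simp add: q_def indet_F_def mult_single flip: single_add)
qed

lemma q_nz: "q \<noteq> 0"
  by (simp add: q_def)

text \<open>A sum of distinct monomials is nonzero: its constant term is \<open>1\<close>.\<close>

lemma q2_sum_nz:
  assumes "n > 0"
  shows "(\<Sum>k<n. (q ^ 2) ^ k) \<noteq> (0 :: 'n::linorder rat_fun)"
proof -
  let ?m = "\<lambda>k. Poly_Mapping.single (ind_q :: 'n indet) (int (2 * k))"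
  have sumF: "(\<Sum>k\<in>A. Fract (p k) 1) = Fract (\<Sum>k\<in>A. p k) 1" for A :: "nat set" and p :: "nat \<Rightarrow> 'n laurent"
    by (induction A rule: infinite_finite_induct) (simp_all add: Zero_fract_def)
  have "(\<Sum>k<n. (q ^ 2) ^ k :: 'n rat_fun) = Fract (\<Sum>k<n. Poly_Mapping.single (?m k) 1) 1"
  proof -
    have "(q ^ 2) ^ k = Fract (Poly_Mapping.single (?m k) 1) 1" for k
      unfolding power_mult[symmetric] by (rule q_power)
    then show ?thesis by (simp only: sumF)
  qed
  moreover have "Poly_Mapping.lookup (\<Sum>k<n. Poly_Mapping.single (?m k) (1 :: complex)) 0 = 1"
  proof -
    have "?m k = 0 \<longleftrightarrow> k = 0" for k
      by (metis lookup_single_eq lookup_zero mult_is_0 of_nat_eq_0_iff single_zero zero_neq_numeral)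
    then have "Poly_Mapping.lookup (\<Sum>k<n. Poly_Mapping.single (?m k) (1 :: complex)) 0 = (\<Sum>k<n. if k = 0 then 1 else 0)"
      unfolding lookup_sum by (intro sum.cong refl) (auto simp: lookup_single when_def)
    then show ?thesis using assms by simp
  qed
  then have "(\<Sum>k<n. Poly_Mapping.single (?m k) (1 :: complex)) \<noteq> 0"
    by (metis lookup_zero zero_neq_one)
  ultimately show ?thesis unfolding Zero_fract_def by (simp add: eq_fract)
qed

lemma qij_diag: "qij i i = 1"
  by (simp add: qij_def)

lemma qij_mult: "i \<noteq> j \<Longrightarrow> qij i j * qij j i = q ^ 2"
  by (auto simp: qij_def)

lemma to_O_0: "to_O 0 = 0" by (simp add: to_O.abs_eq zero_OqQ_def)
lemma to_O_1: "to_O 1 = 1" by (simp add: to_O.abs_eq one_OqQ_def)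
lemma to_O_add: "to_O (x + y) = to_O x + to_O y" by (simp add: to_O.abs_eq plus_OqQ.abs_eq)
lemma to_O_diff: "to_O (x - y) = to_O x - to_O y" by (simp add: to_O.abs_eq minus_OqQ.abs_eq)
lemma to_O_mult: "to_O (x * y) = to_O x * to_O y" by (simp add: to_O.abs_eq times_OqQ.abs_eq)

lemma to_O_sum: "to_O (sum f A) = (\<Sum>a\<in>A. to_O (f a))"
  by (rule additive_sum) (simp_all add: to_O_0 to_O_add)

lemma to_O_surj: obtains f where "x = to_O f"
  by (metis Quotient3_OqQ Quotient3_abs_rep to_O.abs_eq that)

lemma to_O_relator: "x \<in> relators \<Longrightarrow> to_O x = 0"
  by (simp add: to_O.abs_eq zero_OqQ_def OqQ.abs_eq_iff ideal_cong_def ideal_of_base)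

lemma scal_0: "scal 0 = 0" and scal_1: "scal 1 = 1"
  and scal_add: "scal (x + y) = scal x + scal y" and scal_mult: "scal (x * y) = scal x * scal y"
  by (simp_all add: scal_def single_add mult_single)

lemma scal_central: "z * scal x = scal x * z"
proof -
  have "(\<Sum>k\<in>Poly_Mapping.keys z. Poly_Mapping.single k (Poly_Mapping.lookup z k)) * scal x
      = scal x * (\<Sum>k\<in>Poly_Mapping.keys z. Poly_Mapping.single k (Poly_Mapping.lookup z k))"
    unfolding sum_distrib_left sum_distrib_right
    by (simp add: scal_def mult_single mult.commute)
  then show ?thesis using poly_mapping_sum_single[of z] by simp
qed

lemma sum_UNIV_prod: "(\<Sum>s\<in>UNIV. f s) = (\<Sum>a\<in>UNIV. \<Sum>b\<in>UNIV. f (a, b))"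
  by (simp add: sum.cartesian_product flip: UNIV_Times_UNIV)

lemma scal_mat_mult: "(mat c ** A) $ s $ t = c * A $ s $ t" for A :: "('a::comm_semiring_1, 'm::finite) sqmat"
  by (simp add: matrix_matrix_mult_def mat_def if_distrib[of "\<lambda>x. x * _"] cong: if_cong)

lemma sum_if_const: "(\<Sum>x\<in>A. if P then f x else 0) = (if P then sum f A else 0)"
  by simp

text \<open>All identities between matrices of size \<open>N^2\<close> are reduced to entries.\<close>

lemma Rmat_entry:
  "Rmat $ (a, b) $ (c, d) = (if a = c \<and> b = d then qij a b else 0) + (if a < b \<and> a = d \<and> b = c then 1 - q ^ 2 else 0)"
proof -
  have "(\<Sum>i\<in>UNIV. \<Sum>j\<in>UNIV. mat (qij i j) ** kron (munit i i) (munit j j)) $ (a, b) $ (c, d)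
     = (\<Sum>i\<in>UNIV. \<Sum>j\<in>UNIV. if i = a then (if j = b then (if a = c \<and> b = d then qij a b else 0) else 0) else 0)"
    unfolding sum_component scal_mat_mult by (intro sum.cong refl) (auto simp: kron_def munit_def)
  also have "\<dots> = (if a = c \<and> b = d then qij a b else 0)"
    unfolding sum_if_const by simp
  finally have 1: "(\<Sum>i\<in>UNIV. \<Sum>j\<in>UNIV. mat (qij i j) ** kron (munit i i) (munit j j)) $ (a, b) $ (c, d)
     = (if a = c \<and> b = d then qij a b else 0)" .
  have "(\<Sum>(i, j)\<in>{(i, j). i < j}. kron (munit i j) (munit j i)) $ (a, b) $ (c, d)
     = (\<Sum>p\<in>{(i, j). i < j}. if p = (a, b) then (if a = d \<and> b = c then 1 else 0) else (0 :: 'a rat_fun))"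
    unfolding sum_component by (intro sum.cong refl) (auto simp: kron_def munit_def split: if_splits)
  also have "\<dots> = (if a < b \<and> a = d \<and> b = c then 1 else 0)"
    by (simp add: sum.delta')
  finally have 2: "(\<Sum>(i, j)\<in>{(i, j). i < j}. kron (munit i j) (munit j i)) $ (a, b) $ (c, d)
     = (if a < b \<and> a = d \<and> b = c then 1 else (0 :: 'a rat_fun))" .
  show ?thesis
    unfolding Rmat_def vector_add_component scal_mat_mult 1 2 by (cases "a < b \<and> a = d \<and> b = c") auto
qed

lemma R12_entry:
  "map_matrix scal Rmat $ (a, b) $ (c, d)
    = (if c = a then if d = b then scal (qij a b) else 0 else 0)
      + (if d = a then if c = b then if a < b then scal (1 - q ^ 2) else 0 else 0 else 0)"
  by (auto simp: Rmat_entry scal_0 scal_add)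

lemma mult_kron_left_entry:
  "(A ** kron M (mat 1)) $ s $ (c, d) = (\<Sum>t\<in>UNIV. A $ s $ (t, d) * M $ t $ c)"
  by (simp add: matrix_matrix_mult_def sum_UNIV_prod kron_def mat_def if_distrib[of "\<lambda>x. _ * x"] cong: if_cong)

lemma mult_kron_right_entry:
  "(A ** kron (mat 1) M) $ s $ (c, d) = (\<Sum>t\<in>UNIV. A $ s $ (c, t) * M $ t $ d)"
  by (simp add: matrix_matrix_mult_def sum_UNIV_prod kron_def mat_def if_distrib[of "\<lambda>x. x * _"]
      if_distrib[of "\<lambda>x. _ * x"] cong: if_cong)
     (subst sum.swap, simp)

lemma kron_left_mult_entry:
  "(kron M (mat 1) ** A) $ (a, b) $ s = (\<Sum>t\<in>UNIV. M $ a $ t * A $ (t, b) $ s)"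
  by (simp add: matrix_matrix_mult_def sum_UNIV_prod kron_def mat_def if_distrib[of "\<lambda>x. x * _"]
      if_distrib[of "\<lambda>x. _ * x"] cong: if_cong)

lemma kron_right_mult_entry:
  "(kron (mat 1) M ** A) $ (a, b) $ s = (\<Sum>t\<in>UNIV. M $ b $ t * A $ (a, t) $ s)"
  by (simp add: matrix_matrix_mult_def sum_UNIV_prod kron_def mat_def if_distrib[of "\<lambda>x. x * _"]
      if_distrib[of "\<lambda>x. _ * x"] cong: if_cong)
     (subst sum.swap, simp)

lemma RMM_entry:
  "(map_matrix scal Rmat ** kron M (mat 1) ** kron (mat 1) M') $ (a, b) $ (c, d)
   = scal (qij a b) * (M $ a $ c * M' $ b $ d) + (if a < b then scal (1 - q ^ 2) * (M $ b $ c * M' $ a $ d) else 0)"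
  unfolding mult_kron_right_entry mult_kron_left_entry R12_entry
  by (simp add: distrib_right sum.distrib if_distrib[of "\<lambda>x. x * _"] sum_if_const mult.assoc cong: if_cong)

lemma RMM'_entry:
  "(map_matrix scal Rmat ** kron (mat 1) M' ** kron M (mat 1)) $ (a, b) $ (c, d)
   = scal (qij a b) * (M' $ b $ d * M $ a $ c) + (if a < b then scal (1 - q ^ 2) * (M' $ a $ d * M $ b $ c) else 0)"
  unfolding mult_kron_right_entry mult_kron_left_entry R12_entry
  by (simp add: distrib_right sum.distrib if_distrib[of "\<lambda>x. x * _"] sum_if_const mult.assoc cong: if_cong)

lemma MMR_entry:
  "(kron (mat 1) M' ** kron M (mat 1) ** map_matrix scal Rmat) $ (a, b) $ (c, d)
   = scal (qij c d) * (M' $ b $ d * M $ a $ c) + (if d < c then scal (1 - q ^ 2) * (M' $ b $ c * M $ a $ d) else 0)"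
  unfolding matrix_mul_assoc[symmetric] kron_right_mult_entry kron_left_mult_entry R12_entry
  by (simp add: distrib_left sum.distrib if_distrib[of "\<lambda>x. _ * x"] scal_central[of "M $ _ $ _"]
      scal_central[of "M' $ _ $ _"] sum_if_const mult.assoc[symmetric] cong: if_cong)

lemma MMR'_entry:
  "(kron M (mat 1) ** kron (mat 1) M' ** map_matrix scal Rmat) $ (a, b) $ (c, d)
   = scal (qij c d) * (M $ a $ c * M' $ b $ d) + (if d < c then scal (1 - q ^ 2) * (M $ a $ d * M' $ b $ c) else 0)"
  unfolding matrix_mul_assoc[symmetric] kron_right_mult_entry kron_left_mult_entry R12_entry
  by (simp add: distrib_left sum.distrib if_distrib[of "\<lambda>x. _ * x"] scal_central[of "M $ _ $ _"]
      scal_central[of "M' $ _ $ _"] sum_if_const mult.assoc[symmetric] cong: if_cong)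

lemma MRM_entry:
  "(kron M (mat 1) ** map_matrix scal Rmat ** kron (mat 1) M') $ (a, b) $ (c, d)
   = scal (qij c b) * (M $ a $ c * M' $ b $ d) + (if b = c then scal (1 - q ^ 2) * (\<Sum>k\<in>{k. k < b}. M $ a $ k * M' $ k $ d) else 0)"
  unfolding kron_left_mult_entry mult_kron_right_entry R12_entry
  by (simp add: distrib_left distrib_right sum.distrib if_distrib[of "\<lambda>x. x * _"] if_distrib[of "\<lambda>x. _ * x"] 
      sum_if_const scal_central[of "M $ _ $ _"] sum.If_cases sum_distrib_left mult.assoc cong: if_cong)

lemma MRM'_entry:
  "(kron (mat 1) M' ** map_matrix scal Rmat ** kron M (mat 1)) $ (a, b) $ (c, d)
   = scal (qij a d) * (M' $ b $ d * M $ a $ c) + (if a = d then scal (1 - q ^ 2) * (\<Sum>l\<in>{l. a < l}. M' $ b $ l * M $ l $ c) else 0)"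
  unfolding kron_right_mult_entry mult_kron_left_entry R12_entry
  by (simp add: distrib_left distrib_right sum.distrib if_distrib[of "\<lambda>x. x * _"] if_distrib[of "\<lambda>x. _ * x"] 
      sum_if_const scal_central[of "M' $ _ $ _"] sum.If_cases sum_distrib_left mult.assoc cong: if_cong)

lemma entries_zero: "entries (A - B) \<subseteq> relators \<Longrightarrow> to_O (A $ s $ t) = to_O (B $ s $ t)"
  using to_O_relator[of "(A - B) $ s $ t"] by (auto simp: entries_def to_O_diff)

lemma X_relation: "to_O ((map_matrix scal Rmat ** kron Xfree (mat 1) ** kron (mat 1) Xfree) $ s $ t) = to_O ((kron (mat 1) Xfree ** kron Xfree (mat 1) ** map_matrix scal Rmat) $ s $ t)"
  by (rule entries_zero) (auto simp: relators_def Let_def)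

lemma Y_relation: "to_O ((map_matrix scal Rmat ** kron (mat 1) Yfree ** kron Yfree (mat 1)) $ s $ t) = to_O ((kron Yfree (mat 1) ** kron (mat 1) Yfree ** map_matrix scal Rmat) $ s $ t)"
  by (rule entries_zero) (auto simp: relators_def Let_def)

lemma XY_relation: "to_O ((kron Xfree (mat 1) ** map_matrix scal Rmat ** kron (mat 1) Yfree) $ s $ t) = to_O ((kron (mat 1) Yfree ** map_matrix scal Rmat ** kron Xfree (mat 1)) $ s $ t)"
  by (rule entries_zero) (auto simp: relators_def Let_def)

lemma scal_O_hom: "scal_O 1 = 1" "scal_O (x + y) = scal_O x + scal_O y" "scal_O (x * y) = scal_O x * scal_O y"
  by (simp_all add: scal_O_def scal_1 scal_add scal_mult to_O_1 to_O_add to_O_mult)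

lemma scal_O_central: "z * scal_O x = scal_O x * z"
  by (rule to_O_surj[of z]) (simp add: scal_O_def to_O_mult[symmetric] scal_central)

lemmas to_O_simps = to_O_0 to_O_add to_O_mult to_O_sum if_distrib[of to_O] scal_O_def[symmetric]

interpretation OqQ: quantum_pair "q ^ 2" qij scal_O "\<lambda>i j. Xmat $ i $ j" "\<lambda>i j. Ymat $ i $ j"
proof unfold_locales
  fix a b c d :: 'a
  show "scal_O (qij a b) * (Xmat $ a $ c * Xmat $ b $ d) + (if a < b then scal_O (1 - q ^ 2) * (Xmat $ b $ c * Xmat $ a $ d) else 0)
    = scal_O (qij c d) * (Xmat $ b $ d * Xmat $ a $ c) + (if d < c then scal_O (1 - q ^ 2) * (Xmat $ b $ c * Xmat $ a $ d) else 0)"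
    using X_relation[of "(a, b)" "(c, d)"]
    unfolding RMM_entry MMR_entry
    by (simp add: to_O_simps Xmat_def cong: if_cong)
  show "scal_O (qij a b) * (Ymat $ b $ d * Ymat $ a $ c) + (if a < b then scal_O (1 - q ^ 2) * (Ymat $ a $ d * Ymat $ b $ c) else 0)
    = scal_O (qij c d) * (Ymat $ a $ c * Ymat $ b $ d) + (if d < c then scal_O (1 - q ^ 2) * (Ymat $ a $ d * Ymat $ b $ c) else 0)"
    using Y_relation[of "(a, b)" "(c, d)"]
    unfolding RMM'_entry MMR'_entry
    by (simp add: to_O_simps Ymat_def cong: if_cong)
  show "scal_O (qij b d) * (Ymat $ a $ d * Xmat $ b $ c) + (if b = d then scal_O (1 - q ^ 2) * (\<Sum>k\<in>{k. b < k}. Ymat $ a $ k * Xmat $ k $ c) else 0)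
    = scal_O (qij c a) * (Xmat $ b $ c * Ymat $ a $ d) + (if a = c then scal_O (1 - q ^ 2) * (\<Sum>l\<in>{l. l < a}. Xmat $ b $ l * Ymat $ l $ d) else 0)"
    using XY_relation[of "(b, a)" "(c, d)"]
    unfolding MRM_entry MRM'_entry
    by (simp add: to_O_simps Xmat_def Ymat_def cong: if_cong)
next
  show "z * scal_O x = scal_O x * z" for z :: "'a OqQ" and x by (rule scal_O_central)
qed (simp_all add: qij_diag qij_mult q_nz q2_sum_nz scal_O_hom)

section \<open>Words and operators on the legs of the tensor power\<close>

text \<open>A basis vector of the tensor power is a map from legs to letters; reading it off along the legs
  in increasing order turns it into a word.\<close>

abbreviation wd :: "('n::{finite,linorder} \<Rightarrow> 'b) \<Rightarrow> 'b list" where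
  "wd a \<equiv> map a (sorted_list_of_set UNIV)"

lemma bij_wd: "bij_betw (wd :: ('n::{finite,linorder} \<Rightarrow> 'b) \<Rightarrow> _) UNIV {w. length w = CARD('n)}"
proof (rule bij_betwI[where g = "\<lambda>w i. w ! (THE j. j < CARD('n) \<and> sorted_list_of_set UNIV ! j = i)"])
  let ?ls = "sorted_list_of_set (UNIV :: 'n set)"
  have the: "(THE j. j < CARD('n) \<and> ?ls ! j = ?ls ! k) = k" if "k < CARD('n)" for k
    using that by (intro the_equality) (auto simp: nth_eq_iff_index_eq)
  have ex: "\<exists>k < CARD('n). i = ?ls ! k" for i :: 'n
    by (metis UNIV_I finite in_set_conv_nth length_sorted_list_of_set set_sorted_list_of_set)
  show "(\<lambda>i. wd a ! (THE j. j < CARD('n) \<and> ?ls ! j = i)) = a" for a :: "'n \<Rightarrow> 'b"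
  proof
    fix i :: 'n
    obtain k where "k < CARD('n)" "i = ?ls ! k" using ex by blast
    then show "wd a ! (THE j. j < CARD('n) \<and> ?ls ! j = i) = a i" by (simp add: the)
  qed
  show "wd (\<lambda>i. w ! (THE j. j < CARD('n) \<and> ?ls ! j = i)) = w" if "w \<in> {w. length w = CARD('n)}" for w :: "'b list"
    using that by (intro nth_equalityI) (simp_all add: the)
qed auto

lemma wd_update:
  "j < CARD('n) \<Longrightarrow> wd (a(sorted_list_of_set UNIV ! j := x)) = (wd a)[j := x]" for a :: "'n::{finite,linorder} \<Rightarrow> 'b"
  by (intro nth_equalityI) (auto simp: nth_list_update nth_eq_iff_index_eq)

text \<open>A matrix as an operator on functions, so that products of matrices become compositions.\<close>

definition act :: "('a::semiring_1 ^'m::finite ^'m) \<Rightarrow> ('m \<Rightarrow> 'a) \<Rightarrow> 'm \<Rightarrow> 'a" where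
  "act M f a = (\<Sum>b\<in>UNIV. M $ a $ b * f b)"

lemma act_mult: "act (M ** N) f = act M (act N f)"
proof (rule ext)
  fix a
  show "act (M ** N) f a = act M (act N f) a"
    unfolding act_def matrix_matrix_mult_def
    by (simp add: sum_distrib_left sum_distrib_right mult.assoc) (rule sum.swap)
qed

lemma act_mat_1: "act (mat 1) f = f"
  by (rule ext) (simp add: act_def mat_def if_distrib[of "\<lambda>x. x * _"] cong: if_cong)

lemma act_mpow: "act (mpow A k) f = (act A ^^ k) f"
proof -
  have "act (((**) A ^^ k) (mat 1)) f = (act A ^^ k) f"
    by (induction k) (simp_all add: act_mult act_mat_1)
  then show ?thesis by (simp add: mpow_def)
qed

lemma act_foldl: "act (foldl (**) A Bs) f = act A (foldr act Bs f)"
  by (induction Bs arbitrary: A) (simp_all add: act_mult)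

lemma act_on_leg:
  "act (on_leg l A) f a = (\<Sum>x\<in>UNIV. A $ a l $ x * f (a(l := x)))"
  for A :: "('a::semiring_1, 'n::finite) sqmat"
proof -
  have "act (on_leg l A) f a = (\<Sum>b\<in>{b. \<forall>m. m \<noteq> l \<longrightarrow> a m = b m}. A $ a l $ b l * f b)"
    unfolding act_def on_leg_def by (rule sum.mono_neutral_cong_right) auto
  also have "\<dots> = (\<Sum>x\<in>UNIV. A $ a l $ x * f (a(l := x)))"
  proof -
    have "a(l := b l) = b" if "\<forall>m. m \<noteq> l \<longrightarrow> a m = b m" for b using that by (auto simp: fun_eq_iff)
    then show ?thesis
      by (intro sum.reindex_bij_witness[where i = "\<lambda>x. a(l := x)" and j = "\<lambda>b. b l"]) auto
  qed
  finally show ?thesis .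
qed

lemma act_on_legs:
  fixes T :: "('a::semiring_1, 'n::finite \<times> 'n) sqmat"
  assumes "k \<noteq> m"
  shows "act (on_legs k m T) f a = (\<Sum>x\<in>UNIV. \<Sum>y\<in>UNIV. T $ (a k, a m) $ (x, y) * f (a(k := x, m := y)))"
proof -
  have "act (on_legs k m T) f a = (\<Sum>b\<in>{b. \<forall>l. l \<noteq> k \<and> l \<noteq> m \<longrightarrow> a l = b l}. T $ (a k, a m) $ (b k, b m) * f b)"
    unfolding act_def on_legs_def by (rule sum.mono_neutral_cong_right) auto
  also have "\<dots> = (\<Sum>z\<in>UNIV. T $ (a k, a m) $ z * f (a(k := fst z, m := snd z)))"
  proof -
    have "a(k := b k, m := b m) = b" if "\<forall>l. l \<noteq> k \<and> l \<noteq> m \<longrightarrow> a l = b l" for b using that by (auto simp: fun_eq_iff)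
    then show ?thesis using assms
      by (intro sum.reindex_bij_witness[where i = "\<lambda>z. a(k := fst z, m := snd z)" and j = "\<lambda>b. (b k, b m)"]) auto
  qed
  finally show ?thesis by (simp add: sum_UNIV_prod)
qed

lemma Rhat_entry:
  "Rhat $ (a, b) $ (c, d) = (if c = b then if d = a then qij b a else 0 else 0)
     + (if c = a then if d = b then if b < a then 1 - q ^ 2 else 0 else 0 else 0)"
proof -
  have F: "Flip $ (a, b) $ s = (if fst s = b then if snd s = a then 1 else 0 else (0 :: 'a rat_fun))" for s
  proof -
    have "Flip $ (a, b) $ s = (\<Sum>i\<in>UNIV. \<Sum>j\<in>UNIV. if i = a then if j = b then (if fst s = b then if snd s = a then 1 else 0 else 0) else 0 else (0 :: 'a rat_fun))"
      unfolding Flip_def sum_component by (intro sum.cong refl) (auto simp: kron_def munit_def)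
    then show ?thesis unfolding sum_if_const by simp
  qed
  have "Rhat $ (a, b) $ (c, d) = Rmat $ (b, a) $ (c, d)"
    unfolding Rhat_def matrix_matrix_mult_def
    by (simp add: F sum_UNIV_prod if_distrib[of "\<lambda>x. x * _"] sum_if_const cong: if_cong)
  then show ?thesis by (auto simp: Rmat_entry)
qed

lemma map_on_legs: "f 0 = 0 \<Longrightarrow> map_matrix f (on_legs k m T) = on_legs k m (map_matrix f T)"
  by (auto simp: on_legs_def map_matrix_def vec_eq_iff)

lemma act_Rhat:
  assumes "Suc j < CARD('n::{finite,linorder})"
  shows "act (map_matrix scal_O (on_legs (leg (Suc j)) (leg (Suc (Suc j))) Rhat)) (\<lambda>a :: 'n \<Rightarrow> 'n. g (wd a))
    = (\<lambda>a. OqQ.Sg j g (wd a))"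
proof (rule ext)
  fix a :: "'n \<Rightarrow> 'n"
  let ?ls = "sorted_list_of_set (UNIV :: 'n set)"
  have legs: "leg (Suc j) = ?ls ! j" "leg (Suc (Suc j)) = ?ls ! Suc j" by (simp_all add: leg_def)
  have ne: "?ls ! j \<noteq> ?ls ! Suc j" using assms by (simp add: nth_eq_iff_index_eq)
  have upd: "wd (a(?ls ! j := x, ?ls ! Suc j := y)) = (wd a)[j := x, Suc j := y]" for x y
    using assms by (simp add: wd_update)
  have nth: "wd a ! j = a (?ls ! j)" "wd a ! Suc j = a (?ls ! Suc j)" using assms by simp_all
  have same: "(wd a)[j := a (?ls ! j), Suc j := a (?ls ! Suc j)] = wd a"
    using nth by (metis list_update_id)
  show "act (map_matrix scal_O (on_legs (leg (Suc j)) (leg (Suc (Suc j))) Rhat)) (\<lambda>a. g (wd a)) a = OqQ.Sg j g (wd a)"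
    unfolding legs map_on_legs[of scal_O, OF OqQ.sc_0] act_on_legs[OF ne] upd nth_map_matrix Rhat_entry OqQ.Sg_def nth
    by (simp add: scal_O_hom if_distrib[of scal_O] distrib_right sum.distrib if_distrib[of "\<lambda>x. x * _"] sum_if_const same cong: if_cong)
qed

lemma act_sigma_op:
  assumes "n < CARD('n::{finite,linorder})"
  shows "act (sigma_op (Suc n)) (\<lambda>a :: 'n \<Rightarrow> 'n. g (wd a)) = (\<lambda>a. OqQ.Dop n g (wd a))"
proof -
  let ?ls = "sorted_list_of_set (UNIV :: 'n set)"
  let ?B = "\<lambda>j. map_matrix scal_O (on_legs (leg (Suc j)) (leg (Suc (Suc j))) Rhat) :: ('n OqQ, 'n \<Rightarrow> 'n) sqmat"
  have fold: "set ns \<subseteq> {..<n} \<Longrightarrow> foldr act (map ?B ns) (\<lambda>a :: 'n \<Rightarrow> 'n. g (wd a)) = (\<lambda>a. foldr OqQ.Sg ns g (wd a))" for ns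
    using assms by (induction ns) (auto simp: act_Rhat)
  have mp: "map (\<lambda>k. map_matrix scal_O (on_legs (leg k) (leg (k + 1)) Rhat)) [1..<Suc n] = map ?B [0..<n]"
    unfolding One_nat_def map_Suc_upt[symmetric] map_map comp_def add_Suc_right add_0_right ..
  have ne: "?ls = ?ls ! 0 # tl ?ls"
    by (metis UNIV_not_empty finite hd_conv_nth list.collapse sorted_list_of_set_eq_Nil_iff)
  show ?thesis
  proof (rule ext)
    fix a :: "'n \<Rightarrow> 'n"
    obtain x v where w: "wd a = x # v" "x = a (?ls ! 0)" by (metis list.simps(9) ne)
    have len: "length (wd a) = CARD('n)" by simp
    have "act (sigma_op (Suc n)) (\<lambda>a :: 'n \<Rightarrow> 'n. g (wd a)) a
      = act (on_leg (?ls ! 0) (Xmat ** Ymat)) (\<lambda>a. foldr OqQ.Sg [0..<n] g (wd a)) a"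
      unfolding sigma_op_def mp act_foldl by (subst fold) (auto simp: leg_def)
    also have "\<dots> = (\<Sum>b\<in>UNIV. (Xmat ** Ymat) $ x $ b * foldr OqQ.Sg [0..<n] g (b # v))"
      unfolding act_on_leg w(2)[symmetric] by (simp add: wd_update w(1))
    also have "\<dots> = (\<Sum>b\<in>UNIV. OqQ.Zm x b * OqQ.Jop n g (b # v))"
    proof -
      have "n < length (b # v)" for b using assms len w(1) by simp
      then show ?thesis by (simp add: OqQ.foldr_Sg OqQ.Zm_def matrix_matrix_mult_def)
    qed
    finally show "act (sigma_op (Suc n)) (\<lambda>a :: 'n \<Rightarrow> 'n. g (wd a)) a = OqQ.Dop n g (wd a)"
      by (simp add: OqQ.Dop_def w(1))
  qed
qed

lemma mq_c_insert:
  fixes \<tau> :: "'b::linorder \<Rightarrow> 'n::{finite,linorder}"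
  assumes "finite I" "\<And>k. k \<in> I \<Longrightarrow> j < k" "inj_on \<tau> (insert j I)"
  shows "mq_c (insert j I) \<tau> = (\<Prod>k\<in>I. OqQ.inv_c (\<tau> j) (\<tau> k)) * mq_c I \<tau>"
    and "mq_r (insert j I) \<tau> = (\<Prod>k\<in>I. OqQ.inv_r (\<tau> j) (\<tau> k)) * mq_r I \<tau>"
proof -
  let ?P = "\<lambda>I. {(i, k). i \<in> I \<and> k \<in> I \<and> i < k \<and> \<tau> i > \<tau> k}"
  have P: "?P (insert j I) = Pair j ` {k \<in> I. \<tau> k < \<tau> j} \<union> ?P I"
    using assms(2) by (auto dest: less_asym)
  have d: "Pair j ` {k \<in> I. \<tau> k < \<tau> j} \<inter> ?P I = {}" using assms(2) by auto
  have f: "finite (?P I)" by (rule finite_subset[of _ "I \<times> I"]) (auto simp: assms(1))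
  have ne: "k \<in> I \<Longrightarrow> \<tau> k \<noteq> \<tau> j" for k using assms(2,3) by (metis inj_on_contraD insertI1 insertI2 less_irrefl)
  have split: "(\<Prod>(i, k)\<in>?P (insert j I). f i k) = (\<Prod>k\<in>I. if \<tau> k < \<tau> j then f j k else 1) * (\<Prod>(i, k)\<in>?P I. f i k)"
    for f :: "'b \<Rightarrow> 'b \<Rightarrow> 'n rat_fun"
  proof -
    have "(\<Prod>(i, k)\<in>Pair j ` {k \<in> I. \<tau> k < \<tau> j}. f i k) = (\<Prod>k\<in>{k \<in> I. \<tau> k < \<tau> j}. f j k)"
      by (subst prod.reindex) (auto simp: inj_on_def)
    also have "\<dots> = (\<Prod>k\<in>I. if \<tau> k < \<tau> j then f j k else 1)"
      by (rule prod.inter_filter[OF assms(1)])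
    finally show ?thesis
      unfolding P by (subst prod.union_disjoint[OF _ f d]) (simp_all add: assms(1))
  qed
  show "mq_c (insert j I) \<tau> = (\<Prod>k\<in>I. OqQ.inv_c (\<tau> j) (\<tau> k)) * mq_c I \<tau>"
    unfolding mq_c_def split
    by (intro arg_cong2[where f = "(*)"] prod.cong refl) (use ne in \<open>auto simp: OqQ.inv_c_def\<close>)
  show "mq_r (insert j I) \<tau> = (\<Prod>k\<in>I. OqQ.inv_r (\<tau> j) (\<tau> k)) * mq_r I \<tau>"
    unfolding mq_r_def split
    by (intro arg_cong2[where f = "(*)"] prod.cong refl) (use ne in \<open>auto simp: OqQ.inv_r_def\<close>)
qed

text \<open>The product over inversions, computed letter by letter.\<close>

lemma eps_mq:
  fixes \<tau> :: "'b::linorder \<Rightarrow> 'n::{finite,linorder}"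
  assumes "sorted w" "distinct w" "inj_on \<tau> (set w)"
  shows "OqQ.eps_c (map \<tau> w) = mq_c (set w) \<tau>" "OqQ.eps_r (map \<tau> w) = mq_r (set w) \<tau>"
proof -
  have "OqQ.eps_c (map \<tau> w) = mq_c (set w) \<tau> \<and> OqQ.eps_r (map \<tau> w) = mq_r (set w) \<tau>"
    using assms
  proof (induction w)
    case Nil
    then show ?case by (simp add: mq_c_def mq_r_def)
  next
    case (Cons x w)
    have lt: "k \<in> set w \<Longrightarrow> x < k" for k using Cons.prems by (auto simp: order_le_less)
    have inj: "inj_on \<tau> (insert x (set w))" "inj_on \<tau> (set w)" using Cons.prems by auto
    have d: "distinct (map \<tau> w)" using Cons.prems by (simp add: distinct_map)
    have pr: "(\<Prod>y\<in>\<tau> ` set w. f y) = (\<Prod>k\<in>set w. f (\<tau> k))" for f :: "'n \<Rightarrow> 'n rat_fun"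
      using inj(2) by (simp add: prod.reindex)
    have mc: "mq_c (insert x (set w)) \<tau> = (\<Prod>k\<in>set w. OqQ.inv_c (\<tau> x) (\<tau> k)) * mq_c (set w) \<tau>"
      by (rule mq_c_insert(1)) (use lt inj in auto)
    have mr: "mq_r (insert x (set w)) \<tau> = (\<Prod>k\<in>set w. OqQ.inv_r (\<tau> x) (\<tau> k)) * mq_r (set w) \<tau>"
      by (rule mq_c_insert(2)) (use lt inj in auto)
    show ?case
      unfolding list.map list.set mc mr OqQ.eps_c_Cons[OF d] OqQ.eps_r_Cons[OF d]
      using Cons by (simp add: pr)
  qed
  then show "OqQ.eps_c (map \<tau> w) = mq_c (set w) \<tau>" "OqQ.eps_r (map \<tau> w) = mq_r (set w) \<tau>" by auto
qed

lemma u_vec_wd: "u_vec $ (b :: 'n::{finite,linorder} \<Rightarrow> 'n) = OqQ.eps_c (wd b)" and v_vec_wd: "v_vec $ b = OqQ.eps_r (wd b)"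
proof -
  have ax: "(\<Sum>\<sigma>\<in>A. f \<sigma> *s axis \<sigma> 1) $ b = (if b \<in> A then f b else 0)" if "finite A" for A and f :: "('n \<Rightarrow> 'n) \<Rightarrow> 'n rat_fun"
    using that by (simp add: axis_def if_distrib[of "\<lambda>x. _ * x"] cong: if_cong)
  have "distinct (wd b) \<longleftrightarrow> inj b" by (simp add: distinct_map)
  moreover have "bij b \<longleftrightarrow> inj b" using finite_UNIV_inj_surj[OF finite, of b] by (auto simp: bij_def)
  ultimately have *: "OqQ.eps_c (wd b) = (if bij b then mq_c UNIV b else 0)" "OqQ.eps_r (wd b) = (if bij b then mq_r UNIV b else 0)"
    using eps_mq[of "sorted_list_of_set UNIV" b]
    by (auto simp: OqQ.eps_c_not_distinct OqQ.eps_r_not_distinct)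
  show "u_vec $ b = OqQ.eps_c (wd b)" "v_vec $ b = OqQ.eps_r (wd b)"
    unfolding u_vec_def v_vec_def ax[OF finite] * by simp_all
qed

lemma qfact_qf: "qfact k = (OqQ.qf k :: 'n::{finite,linorder} rat_fun)"
  by (simp add: qfact_def OqQ.qf_def qint_def OqQ.qnum_def power_mult)

text \<open>The scalar \<open>(-q^2)^((k - 1) k)\<close> from \<open>Dop_power\<close> has even exponent, so its sign disappears; together with
  \<open>q^(- (k - 1) k)\<close> it leaves the normalization of \<open>sigma_words\<close>, and \<open>alpha k\<close> cancels the two factorials.\<close>

lemma sigma_sm:
  assumes "k \<le> CARD('n::{finite,linorder})"
  shows "sigma k = (OqQ.sm k :: 'n OqQ)"
proof (cases k)
  case 0
  then show ?thesis by (simp add: sigma_def OqQ.sm_0)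
next
  case (Suc n)
  let ?A = "\<Sum>w\<in>{w :: 'n list. length w = CARD('n)}. scal_O (OqQ.eps_r w) * OqQ.FF k w"
  have n: "n < CARD('n)" using assms Suc by simp
  have pw: "(act (sigma_op k) ^^ m) (\<lambda>a :: 'n \<Rightarrow> 'n. OqQ.U0 (wd a)) = (\<lambda>a. (OqQ.Dop n ^^ m) OqQ.U0 (wd a))" for m
    by (induction m) (simp_all add: Suc act_sigma_op[OF n])
  have "(\<Sum>a\<in>UNIV. \<Sum>b\<in>UNIV. scal_O (v_vec $ a) * mpow (sigma_op k) k $ a $ b * scal_O (u_vec $ (b :: 'n \<Rightarrow> 'n)))
     = (\<Sum>a\<in>UNIV. scal_O (OqQ.eps_r (wd a)) * act (mpow (sigma_op k) k) (\<lambda>a. OqQ.U0 (wd a)) a)"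
    by (simp add: act_def sum_distrib_left mult.assoc u_vec_wd v_vec_wd OqQ.U0_def)
  also have "\<dots> = (\<Sum>a\<in>UNIV. scal_O (OqQ.eps_r (wd (a :: 'n \<Rightarrow> 'n))) * (OqQ.Dop n ^^ k) OqQ.U0 (wd a))"
    unfolding act_mpow pw ..
  also have "\<dots> = (\<Sum>w\<in>OqQ.words CARD('n). scal_O (OqQ.eps_r w) * (OqQ.Dop n ^^ k) OqQ.U0 w)"
    by (rule sum.reindex_bij_betw[OF bij_wd])
  also have "\<dots> = (\<Sum>w\<in>OqQ.words CARD('n). scal_O (OqQ.eps_r w) * (scal_O ((- (q ^ 2)) ^ (n * k)) * OqQ.FF k w))"
  proof (rule sum.cong[OF refl])
    fix w :: "'n list" assume "w \<in> {w. length w = CARD('n)}"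
    then have "n < length w" "k \<le> Suc n" using n Suc by auto
    then show "scal_O (OqQ.eps_r w) * (OqQ.Dop n ^^ k) OqQ.U0 w
      = scal_O (OqQ.eps_r w) * (scal_O ((- (q ^ 2)) ^ (n * k)) * OqQ.FF k w)"
      by (simp only: OqQ.Dop_power)
  qed
  also have "\<dots> = scal_O ((- (q ^ 2)) ^ (n * k)) * ?A"
    by (simp only: sum_distrib_left OqQ.scl_comm[of "(- (q ^ 2)) ^ (n * k)"])
  finally have s: "sigma k = scal_O (q powi (- int ((k - 1) * k)) * alpha k) * (scal_O ((- (q ^ 2)) ^ (n * k)) * ?A)"
    using Suc by (simp only: sigma_def nat.distinct(2) if_False)
  have gauss: "2 * (\<Sum>i<k. i) = n * k" unfolding Suc by (induction n) auto
  then have ev: "even (n * k)" by (metis dvd_triv_left)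
  have e: "q powi (- int ((k - 1) * k)) * (- (q ^ 2)) ^ (n * k) = (q ^ 2 :: 'n rat_fun) ^ (\<Sum>i<k. i)"
  proof -
    have "(q ^ 2 :: 'n rat_fun) ^ (\<Sum>i<k. i) = q ^ (n * k)" by (simp add: power_mult[symmetric] gauss)
    moreover have "(- (q ^ 2 :: 'n rat_fun)) ^ (n * k) = q ^ (n * k) * q ^ (n * k)"
      using ev by (simp add: power_minus_even power2_eq_square power_mult_distrib)
    moreover have "q powi (- int ((k - 1) * k)) = inverse (q ^ (n * k) :: 'n rat_fun)"
    proof -
      have "(k - 1) * k = n * k" using Suc by simp
      then show ?thesis by (simp only: power_int_minus power_int_of_nat)
    qed
    moreover have "q ^ (n * k) \<noteq> (0 :: 'n rat_fun)" by (simp add: q_nz)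
    moreover have "inverse x * (x * x) = x" if "x \<noteq> 0" for x :: "'n rat_fun"
      using that by simp
    ultimately show ?thesis by metis
  qed
  have "sigma k = scal_O (alpha k * (q powi (- int ((k - 1) * k)) * (- (q ^ 2)) ^ (n * k))) * ?A"
    unfolding s OqQ.scl_scl by (simp add: mult_ac)
  also have "\<dots> = scal_O (alpha k) * (scal_O ((q ^ 2) ^ (\<Sum>i<k. i)) * ?A)"
    unfolding e OqQ.scl_scl ..
  also have "\<dots> = scal_O (alpha k * (OqQ.qf (CARD('n) - k) * OqQ.qf k)) * OqQ.sm k"
    unfolding OqQ.sigma_words[OF assms] OqQ.scl_scl ..
  also have "alpha k * (OqQ.qf (CARD('n) - k) * OqQ.qf k) = (1 :: 'n rat_fun)"
  proof -
    have "OqQ.qf m \<noteq> (0 :: 'n rat_fun)" for m by (rule OqQ.qf_nz)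
    then show ?thesis by (simp add: alpha_def qfact_qf)
  qed
  finally show ?thesis by (simp add: scal_O_hom)
qed

section \<open>The minors and the numerator as sums of words\<close>

definition wt_prod :: "'n::{finite,linorder} set \<Rightarrow> 'n rat_fun" where
  "wt_prod L = (\<Prod>l\<in>L. q ^ card {k. l < k})"

lemma XD_entry:
  "(Xfree ** map_matrix scal Dprime) $ j $ t
     = Poly_Mapping.single (Word [GX j (t :: 'n::{finite,linorder})]) (q ^ card {k. t < k})"
proof -
  have "Xfree $ j $ s * scal (Dprime $ s $ t) = (if s = t then Xfree $ j $ t * scal (q ^ card {k. t < k}) else 0)" for s
    by (simp add: Dprime_def scal_0)
  then have "(Xfree ** map_matrix scal Dprime) $ j $ t = Xfree $ j $ t * scal (q ^ card {k. t < k})"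
    by (simp add: matrix_matrix_mult_def)
  then show ?thesis by (simp add: Xfree_def scal_def mult_single)
qed

lemma prod_list_singles:
  "(\<Prod>k\<leftarrow>ks. Poly_Mapping.single (Word [g k]) (f k)) = Poly_Mapping.single (Word (map g ks)) (\<Prod>k\<leftarrow>ks. f k)"
  by (induction ks) (simp_all add: mult_single plus_freemon_def flip: zero_freemon_def)

lemma scal_single: "scal x * Poly_Mapping.single w y = Poly_Mapping.single w (x * y)"
  by (simp add: scal_def mult_single)

text \<open>A bijection \<open>\<tau>\<close> is listed as the word of its values. Its weights depend on \<open>L\<close> only, so \<open>D'\<close> contributes a common
  factor.\<close>

lemma minor_XD_words:
  assumes "card J = card (L :: 'n::{finite,linorder} set)"
  shows "minor_XD J L = (\<Sum>c\<in>permutations_of_set L.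
    Poly_Mapping.single (Word (map2 GX (sorted_list_of_set J) c)) (OqQ.eps_c c * wt_prod L))"
proof -
  let ?i = "card J"
  let ?T = "{\<tau>. \<tau> \<in> {1..?i} \<rightarrow>\<^sub>E L \<and> bij_betw \<tau> {1..?i} L}"
  let ?w = "[1..<?i + 1]"
  have set_w: "set ?w = {1..?i}" by auto
  have len: "length c = ?i" "distinct c" "set c = L" if "c \<in> permutations_of_set L" for c
    using that assms by (auto simp: permutations_of_set_def distinct_card[symmetric])
  have map_nth_w: "map (\<lambda>k. if k \<in> {1..?i} then c ! (k - 1) else undefined) ?w = c" if "length c = ?i" for c :: "'n list"
    using that by (intro nth_equalityI) (auto simp del: upt_Suc)
  have "minor_XD J L = (\<Sum>\<tau>\<in>?T. Poly_Mapping.single (Word (map2 GX (sorted_list_of_set J) (map \<tau> ?w)))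
      (OqQ.eps_c (map \<tau> ?w) * wt_prod L))"
    unfolding minor_XD_def Let_def
  proof (rule sum.cong[OF refl])
    fix \<tau> assume "\<tau> \<in> ?T"
    then have b: "bij_betw \<tau> {1..?i} L" by auto
    then have inj: "inj_on \<tau> (set ?w)" unfolding set_w by (rule bij_betw_imp_inj_on)
    have e: "OqQ.eps_c (map \<tau> ?w) = mq_c {1..?i} \<tau>"
      using eps_mq(1)[of ?w \<tau>, OF _ _ inj] unfolding set_w by (simp del: upt_Suc)
    have "(\<Prod>k\<leftarrow>?w. q ^ card {m. \<tau> k < m}) = (\<Prod>k\<in>{1..?i}. q ^ card {m. \<tau> k < m})"
      unfolding set_w[symmetric] by (rule prod.distinct_set_conv_list[symmetric]) simp
    also have "\<dots> = wt_prod L"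
      unfolding wt_prod_def by (rule prod.reindex_bij_betw[OF b])
    finally have p: "(\<Prod>k\<leftarrow>?w. q ^ card {m. \<tau> k < m}) = wt_prod L" .
    have m: "map (\<lambda>k. GX (sorted_list_of_set J ! (k - 1)) (\<tau> k)) ?w = map2 GX (sorted_list_of_set J) (map \<tau> ?w)"
      by (intro nth_equalityI) (auto simp del: upt_Suc)
    show "scal (mq_c {1..?i} \<tau>) * (\<Prod>k\<leftarrow>?w. (Xfree ** map_matrix scal Dprime) $ (sorted_list_of_set J ! (k - 1)) $ \<tau> k)
      = Poly_Mapping.single (Word (map2 GX (sorted_list_of_set J) (map \<tau> ?w))) (OqQ.eps_c (map \<tau> ?w) * wt_prod L)"
      unfolding XD_entry prod_list_singles scal_single e p m ..
  qed
  also have "\<dots> = (\<Sum>c\<in>permutations_of_set L.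
    Poly_Mapping.single (Word (map2 GX (sorted_list_of_set J) c)) (OqQ.eps_c c * wt_prod L))"
  proof (rule sum.reindex_bij_witness[where j = "\<lambda>\<tau>. map \<tau> ?w"
        and i = "\<lambda>c k. if k \<in> {1..?i} then c ! (k - 1) else undefined"])
    fix \<tau> assume T: "\<tau> \<in> ?T"
    show "(\<lambda>k. if k \<in> {1..?i} then map \<tau> ?w ! (k - 1) else undefined) = \<tau>"
    proof
      fix k
      show "(if k \<in> {1..?i} then map \<tau> ?w ! (k - 1) else undefined) = \<tau> k"
        using T by (auto simp: PiE_def extensional_def simp del: upt_Suc)
    qed
    show "map \<tau> ?w \<in> permutations_of_set L"
      using T set_w by (auto simp: permutations_of_set_def distinct_map bij_betw_def simp del: upt_Suc)
  next
    fix c assume c: "c \<in> permutations_of_set L"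
    show "map (\<lambda>k. if k \<in> {1..?i} then c ! (k - 1) else undefined) ?w = c"
      using map_nth_w len(1)[OF c] by blast
    have "bij_betw (\<lambda>k. c ! (k - 1)) {1..?i} L"
      using bij_betw_trans[of "\<lambda>k. k - 1" "{1..?i}" "{..<?i}" "(!) c" L] bij_betw_nth[OF len(2)[OF c], of "{..<?i}" L] len[OF c]
        bij_betw_byWitness[of "{1..?i}" Suc "\<lambda>k. k - 1" "{..<?i}"]
      by (force simp: comp_def)
    then have "bij_betw (\<lambda>k. if k \<in> {1..?i} then c ! (k - 1) else undefined) {1..?i} L"
      by (rule bij_betw_cong[THEN iffD1, rotated]) simp
    then show "(\<lambda>k. if k \<in> {1..?i} then c ! (k - 1) else undefined) \<in> ?T"
      by (auto simp: bij_betw_def)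
  qed (auto)
  finally show ?thesis .
qed

lemma star_F_0 [simp]: "star_F 0 = 0"
  by (simp add: Zero_fract_def star_F_Fract)

lemma star_superset:
  "finite A \<Longrightarrow> Poly_Mapping.keys f \<subseteq> A \<Longrightarrow>
    star f = (\<Sum>w\<in>A. Poly_Mapping.single (Word (rev (map star_gen (letters w)))) (star_F (Poly_Mapping.lookup f w)))"
  unfolding star_def by (rule sum.mono_neutral_left) (auto simp: in_keys_iff)

lemma star_single:
  "star (Poly_Mapping.single w c) = Poly_Mapping.single (Word (rev (map star_gen (letters w)))) (star_F c)"
  by (subst star_superset[of "{w}"]) auto

lemma star_add: "star (f + g) = star f + star g"
proof -
  let ?A = "Poly_Mapping.keys f \<union> Poly_Mapping.keys g"
  have "Poly_Mapping.keys (f + g) \<subseteq> ?A" by (rule keys_add)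
  then show ?thesis
    by (simp add: star_superset[of ?A] lookup_add star_F_add single_add sum.distrib)
qed

lemma star_sum: "star (sum f A) = (\<Sum>a\<in>A. star (f a))"
  by (rule additive_sum) (simp_all add: star_add, simp add: star_def)

lemma star_F_uminus: "star_F (- x) = - star_F x"
  using star_F_add[of x "- x"] by (simp add: eq_neg_iff_add_eq_0 add.commute)

lemma star_F_eps_c: "star_F (OqQ.eps_c c) = OqQ.eps_r (c :: 'n::{finite,linorder} list)"
proof -
  have i: "star_F (OqQ.inv_c x y) = OqQ.inv_r x y" for x y :: 'n
    by (simp add: OqQ.inv_c_def OqQ.inv_r_def star_F_uminus star_F_qij)
  have "star_F (\<Prod>y\<leftarrow>w. OqQ.inv_c x y) = (\<Prod>y\<leftarrow>w. OqQ.inv_r x y)" for x :: 'n and w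
    by (induction w) (simp_all add: star_F_mult i)
  then show ?thesis by (induction c) (simp_all add: star_F_mult)
qed

lemma star_F_wt_prod: "star_F (wt_prod L) = wt_prod (L :: 'n::{finite,linorder} set)"
proof -
  have "star_F (q ^ k) = (q ^ k :: 'n rat_fun)" for k by (induction k) (simp_all add: star_F_mult star_F_q)
  then show ?thesis
    unfolding wt_prod_def by (induction L rule: infinite_finite_induct) (simp_all add: star_F_mult)
qed

lemma minor_DY_words:
  assumes "card K = card (L :: 'n::{finite,linorder} set)"
  shows "minor_DY L K = (\<Sum>c\<in>permutations_of_set L.
    Poly_Mapping.single (Word (rev (map2 GY c (sorted_list_of_set K)))) (OqQ.eps_r c * wt_prod L))"
proof -
  have "map star_gen (map2 GX a c) = map2 GY c a" for a c :: "'n list"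
    by (induction a arbitrary: c) (simp, case_tac c, simp_all)
  then show ?thesis
    unfolding minor_DY_def minor_XD_words[OF assms] star_sum star_single
    by (simp add: star_F_mult star_F_eps_c star_F_wt_prod)
qed

lemma scal_O_mult_hom: "scal_O (x * y) = scal_O x * scal_O y"
  by (rule scal_O_hom)

lemma scal_O_shift: "scal_O c * y * (scal_O d * x) = scal_O c * scal_O d * (y * x)"
proof -
  have "scal_O c * y * (scal_O d * x) = scal_O c * (y * scal_O d) * x" by (simp only: mult.assoc)
  also have "\<dots> = scal_O c * scal_O d * (y * x)" unfolding scal_O_central[of y] by (simp only: mult.assoc)
  finally show ?thesis .
qed

lemma to_O_single: "to_O (Poly_Mapping.single (Word ws) x) = scal_O x * to_O (Poly_Mapping.single (Word ws) 1)"
  by (simp add: scal_O_def scal_single flip: to_O_mult)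

lemma to_O_Cons:
  "to_O (Poly_Mapping.single (Word (g # ws)) 1) = to_O (Poly_Mapping.single (Word [g]) 1) * to_O (Poly_Mapping.single (Word ws) 1)"
  by (simp add: mult_single plus_freemon_def flip: to_O_mult)

lemma to_O_snoc:
  "to_O (Poly_Mapping.single (Word (ws @ [g])) 1) = to_O (Poly_Mapping.single (Word ws) 1) * to_O (Poly_Mapping.single (Word [g]) 1)"
  by (simp add: mult_single plus_freemon_def flip: to_O_mult)

lemma to_O_Nil: "to_O (Poly_Mapping.single (Word []) 1) = 1"
  using to_O_1 by (simp add: zero_freemon_def flip: single_one)

lemma to_O_gen: "to_O (Poly_Mapping.single (Word [GX i j]) 1) = Xmat $ i $ j"
  "to_O (Poly_Mapping.single (Word [GY i j]) 1) = Ymat $ i $ j"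
  by (simp_all add: Xmat_def Ymat_def Xfree_def Yfree_def)

text \<open>The words of the two kinds of minors are mapped to the coefficients in \<open>Am_minors\<close>; the factors \<open>Y\<close> come in reverse
  order.\<close>

lemma to_O_words:
  assumes "length a = length c"
  shows "to_O (Poly_Mapping.single (Word (map2 GX a c)) 1) = OqQ.xw a c"
    and "to_O (Poly_Mapping.single (Word (rev (map2 GY a c))) 1) = OqQ.yw a c"
  using assms
proof (induction a c rule: list_induct2)
  case (Cons x a y c)
  case 1
  show ?case using Cons by (simp add: to_O_Cons[of _ "map2 GX a c"] to_O_gen)
  case 2
  show ?case using Cons by (simp add: to_O_snoc to_O_gen)
qed (simp_all add: to_O_Nil)

lemma to_O_minors:
  fixes K L :: "'n::{finite,linorder} set"
  assumes "card K = card L"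
  shows "to_O (minor_XD K L) = scal_O (wt_prod L) * OqQ.Xmin K L"
    and "to_O (minor_DY L K) = scal_O (wt_prod L) * OqQ.Ymin L K"
proof -
  have len: "length (sorted_list_of_set K) = length c" "length c = length (sorted_list_of_set K)"
    if "c \<in> permutations_of_set L" for c
    using that assms by (auto simp: permutations_of_set_def distinct_card[symmetric])
  show "to_O (minor_XD K L) = scal_O (wt_prod L) * OqQ.Xmin K L"
    unfolding minor_XD_words[OF assms] OqQ.Xmin_def to_O_sum sum_distrib_left
    by (rule sum.cong[OF refl])
       (simp add: to_O_single[of _ "_ * _"] to_O_words len scal_O_mult_hom mult.commute[of "OqQ.eps_c _"] mult.assoc)
  show "to_O (minor_DY L K) = scal_O (wt_prod L) * OqQ.Ymin L K"
    unfolding minor_DY_words[OF assms] OqQ.Ymin_def to_O_sum sum_distrib_left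
    by (rule sum.cong[OF refl])
       (simp add: to_O_single[of _ "_ * _"] to_O_words len scal_O_mult_hom mult.commute[of "OqQ.eps_r _"] mult.assoc)
qed

text \<open>Each of the two minors contributes \<open>D'\<close> once, which makes up the weight of the trace.\<close>

lemma wt_prod_square: "wt_prod L * wt_prod L = (\<Prod>l\<in>L. OqQ.wt l)" for L :: "'n::{finite,linorder} set"
proof -
  have "q ^ k * q ^ k = (q ^ 2 :: 'n rat_fun) ^ k" for k
    by (simp add: power2_eq_square power_mult_distrib)
  then show ?thesis by (simp only: wt_prod_def OqQ.wt_def prod.distrib[symmetric])
qed

lemma mq_less_Cl: "mq_less i K = OqQ.Cl (K - {i}) (i :: 'n::{finite,linorder})"
proof -
  have "mq_less i K = (\<Prod>k\<in>K - {i}. if i < k then - qij i k else 1)"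
  proof -
    have "{k. k \<in> K \<and> i < k} = {k \<in> K - {i}. i < k}" by auto
    then show ?thesis unfolding mq_less_def by (simp only: prod.inter_filter[OF finite])
  qed
  also have "\<dots> = OqQ.Cl (K - {i}) i"
    unfolding OqQ.Cl_def by (rule prod.cong) (auto simp: OqQ.inv_c_def)
  finally show ?thesis .
qed

lemma mq_greater_Gr: "mq_greater K j = OqQ.Gr (j :: 'n::{finite,linorder}) K"
  unfolding mq_greater_def OqQ.Gr_def
  using prod.inter_filter[of K "\<lambda>k. - qij k j" "\<lambda>k. j < k"] by simp

section \<open>Polynomials in the central indeterminate\<close>

lemma tvar_power: "tvar ^ k = Poly_Mapping.single k 1"
  by (induction k) (simp_all add: tvar_def mult_single)

lemma tvar_power_const: "tvar ^ k * const x = Poly_Mapping.single k x" "const x * tvar ^ k = Poly_Mapping.single k x"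
  by (simp_all add: tvar_power const_def mult_single)

lemma lookup_to_Ot: "Poly_Mapping.lookup (to_Ot f) k = to_O (Poly_Mapping.lookup f k)"
  by (simp add: to_Ot_def Poly_Mapping.map.rep_eq when_def to_O_0)

lemma to_Ot_add: "to_Ot (f + g) = to_Ot f + to_Ot g"
  by (rule poly_mapping_eqI) (simp add: lookup_to_Ot lookup_add to_O_add)

lemma to_Ot_single: "to_Ot (Poly_Mapping.single k x) = Poly_Mapping.single k (to_O x)"
  by (rule poly_mapping_eqI) (simp add: lookup_to_Ot lookup_single when_def to_O_0)

lemma to_Ot_sum: "to_Ot (sum f A) = (\<Sum>a\<in>A. to_Ot (f a))"
  by (rule additive_sum) (simp_all add: to_Ot_add, simp add: poly_mapping_eq_iff fun_eq_iff lookup_to_Ot to_O_0)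

definition Apoly :: "'n::{finite,linorder} \<Rightarrow> 'n \<Rightarrow> (nat \<Rightarrow>\<^sub>0 'n OqQ)" where
  "Apoly i j = (\<Sum>k\<le>CARD('n). Poly_Mapping.single (CARD('n) - k) (OqQ.Am k i j))"

text \<open>The sets \<open>K\<close> are grouped by their size, which is the index \<open>k\<close> of \<open>A\<^sub>k\<close>.\<close>

lemma to_Ot_numerator: "to_Ot (numerator i j) = Apoly i (j :: 'n::{finite,linorder})"
proof -
  let ?S = "{K :: 'n set. i \<in> K \<and> j \<in> K}"
  define G where "G K = scal_O (OqQ.Gr j K * OqQ.Cl (K - {i}) i) *
     (\<Sum>L\<in>{L. card L = card K - 1}. scal_O (\<Prod>l\<in>L. OqQ.wt l) * (OqQ.Ymin L (K - {i}) * OqQ.Xmin (K - {j}) L))" for K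
  have "to_Ot (numerator i j) = (\<Sum>K\<in>?S. Poly_Mapping.single (CARD('n) - card K) (G K))"
    unfolding numerator_def tvar_power_const to_Ot_sum to_Ot_single
  proof (rule sum.cong[OF refl])
    fix K assume K: "K \<in> ?S"
    have minors: "to_O (minor_DY L (K - {i}) * minor_XD (K - {j}) L)
        = scal_O (\<Prod>l\<in>L. OqQ.wt l) * (OqQ.Ymin L (K - {i}) * OqQ.Xmin (K - {j}) L)"
      if "card L = card K - 1" for L
    proof -
      have "card (K - {i}) = card L" "card (K - {j}) = card L" using K that by (simp_all add: card_Diff_singleton)
      then show ?thesis
        unfolding to_O_mult wt_prod_square[symmetric] scal_O_mult_hom
        by (simp only: to_O_minors scal_O_shift)
    qed
    have "to_O (\<Sum>L | card L = card K - 1. minor_DY L (K - {i}) * minor_XD (K - {j}) L)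
      = (\<Sum>L\<in>{L. card L = card K - 1}. scal_O (\<Prod>l\<in>L. OqQ.wt l) * (OqQ.Ymin L (K - {i}) * OqQ.Xmin (K - {j}) L))"
      unfolding to_O_sum by (rule sum.cong[OF refl]) (simp add: minors)
    then have "to_O (scal (mq_less i K) * scal (mq_greater K j) *
          (\<Sum>L | card L = card K - 1. minor_DY L (K - {i}) * minor_XD (K - {j}) L)) = G K"
      unfolding to_O_mult G_def scal_O_def[symmetric] mq_less_Cl mq_greater_Gr scal_O_mult_hom[symmetric]
      by (simp only: mult.commute[of "OqQ.Gr j K"])
    then show "Poly_Mapping.single (CARD('n) - card K) (to_O (scal (mq_less i K) * scal (mq_greater K j) *
          (\<Sum>L | card L = card K - 1. minor_DY L (K - {i}) * minor_XD (K - {j}) L)))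
      = Poly_Mapping.single (CARD('n) - card K) (G K)" by (simp only:)
  qed
  also have "\<dots> = (\<Sum>k\<le>CARD('n). \<Sum>K\<in>{K\<in>?S. card K = k}. Poly_Mapping.single (CARD('n) - card K) (G K))"
    by (rule sum.group[symmetric]) (auto intro: card_mono)
  also have "\<dots> = Apoly i j"
  proof -
    have "(\<Sum>K\<in>{K\<in>?S. card K = k}. Poly_Mapping.single (CARD('n) - card K) (G K)) = Poly_Mapping.single (CARD('n) - k) (OqQ.Am k i j)" for k
    proof -
      have "(\<Sum>K\<in>{K\<in>?S. card K = k}. Poly_Mapping.single (CARD('n) - card K) (G K))
        = (\<Sum>K\<in>{K\<in>?S. card K = k}. Poly_Mapping.single (CARD('n) - k) (G K))" by (rule sum.cong) auto
      also have "\<dots> = Poly_Mapping.single (CARD('n) - k) (\<Sum>K\<in>{K\<in>?S. card K = k}. G K)"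
        by (rule additive_sum[symmetric]) (simp_all add: single_add)
      also have "(\<Sum>K\<in>{K\<in>?S. card K = k}. G K) = OqQ.Am k i j"
        unfolding OqQ.Am_minors G_def by (rule sum.cong) auto
      finally show ?thesis .
    qed
    then show ?thesis unfolding Apoly_def by simp
  qed
  finally show ?thesis .
qed

lemma C_N_sm: "C_N = (\<Sum>k\<le>CARD('n). Poly_Mapping.single (CARD('n) - k) (OqQ.sm k :: 'n::{finite,linorder} OqQ))"
  unfolding C_N_def tvar_power_const atLeast0AtMost by (rule sum.cong[OF refl]) (simp add: sigma_sm)

text \<open>An element that commutes with the generators commutes with all words in them.\<close>

lemma com_central:
  assumes "OqQ.com z"
  shows "z * y = y * (z :: 'n::{finite,linorder} OqQ)"
proof -
  have w: "z * to_O (Poly_Mapping.single (Word ws) 1) = to_O (Poly_Mapping.single (Word ws) 1) * z" for ws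
  proof (induction ws)
    case Nil
    show ?case by (simp add: to_O_Nil)
  next
    case (Cons g ws)
    have g: "z * to_O (Poly_Mapping.single (Word [g]) 1) = to_O (Poly_Mapping.single (Word [g]) 1) * z"
      using assms by (cases g) (simp_all add: to_O_gen OqQ.com_def)
    have "z * to_O (Poly_Mapping.single (Word [g]) 1) * to_O (Poly_Mapping.single (Word ws) 1)
      = to_O (Poly_Mapping.single (Word [g]) 1) * to_O (Poly_Mapping.single (Word ws) 1) * z"
      unfolding g mult.assoc Cons ..
    then show ?case unfolding to_O_Cons[of g ws] by (simp only: mult.assoc)
  qed
  have s: "z * to_O (Poly_Mapping.single v x) = to_O (Poly_Mapping.single v x) * z" for v x
  proof (cases v)
    case (Word ws)
    have "z * (scal_O x * to_O (Poly_Mapping.single (Word ws) 1)) = scal_O x * (z * to_O (Poly_Mapping.single (Word ws) 1))"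
      by (simp only: mult.assoc[symmetric] scal_O_central[of z])
    then show ?thesis unfolding Word to_O_single[of ws x] w by (simp only: mult.assoc)
  qed
  obtain f where f: "y = to_O f" by (rule to_O_surj)
  have "z * to_O (\<Sum>k\<in>Poly_Mapping.keys f. Poly_Mapping.single k (Poly_Mapping.lookup f k))
    = to_O (\<Sum>k\<in>Poly_Mapping.keys f. Poly_Mapping.single k (Poly_Mapping.lookup f k)) * z"
    unfolding to_O_sum sum_distrib_left sum_distrib_right s ..
  then show ?thesis unfolding f by (simp only: poly_mapping_sum_single[symmetric])
qed

lemma C_N_central: "C_N * x = x * (C_N :: nat \<Rightarrow>\<^sub>0 'n::{finite,linorder} OqQ)"
proof -
  have "C_N * (\<Sum>k\<in>Poly_Mapping.keys x. Poly_Mapping.single k (Poly_Mapping.lookup x k))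
    = (\<Sum>k\<in>Poly_Mapping.keys x. Poly_Mapping.single k (Poly_Mapping.lookup x k)) * (C_N :: nat \<Rightarrow>\<^sub>0 'n OqQ)"
    unfolding C_N_sm sum_distrib_left sum_distrib_right mult_single
    by (subst sum.swap) (simp add: com_central[OF OqQ.sm_com] add.commute)
  then show ?thesis by (simp only: poly_mapping_sum_single[symmetric])
qed

definition Tpoly :: "'n::{finite,linorder} \<Rightarrow> 'n \<Rightarrow> (nat \<Rightarrow>\<^sub>0 'n OqQ)" where
  "Tpoly i j = (if i = j then tvar else 0) + const (OqQ.Zm i j)"

lemma Am_top: "OqQ.Am (Suc CARD('n)) i j = (0 :: 'n::{finite,linorder} OqQ)"
proof -
  have "card K \<noteq> Suc CARD('n)" for K :: "'n set"
    using card_mono[OF finite subset_UNIV, of K] by auto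
  then have "{K :: 'n set. card K = Suc CARD('n) \<and> j \<in> K} = {}" by blast
  then show ?thesis by (simp only: OqQ.Am_def sum.empty)
qed

lemma shift_Apoly:
  "tvar * Apoly i j = (\<Sum>k\<le>CARD('n). Poly_Mapping.single (CARD('n) - k) (OqQ.Am (Suc k) i (j :: 'n::{finite,linorder})))"
    "Apoly i j * tvar = tvar * Apoly i j"
proof -
  let ?f = "\<lambda>k. Poly_Mapping.single (Suc CARD('n) - k) (OqQ.Am k i j)"
  have "tvar * Apoly i j = (\<Sum>k\<le>CARD('n). ?f k)"
    unfolding Apoly_def tvar_def sum_distrib_left mult_single by (rule sum.cong) (simp_all add: Suc_diff_le)
  also have "\<dots> = (\<Sum>k\<le>Suc CARD('n). ?f k)" by (simp add: Am_top)
  also have "\<dots> = ?f 0 + (\<Sum>k\<le>CARD('n). ?f (Suc k))" by (rule sum.atMost_Suc_shift)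
  finally show "tvar * Apoly i j = (\<Sum>k\<le>CARD('n). Poly_Mapping.single (CARD('n) - k) (OqQ.Am (Suc k) i j))"
    by (simp add: OqQ.Am_0)
  show "Apoly i j * tvar = tvar * Apoly i j"
    by (simp add: Apoly_def tvar_def sum_distrib_left sum_distrib_right mult_single)
qed

text \<open>The recursion summed against powers of \<open>t\<close>. For the second product \<open>A\<^sub>k\<close> is first moved past \<open>Z\<close>.\<close>

lemma Tpoly_Apoly:
  "(\<Sum>l\<in>UNIV. Tpoly i l * Apoly l j) = (if i = j then C_N else 0 :: nat \<Rightarrow>\<^sub>0 'n::{finite,linorder} OqQ)"
  "(\<Sum>l\<in>UNIV. Apoly i l * Tpoly l j) = (if i = j then C_N else 0 :: nat \<Rightarrow>\<^sub>0 'n OqQ)"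
proof -
  let ?N = "CARD('n)"
  have ss: "(\<Sum>l\<in>A. \<Sum>k\<le>?N. Poly_Mapping.single (?N - k) (g k l)) = (\<Sum>k\<le>?N. Poly_Mapping.single (?N - k) (\<Sum>l\<in>A. g k l))"
    for A :: "'n set" and g :: "nat \<Rightarrow> 'n \<Rightarrow> 'n OqQ"
    by (subst sum.swap) (simp add: additive_sum[of "Poly_Mapping.single _", OF single_zero single_add])
  have m: "(\<Sum>l\<in>UNIV. OqQ.Am k i l * OqQ.Zm l j) = (\<Sum>l\<in>UNIV. OqQ.Zm i l * OqQ.Am k l j)" for k and i j :: 'n
    using fun_cong[OF fun_cong[OF OqQ.Am_commute_Zm[of k]], of i j] by (simp add: OqQ.mm_def)
  have fin: "(\<Sum>k\<le>?N. Poly_Mapping.single (?N - k) (OqQ.Am (Suc k) i j))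
      + (\<Sum>k\<le>?N. Poly_Mapping.single (?N - k) (\<Sum>l\<in>UNIV. OqQ.Zm i l * OqQ.Am k l j)) = (if i = j then C_N else 0)"
    unfolding sum.distrib[symmetric] single_add[symmetric] add.commute[of "OqQ.Am (Suc _) _ _"] OqQ.main_identity_all C_N_sm
    by simp
  have "(\<Sum>l\<in>UNIV. Tpoly i l * Apoly l j) = tvar * Apoly i j + (\<Sum>l\<in>UNIV. const (OqQ.Zm i l) * Apoly l j)"
    by (simp add: Tpoly_def distrib_right sum.distrib if_distrib[of "\<lambda>x. x * _"] cong: if_cong)
  also have "(\<Sum>l\<in>UNIV. const (OqQ.Zm i l) * Apoly l j) = (\<Sum>k\<le>?N. Poly_Mapping.single (?N - k) (\<Sum>l\<in>UNIV. OqQ.Zm i l * OqQ.Am k l j))"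
    by (simp add: Apoly_def const_def sum_distrib_left mult_single ss)
  finally show "(\<Sum>l\<in>UNIV. Tpoly i l * Apoly l j) = (if i = j then C_N else 0)"
    unfolding shift_Apoly(1) fin .
  have "(\<Sum>l\<in>UNIV. Apoly i l * Tpoly l j) = tvar * Apoly i j + (\<Sum>l\<in>UNIV. Apoly i l * const (OqQ.Zm l j))"
    by (simp add: Tpoly_def distrib_left sum.distrib if_distrib[of "\<lambda>x. _ * x"] shift_Apoly(2) cong: if_cong)
  also have "(\<Sum>l\<in>UNIV. Apoly i l * const (OqQ.Zm l j)) = (\<Sum>k\<le>?N. Poly_Mapping.single (?N - k) (\<Sum>l\<in>UNIV. OqQ.Zm i l * OqQ.Am k l j))"
    by (simp add: Apoly_def const_def sum_distrib_right mult_single ss m)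
  finally show "(\<Sum>l\<in>UNIV. Apoly i l * Tpoly l j) = (if i = j then C_N else 0)"
    unfolding shift_Apoly(1) fin .
qed

section \<open>The inverse over the localized algebra\<close>

lemma to_loc_hom: "to_loc 0 = 0" "to_loc (x + y) = to_loc x + to_loc y" "to_loc (x * y) = to_loc x * to_loc y"
  by (simp_all add: to_loc.abs_eq zero_Oloc_def plus_Oloc.abs_eq times_Oloc.abs_eq const_def single_add mult_single)

lemma to_loc_sum: "to_loc (sum f A) = (\<Sum>a\<in>A. to_loc (f a))"
  by (rule additive_sum) (simp_all add: to_loc_hom)

lemma matrix_inv_eqI:
  assumes "A ** B = mat 1" "B ** A = mat (1 :: 'a::semiring_1)"
  shows "invertible A" "matrix_inv A = (B :: ('a, 'n::finite) sqmat)"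
proof -
  show inv: "invertible A" using assms by (auto simp: invertible_def)
  have "A ** matrix_inv A = mat 1"
    unfolding matrix_inv_def by (rule someI2_ex) (use assms in auto)
  then have "B ** (A ** matrix_inv A) = B" by simp
  then show "matrix_inv A = B" by (simp add: matrix_mul_assoc assms(2))
qed

text \<open>Over the localization \<open>C\<^sub>N\<close> is a central unit, so \<open>Tpoly_Apoly\<close> exhibits a two-sided inverse.\<close>

lemma inverse_tI_plus_XY:
  shows "invertible (tI_plus_XY :: ('n::{finite,linorder} Oloc, 'n) sqmat)"
    and "matrix_inv tI_plus_XY $ i $ (j :: 'n) = C_N_inverse * to_loc (to_Ot (numerator i j))"
proof -
  let ?B = "(\<chi> i j. C_N_inverse * to_loc (Apoly i j)) :: ('n Oloc, 'n) sqmat"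
  have T: "tI_plus_XY $ i $ j = to_loc (Tpoly i j)" for i j :: 'n
    by (simp add: tI_plus_XY_def Tpoly_def to_loc_hom mat_def OqQ.Zm_def matrix_matrix_mult_def)
  have C: "C_N_inverse * to_loc C_N = (1 :: 'n Oloc)"
    using C_N_mult_inverse by (simp add: C_N_inverse_central)
  have swap: "x * (C_N_inverse * y) = C_N_inverse * (x * y)" for x y :: "'n Oloc"
    by (simp only: mult.assoc[symmetric] C_N_inverse_central[of x])
  have "(tI_plus_XY ** ?B) $ i $ j = mat 1 $ i $ j" for i j :: 'n
  proof -
    have "(tI_plus_XY ** ?B) $ i $ j = C_N_inverse * to_loc (\<Sum>l\<in>UNIV. Tpoly i l * Apoly l j)"
      by (simp add: matrix_matrix_mult_def T to_loc_sum to_loc_hom sum_distrib_left swap)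
    then show ?thesis by (simp add: Tpoly_Apoly C mat_def to_loc_hom)
  qed
  then have 1: "tI_plus_XY ** ?B = mat 1" by (simp add: vec_eq_iff)
  have "(?B ** tI_plus_XY) $ i $ j = mat 1 $ i $ j" for i j :: 'n
  proof -
    have "(?B ** tI_plus_XY) $ i $ j = C_N_inverse * to_loc (\<Sum>l\<in>UNIV. Apoly i l * Tpoly l j)"
      by (simp add: matrix_matrix_mult_def T to_loc_sum to_loc_hom sum_distrib_left mult.assoc)
    then show ?thesis by (simp add: Tpoly_Apoly C mat_def to_loc_hom)
  qed
  then have 2: "?B ** tI_plus_XY = mat 1" by (simp add: vec_eq_iff)
  show "invertible (tI_plus_XY :: ('n Oloc, 'n) sqmat)" by (rule matrix_inv_eqI(1)[OF 1 2])
  show "matrix_inv tI_plus_XY $ i $ j = C_N_inverse * to_loc (to_Ot (numerator i j))"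
    by (simp add: matrix_inv_eqI(2)[OF 1 2] to_Ot_numerator)
qed

section \<open>Signed Laurent monomials and their specializations\<close>

definition mono_F :: "complex \<Rightarrow> ('n::linorder indet \<Rightarrow>\<^sub>0 int) \<Rightarrow> 'n rat_fun" where
  "mono_F s m = Fract (Poly_Mapping.single m s) 1"

lemma mono_F_mult: "mono_F s m * mono_F s' m' = mono_F (s * s') (m + m')"
  by (simp add: mono_F_def mult_single)

lemma mono_F_1: "mono_F 1 0 = 1"
  by (simp add: mono_F_def One_fract_def)

text \<open>A group under multiplication; it contains all coefficients of the numerator.\<close>

definition signed_mono :: "'n::linorder rat_fun set" where
  "signed_mono = {mono_F s m | s m. s \<in> {1, - 1}}"

lemma signed_monoI: "s \<in> {1, - 1} \<Longrightarrow> mono_F s m \<in> signed_mono"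
  unfolding signed_mono_def by blast

lemma signed_mono_1: "1 \<in> signed_mono"
  unfolding mono_F_1[symmetric] by (rule signed_monoI) simp

lemma signed_mono_mult:
  assumes "x \<in> signed_mono" "y \<in> signed_mono"
  shows "x * y \<in> signed_mono"
proof -
  obtain s m s' m' where eq: "x = mono_F s m" "y = mono_F s' m'" and s: "s \<in> {1, - 1}" "s' \<in> {1, - 1}"
    using assms unfolding signed_mono_def by blast
  have "s * s' \<in> {1, - 1}" using s by auto
  then show ?thesis unfolding eq mono_F_mult by (rule signed_monoI)
qed

lemma signed_mono_uminus:
  assumes "x \<in> signed_mono"
  shows "- x \<in> signed_mono"
proof -
  obtain s m where eq: "x = mono_F s m" and s: "s \<in> {1, - 1}"
    using assms unfolding signed_mono_def by blast
  have "- x = mono_F (- s) m" unfolding eq by (simp add: mono_F_def single_uminus)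
  moreover have "- s \<in> {1, - 1}" using s by auto
  ultimately show ?thesis by (simp only: signed_monoI)
qed

lemma signed_mono_prod: "(\<And>a. a \<in> A \<Longrightarrow> f a \<in> signed_mono) \<Longrightarrow> prod f A \<in> signed_mono"
  by (induction A rule: infinite_finite_induct) (simp_all add: signed_mono_1 signed_mono_mult)

lemma signed_mono_power: "x \<in> signed_mono \<Longrightarrow> x ^ k \<in> signed_mono"
  by (induction k) (simp_all add: signed_mono_1 signed_mono_mult)

lemma mono_F_indet: "mono_F 1 (Poly_Mapping.single v 1) = indet_F v"
  by (simp add: mono_F_def indet_F_def)

lemma signed_mono_q: "q \<in> signed_mono"
  unfolding q_def mono_F_indet[symmetric] by (rule signed_monoI) simp

lemma signed_mono_qij: "qij i j \<in> signed_mono"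
proof -
  have quot: "q ^ 2 / indet_F v \<in> signed_mono" for v :: "'a indet"
  proof -
    have "mono_F 1 (- Poly_Mapping.single v 1) * indet_F v = mono_F 1 0"
      unfolding mono_F_indet[symmetric] mono_F_mult by simp
    then have inv: "mono_F 1 (- Poly_Mapping.single v 1) = inverse (indet_F v)"
      unfolding mono_F_1 by (metis inverse_unique mult.commute)
    show ?thesis
      unfolding divide_inverse inv[symmetric]
      by (rule signed_mono_mult[OF signed_mono_power[OF signed_mono_q] signed_monoI]) simp
  qed
  have "indet_F v \<in> signed_mono" for v :: "'a indet"
    unfolding mono_F_indet[symmetric] by (rule signed_monoI) simp
  with quot show ?thesis unfolding qij_def by (simp add: signed_mono_1)
qed

lemma signed_mono_eps:
  assumes "distinct c"
  shows "OqQ.eps_c c \<in> signed_mono \<and> OqQ.eps_r (c :: 'n::{finite,linorder} list) \<in> signed_mono"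
  using assms
proof (induction c)
  case Nil
  show ?case by (simp add: signed_mono_1)
next
  case (Cons x c)
  have inv: "OqQ.inv_c x y \<in> signed_mono \<and> OqQ.inv_r x y \<in> signed_mono" if "y \<in> set c" for y
  proof -
    have "y \<noteq> x" using Cons.prems that by auto
    then show ?thesis
      unfolding OqQ.inv_c_def OqQ.inv_r_def
      by (simp only: if_False split: if_split) (intro conjI impI signed_mono_1 signed_mono_uminus signed_mono_qij)
  qed
  have d: "distinct c" using Cons.prems by simp
  have p: "(\<Prod>y\<in>set c. OqQ.inv_c x y) \<in> signed_mono" "(\<Prod>y\<in>set c. OqQ.inv_r x y) \<in> signed_mono"
    by (rule signed_mono_prod, rule inv[THEN conjunct1], assumption)
       (rule signed_mono_prod, rule inv[THEN conjunct2], assumption)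
  show ?case
    unfolding OqQ.eps_c_Cons[OF d] OqQ.eps_r_Cons[OF d]
    by (rule conjI[OF signed_mono_mult[OF p(1) Cons.IH[OF d, THEN conjunct1]]
          signed_mono_mult[OF p(2) Cons.IH[OF d, THEN conjunct2]]])
qed

lemma signed_mono_wt_prod: "wt_prod L \<in> signed_mono"
  unfolding wt_prod_def by (intro signed_mono_prod signed_mono_power signed_mono_q)

lemma mono_F_powi: "mono_F 1 (Poly_Mapping.single v k) = indet_F v powi k"
proof -
  have nat: "mono_F 1 (Poly_Mapping.single v (int n)) = indet_F v ^ n" for n
  proof (induction n)
    case 0
    show ?case by (simp add: mono_F_1)
  next
    case (Suc n)
    have "mono_F 1 (Poly_Mapping.single v (int (Suc n))) = mono_F 1 (Poly_Mapping.single v 1) * mono_F 1 (Poly_Mapping.single v (int n))"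
      unfolding mono_F_mult single_add[symmetric] by simp
    then show ?case unfolding mono_F_indet Suc by simp
  qed
  show ?thesis
  proof (cases "k \<ge> 0")
    case True
    then show ?thesis using nat[of "nat k"] by (simp add: power_int_def)
  next
    case False
    then have "mono_F 1 (Poly_Mapping.single v k) * indet_F v ^ nat (- k) = 1"
      unfolding nat[symmetric] mono_F_mult single_add[symmetric] by (simp add: mono_F_1)
    then show ?thesis using False by (simp add: power_int_def field_simps)
  qed
qed

lemma finite_UNIV_indet: "finite (UNIV :: 'n::{finite,linorder} indet set)"
proof -
  have "x \<in> range Abs_indet" for x :: "'n indet"
    by (metis Rep_indet_inverse rangeI)
  then have "(UNIV :: 'n indet set) \<subseteq> Abs_indet ` UNIV" by blast
  then show ?thesis by (rule finite_surj[OF finite])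
qed

lemma UNIV_indet: "UNIV = insert ind_q ((\<lambda>(i, j). ind i j) ` {(i, j :: 'n::linorder). i < j})"
proof -
  have "v = ind_q \<or> (\<exists>i j. i < j \<and> v = ind i j)" for v :: "'n indet"
  proof (cases "Rep_indet v")
    case None
    then show ?thesis using Rep_indet_inverse[of v] by (simp add: ind_q_def)
  next
    case (Some p)
    then have "Rep_indet v = Some (fst p, snd p)" by simp
    moreover from this have "fst p < snd p" using Rep_indet[of v] by simp
    ultimately show ?thesis using Rep_indet_inverse[of v] unfolding ind_def by metis
  qed
  then show ?thesis by auto
qed

text \<open>Every exponent vector is realized by \<open>q\<close> and the \<open>q\<^sub>k\<^sub>l\<close> with \<open>k < l\<close>, so the exponents of the others are set to \<open>0\<close>.\<close>

lemma mono_F_expand: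
  "mono_F s m = const_F s * q powi Poly_Mapping.lookup m ind_q
     * (\<Prod>(k, l) \<in> UNIV. qij k l powi (if k < l then Poly_Mapping.lookup m (ind k (l :: 'n::{finite,linorder})) else 0))"
proof -
  let ?P = "{(i, j :: 'n). i < j}"
  let ?f = "\<lambda>v. indet_F v powi Poly_Mapping.lookup m v"
  have pr: "(\<Prod>v\<in>A. mono_F 1 (g v)) = mono_F 1 (\<Sum>v\<in>A. g v)" for A and g :: "'n indet \<Rightarrow> 'n indet \<Rightarrow>\<^sub>0 int"
    by (induction A rule: infinite_finite_induct) (simp_all add: mono_F_1 mono_F_mult)
  have inj: "inj_on (\<lambda>(i, j). ind i j) ?P" and nq: "ind_q \<notin> (\<lambda>(i, j). ind i j) ` ?P"
    by (auto simp: inj_on_def ind_def ind_q_def Abs_indet_inject)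
  have "mono_F s m = const_F s * mono_F 1 m"
    using mono_F_mult[of s 0 1 m] by (simp add: mono_F_def[of s 0] const_F_def)
  also have "mono_F 1 m = (\<Prod>v\<in>Poly_Mapping.keys m. ?f v)"
    by (simp only: mono_F_powi[symmetric] pr poly_mapping_sum_single[symmetric])
  also have "\<dots> = (\<Prod>v\<in>UNIV. ?f v)"
    by (rule prod.mono_neutral_left[OF finite_UNIV_indet]) (auto simp: in_keys_iff)
  also have "\<dots> = ?f ind_q * (\<Prod>v\<in>(\<lambda>(i, j). ind i j) ` ?P. ?f v)"
    unfolding UNIV_indet by (rule prod.insert) (simp_all add: nq finite_subset[OF subset_UNIV finite_UNIV_indet])
  also have "(\<Prod>v\<in>(\<lambda>(i, j). ind i j) ` ?P. ?f v) = (\<Prod>(k, l)\<in>?P. ?f (ind k l))"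
    unfolding prod.reindex[OF inj] by (rule prod.cong) auto
  also have "\<dots> = (\<Prod>(k, l) \<in> UNIV. qij k l powi (if k < l then Poly_Mapping.lookup m (ind k l) else 0))"
    by (rule prod.mono_neutral_cong_left) (auto simp: qij_def split: if_splits)
  finally show ?thesis by (simp add: q_def mult.assoc)
qed

lemma has_value_at_mono_F:
  assumes "s \<noteq> 0"
  shows "has_value_at (mono_F s m) (s * (\<Prod>v\<in>Poly_Mapping.keys m. \<rho> v powi Poly_Mapping.lookup m v)) \<rho>"
proof -
  have one: "eval_laurent \<rho> 1 = 1"
    by (simp add: eval_laurent_def flip: single_one)
  have "eval_laurent \<rho> (Poly_Mapping.single m s) = s * (\<Prod>v\<in>Poly_Mapping.keys m. \<rho> v powi Poly_Mapping.lookup m v)"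
    using assms by (simp add: eval_laurent_def)
  then show ?thesis
    unfolding has_value_at_def mono_F_def
    by (intro exI[of _ "Poly_Mapping.single m s"] exI[of _ 1]) (simp add: one)
qed

lemma mono_F_value_const:
  assumes "s \<noteq> 0" "z \<noteq> 0"
  shows "has_value_at (mono_F s m) (s * z powi total_exp m) (\<lambda>_. z)"
proof -
  have "(\<Prod>v\<in>A. z powi f v) = z powi (\<Sum>v\<in>A. f v)" for A and f :: "'a indet \<Rightarrow> int"
    using assms(2) by (induction A rule: infinite_finite_induct) (simp_all add: power_int_add)
  then show ?thesis
    using has_value_at_mono_F[OF assms(1), of m "\<lambda>_. z"] by (simp add: total_exp_def)
qed

text \<open>As a function of the value of \<open>q\<close> alone, a monomial is a nonzero constant times an integral power.\<close>

lemma mono_F_limit: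
  assumes "s \<noteq> 0" "\<forall>v. \<rho> v \<noteq> 0"
  shows "\<exists>f l. (\<forall>z. z \<noteq> 0 \<longrightarrow> has_value_at (mono_F s m) (f z) (\<rho>(ind_q := z))) \<and> (f \<longlongrightarrow> l) (at 1) \<and> l \<noteq> 0"
proof (intro exI conjI allI impI)
  let ?f = "\<lambda>z. s * (\<Prod>v\<in>Poly_Mapping.keys m. (\<rho>(ind_q := z)) v powi Poly_Mapping.lookup m v)"
  show "has_value_at (mono_F s m) (?f z) (\<rho>(ind_q := z))" for z
    by (rule has_value_at_mono_F[OF assms(1)])
  have nz: "(\<rho>(ind_q := 1)) v \<noteq> 0" for v using assms(2) by simp
  have "((\<lambda>z. (\<rho>(ind_q := z)) v) \<longlongrightarrow> (\<rho>(ind_q := 1)) v) (at 1)" for v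
    by (cases "v = ind_q") simp_all
  then show "(?f \<longlongrightarrow> ?f 1) (at 1)"
    by (intro tendsto_mult tendsto_const tendsto_prod tendsto_power_int nz)
  show "?f 1 \<noteq> 0" using nz assms(1) by simp
qed

section \<open>The coefficients of the numerator\<close>

type_synonym 'n term_index = "'n set \<times> 'n set \<times> 'n list \<times> 'n list"

definition term_indices :: "'n::{finite,linorder} \<Rightarrow> 'n \<Rightarrow> 'n term_index set" where
  "term_indices i j = (SIGMA K:{K. i \<in> K \<and> j \<in> K}. SIGMA L:{L. card L = card K - 1}.
     permutations_of_set L \<times> permutations_of_set L)"

fun term_word :: "'n::{finite,linorder} \<Rightarrow> 'n \<Rightarrow> 'n term_index \<Rightarrow> 'n gen list" where
  "term_word i j (K, L, c, c') =
     rev (map2 GY c (sorted_list_of_set (K - {i}))) @ map2 GX (sorted_list_of_set (K - {j})) c'"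

fun term_coeff :: "'n::{finite,linorder} \<Rightarrow> 'n \<Rightarrow> 'n term_index \<Rightarrow> 'n rat_fun" where
  "term_coeff i j (K, L, c, c') =
     mq_less i K * mq_greater K j * (OqQ.eps_r c * wt_prod L * (OqQ.eps_c c' * wt_prod L))"

lemma finite_term_indices: "finite (term_indices i j)"
  unfolding term_indices_def by (intro finite_SigmaI) auto

lemma numerator_terms:
  "numerator i j = (\<Sum>p\<in>term_indices i j.
     Poly_Mapping.single (CARD('n) - card (fst p)) (Poly_Mapping.single (Word (term_word i j p)) (term_coeff i (j :: 'n::{finite,linorder}) p)))"
proof -
  let ?F = "\<lambda>K L c c'. Poly_Mapping.single (Word (term_word i j (K, L, c, c'))) (term_coeff i j (K, L, c, c'))"
  have inner: "scal (mq_less i K) * scal (mq_greater K j) *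
          (\<Sum>L | card L = card K - 1. minor_DY L (K - {i}) * minor_XD (K - {j}) L)
     = (\<Sum>L\<in>{L. card L = card K - 1}. \<Sum>c\<in>permutations_of_set L. \<Sum>c'\<in>permutations_of_set L. ?F K L c c')"
    if K: "i \<in> K" "j \<in> K" for K
    unfolding sum_distrib_left
  proof (rule sum.cong[OF refl])
    fix L :: "'n set" assume "L \<in> {L. card L = card K - 1}"
    then have c: "card (K - {i}) = card L" "card (K - {j}) = card L" using K by (simp_all add: card_Diff_singleton)
    show "scal (mq_less i K) * scal (mq_greater K j) * (minor_DY L (K - {i}) * minor_XD (K - {j}) L)
      = (\<Sum>c\<in>permutations_of_set L. \<Sum>c'\<in>permutations_of_set L. ?F K L c c')"
      unfolding minor_DY_words[OF c(1)] minor_XD_words[OF c(2)] scal_mult[symmetric] sum_product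
      unfolding sum_distrib_left mult_single scal_single plus_freemon_def freemon.sel term_word.simps term_coeff.simps ..
  qed
  have single_sum: "Poly_Mapping.single n (\<Sum>a\<in>A. f a) = (\<Sum>a\<in>A. Poly_Mapping.single n (f a))"
    for n :: nat and A and f :: "'z \<Rightarrow> 'n free_alg"
    by (rule additive_sum) (simp_all add: single_add)
  have "numerator i j = (\<Sum>K\<in>{K. i \<in> K \<and> j \<in> K}. \<Sum>L\<in>{L. card L = card K - 1}. \<Sum>c\<in>permutations_of_set L.
      \<Sum>c'\<in>permutations_of_set L. Poly_Mapping.single (CARD('n) - card K) (?F K L c c'))"
    unfolding numerator_def tvar_power_const by (rule sum.cong[OF refl]) (simp only: inner mem_Collect_eq single_sum)
  also have "\<dots> = (\<Sum>(K, L, c, c')\<in>term_indices i j. Poly_Mapping.single (CARD('n) - card K) (?F K L c c'))"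
    unfolding term_indices_def by (simp add: sum.Sigma sum.cartesian_product)
  also have "\<dots> = (\<Sum>p\<in>term_indices i j.
     Poly_Mapping.single (CARD('n) - card (fst p)) (Poly_Mapping.single (Word (term_word i j p)) (term_coeff i j p)))"
  proof (rule sum.cong[OF refl])
    fix p
    show "(case p of (K, L, c, c') \<Rightarrow> Poly_Mapping.single (CARD('n) - card K) (?F K L c c'))
      = Poly_Mapping.single (CARD('n) - card (fst p)) (Poly_Mapping.single (Word (term_word i j p)) (term_coeff i j p))"
      by (cases p) simp
  qed
  finally show ?thesis .
qed

lemma concat_map2:
  assumes "length a = length c" "\<And>x y. f (g x y) = [h x y]"
  shows "concat (map f (map2 g a c)) = map2 h a c"
  using assms(1) by (induction a c rule: list_induct2) (simp_all add: assms(2))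

lemma concat_map2_Nil:
  assumes "\<And>x y. f (g x y) = []"
  shows "concat (map f (rev (map2 g a c))) = []"
  by (simp add: case_prod_beta' assms)

lemma map2_proj:
  assumes "length a = length c"
  shows "map2 (\<lambda>x y. x) a c = a" "map2 (\<lambda>x y. y) a c = c"
  using assms by (induction a c rule: list_induct2) simp_all

text \<open>The row indices of the \<open>Y\<close>-letters, read backwards, give \<open>c\<close>, their column indices give \<open>K - {i}\<close>, and the column indices
  of the \<open>X\<close>-letters give \<open>c'\<close>.\<close>

lemma inj_term_word: "inj_on (term_word i j) (term_indices i (j :: 'n::{finite,linorder}))"
proof (rule inj_onI)
  fix p p' assume p: "p \<in> term_indices i j" "p' \<in> term_indices i j" and eq: "term_word i j p = term_word i j p'"
  define y1 where "y1 g = (case g of GY a b \<Rightarrow> [a] | GX a b \<Rightarrow> [])" for g :: "'n gen"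
  define y2 where "y2 g = (case g of GY a b \<Rightarrow> [b] | GX a b \<Rightarrow> [])" for g :: "'n gen"
  define x2 where "x2 g = (case g of GX a b \<Rightarrow> [b] | GY a b \<Rightarrow> [])" for g :: "'n gen"
  define dec where "dec ws = (insert i (set (concat (map y2 (rev ws)))), set (concat (map y1 (rev ws))),
     concat (map y1 (rev ws)), concat (map x2 ws))" for ws :: "'n gen list"
  have decode: "dec (term_word i j r) = r" if r: "r \<in> term_indices i j" for r
  proof -
    obtain K L c c' where rr: "r = (K, L, c, c')" by (cases r)
    let ?a = "sorted_list_of_set (K - {i})" and ?b = "sorted_list_of_set (K - {j})"
    have K: "i \<in> K" "j \<in> K" "card L = card K - 1" and c: "set c = L" "distinct c" "set c' = L" "distinct c'"
      using r by (auto simp: rr term_indices_def permutations_of_set_def)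
    have "length c = card L" "length c' = card L"
      using distinct_card[OF c(2)] distinct_card[OF c(4)] unfolding c(1,3) by (simp_all only:)
    moreover have "length ?a = card L" "length ?b = card L"
      unfolding K(3) length_sorted_list_of_set by (rule card_Diff_singleton[OF K(1)], rule card_Diff_singleton[OF K(2)])
    ultimately have len: "length c = length ?a" "length ?b = length c'" by (simp_all only:)
    have y1: "concat (map y1 (map2 GY c ?a)) = c"
      by (rule trans[OF concat_map2[OF len(1)] map2_proj(1)[OF len(1)]]) (simp add: y1_def)
    have y2: "concat (map y2 (map2 GY c ?a)) = ?a"
      by (rule trans[OF concat_map2[OF len(1)] map2_proj(2)[OF len(1)]]) (simp add: y2_def)
    have x2: "concat (map x2 (map2 GX ?b c')) = c'"
      by (rule trans[OF concat_map2[OF len(2)] map2_proj(2)[OF len(2)]]) (simp add: x2_def)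
    have nil: "concat (map y1 (rev (map2 GX ?b c'))) = []" "concat (map y2 (rev (map2 GX ?b c'))) = []"
      "concat (map x2 (rev (map2 GY c ?a))) = []"
      by (rule concat_map2_Nil, simp add: y1_def y2_def x2_def)+
    have set_a: "insert i (set ?a) = K" using K(1) by auto
    show ?thesis
      unfolding rr dec_def term_word.simps rev_append rev_rev_ident map_append concat_append y1 y2 x2 nil append_Nil set_a c(1) ..
  qed
  show "p = p'"
    by (rule trans[OF trans[OF decode[OF p(1), symmetric] arg_cong[where f = dec, OF eq]] decode[OF p(2)]])
qed

lemma word_coeff_terms:
  "word_coeff (numerator i j) w = (\<Sum>p\<in>term_indices i j.
     if Word (term_word i j p) = w then Poly_Mapping.single (CARD('n) - card (fst p)) (term_coeff i (j :: 'n::{finite,linorder}) p) else 0)"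
proof -
  have lk: "Poly_Mapping.lookup (word_coeff P w) k = Poly_Mapping.lookup (Poly_Mapping.lookup P k) w"
    for P :: "nat \<Rightarrow>\<^sub>0 'n free_alg" and k
    by (simp add: word_coeff_def Poly_Mapping.map.rep_eq when_def)
  have "word_coeff (numerator i j) w = (\<Sum>p\<in>term_indices i j. word_coeff
     (Poly_Mapping.single (CARD('n) - card (fst p)) (Poly_Mapping.single (Word (term_word i j p)) (term_coeff i j p))) w)"
    unfolding numerator_terms
    by (rule additive_sum) (simp_all add: poly_mapping_eq_iff fun_eq_iff lk lookup_add)
  also have "\<dots> = (\<Sum>p\<in>term_indices i j.
     if Word (term_word i j p) = w then Poly_Mapping.single (CARD('n) - card (fst p)) (term_coeff i j p) else 0)"
    by (rule sum.cong[OF refl]) (auto simp: poly_mapping_eq_iff fun_eq_iff lk lookup_single when_def)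
  finally show ?thesis .
qed

lemma signed_mono_term_coeff:
  assumes "p \<in> term_indices i j"
  shows "term_coeff i j p \<in> signed_mono"
proof -
  obtain K L c c' where p: "p = (K, L, c, c')" by (cases p)
  then have "distinct c" "distinct c'" using assms by (auto simp: term_indices_def permutations_of_set_def)
  then show ?thesis
    unfolding p term_coeff.simps mq_less_def mq_greater_def
    by (intro signed_mono_mult signed_mono_prod signed_mono_uminus signed_mono_qij signed_mono_wt_prod
        signed_mono_eps[THEN conjunct1] signed_mono_eps[THEN conjunct2])
qed

text \<open>At most one term has the word \<open>w\<close>.\<close>

lemma word_coeff_numerator:
  assumes "word_coeff (numerator i j) w \<noteq> 0"
  obtains s m d where "s \<in> {1, - 1}" "word_coeff (numerator i (j :: 'n::{finite,linorder})) w = Poly_Mapping.single d (mono_F s m)"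
proof -
  let ?g = "\<lambda>p. if Word (term_word i j p) = w then Poly_Mapping.single (CARD('n) - card (fst p)) (term_coeff i j p) else 0"
  have "\<exists>p\<in>term_indices i j. Word (term_word i j p) = w"
  proof (rule ccontr)
    assume "\<not> ?thesis"
    then have "word_coeff (numerator i j) w = 0"
      unfolding word_coeff_terms by (intro sum.neutral) simp
    with assms show False by contradiction
  qed
  then obtain p where p: "p \<in> term_indices i j" "Word (term_word i j p) = w" by blast
  have "word_coeff (numerator i j) w = (\<Sum>p'\<in>term_indices i j. if p' = p then ?g p' else 0)"
    unfolding word_coeff_terms
  proof (rule sum.cong[OF refl])
    fix p' assume p': "p' \<in> term_indices i j"
    have "p' = p" if w: "Word (term_word i j p') = w"
    proof (rule inj_onD[OF inj_term_word _ p' p(1)])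
      show "term_word i j p' = term_word i j p"
        by (rule freemon.inject[THEN iffD1, OF trans[OF w p(2)[symmetric]]])
    qed
    then show "?g p' = (if p' = p then ?g p' else 0)" by (simp split: if_split)
  qed
  also have "\<dots> = Poly_Mapping.single (CARD('n) - card (fst p)) (term_coeff i j p)"
    using p by (simp add: finite_term_indices)
  finally have w: "word_coeff (numerator i j) w = Poly_Mapping.single (CARD('n) - card (fst p)) (term_coeff i j p)" .
  obtain s m where "term_coeff i j p = mono_F s m" "s \<in> {1, - 1}"
    using signed_mono_term_coeff[OF p(1)] unfolding signed_mono_def by blast
  then show thesis using that[of s "CARD('n) - card (fst p)" m] w by simp
qed

theorem theorem1p2:
  assumes "2 \<le> CARD('n::{finite,linorder})"
  shows "(\<forall>x :: nat \<Rightarrow>\<^sub>0 'n OqQ. C_N * x = x * C_N)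
    \<and> invertible (tI_plus_XY :: ('n Oloc, 'n) sqmat)
    \<and> (\<forall>i j :: 'n. matrix_inv tI_plus_XY $ i $ j = C_N_inverse * to_loc (to_Ot (numerator i j)))
    \<and> (\<forall>(i :: 'n) j w. word_coeff (numerator i j) w \<noteq> 0 \<longrightarrow>
        (\<exists>s \<in> {1, -1 :: complex}. \<exists>m x. word_coeff (numerator i j) w = Poly_Mapping.single m x
          \<and> (\<exists>(e :: int) (b :: 'n \<Rightarrow> 'n \<Rightarrow> int).
                x = const_F s * q powi e * (\<Prod>(k, l) \<in> UNIV. qij k l powi b k l))
          \<and> (\<exists>e :: int. \<forall>z. z \<noteq> 0 \<longrightarrow> has_value_at x (s * z powi e) (\<lambda>_. z))
          \<and> (\<forall>\<rho>. (\<forall>v. \<rho> v \<noteq> 0) \<longrightarrow> 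
              (\<exists>f l. (\<forall>z. z \<noteq> 0 \<longrightarrow> has_value_at x (f z) (\<rho>(ind_q := z)))
                 \<and> (f \<longlongrightarrow> l) (at 1) \<and> l \<noteq> 0))))"
proof (intro conjI allI impI)
  show "C_N * x = x * C_N" for x :: "nat \<Rightarrow>\<^sub>0 'n OqQ" by (rule C_N_central)
  show "invertible (tI_plus_XY :: ('n Oloc, 'n) sqmat)"
    and "matrix_inv tI_plus_XY $ i $ j = C_N_inverse * to_loc (to_Ot (numerator i j))" for i j :: 'n
    by (rule inverse_tI_plus_XY(1), rule inverse_tI_plus_XY(2))
next
  fix i j :: 'n and w assume nz: "word_coeff (numerator i j) w \<noteq> 0"
  obtain s m d where s: "s \<in> {1, - 1 :: complex}" and w: "word_coeff (numerator i j) w = Poly_Mapping.single d (mono_F s m)"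
    by (rule word_coeff_numerator[OF nz])
  have s0: "s \<noteq> 0" using s by auto
  have b: "\<exists>(e :: int) (b :: 'n \<Rightarrow> 'n \<Rightarrow> int). mono_F s m = const_F s * q powi e * (\<Prod>(k, l) \<in> UNIV. qij k l powi b k l)"
    by (rule exI[of _ "Poly_Mapping.lookup m ind_q"],
        rule exI[of _ "\<lambda>k l. if k < l then Poly_Mapping.lookup m (ind k l) else 0"]) (rule mono_F_expand)
  have c: "\<exists>e :: int. \<forall>z. z \<noteq> 0 \<longrightarrow> has_value_at (mono_F s m) (s * z powi e) (\<lambda>_. z)"
    by (intro exI[of _ "total_exp m"] allI impI, rule mono_F_value_const[OF s0])
  have lim: "\<forall>\<rho>. (\<forall>v. \<rho> v \<noteq> 0) \<longrightarrow>
      (\<exists>f l. (\<forall>z. z \<noteq> 0 \<longrightarrow> has_value_at (mono_F s m) (f z) (\<rho>(ind_q := z))) \<and> (f \<longlongrightarrow> l) (at 1) \<and> l \<noteq> 0)"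
    by (intro allI impI, rule mono_F_limit[OF s0])
  show "\<exists>s \<in> {1, -1 :: complex}. \<exists>m x. word_coeff (numerator i j) w = Poly_Mapping.single m x
          \<and> (\<exists>(e :: int) (b :: 'n \<Rightarrow> 'n \<Rightarrow> int).
                x = const_F s * q powi e * (\<Prod>(k, l) \<in> UNIV. qij k l powi b k l))
          \<and> (\<exists>e :: int. \<forall>z. z \<noteq> 0 \<longrightarrow> has_value_at x (s * z powi e) (\<lambda>_. z))
          \<and> (\<forall>\<rho>. (\<forall>v. \<rho> v \<noteq> 0) \<longrightarrow> 
              (\<exists>f l. (\<forall>z. z \<noteq> 0 \<longrightarrow> has_value_at x (f z) (\<rho>(ind_q := z)))
                 \<and> (f \<longlongrightarrow> l) (at 1) \<and> l \<noteq> 0))"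
    by (rule bexI[OF _ s], rule exI[of _ d], rule exI[of _ "mono_F s m"]) (intro conjI w b c lim)
qed

end
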